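(* Let $p\ge 5$ be a prime and let $S\in\{R,N\}^4$. Let $n_p(S)$, the curves $C_S^a$, $C_S$, the set $C_S^{a,\circ}(\mathbb F_p)$ and the Frobenius traces $a_0=a_0(p)$, $a_1=a_1(p)$, $a_4=a_4(p)$ be as defined in the context. Then the curve $C_S$ has genus $5$ and $$n_p(S)=2^{-4}\,|C_S^{a,\circ}(\mathbb F_p)|.$$ Moreover $$n_p(S)=\frac{p}{16}-\frac{A_{S,\,p \bmod 4}}{16}+C_{S,\,p\bmod 24},$$ where $A_{S,\,p\bmod 4}$ and $C_{S,\,p\bmod 24}$ are given by the following two tables (in particular $C_{S,\,p\bmod 24}$ is bounded by an absolute constant). Values of $A_{S,\,p\bmod 4}$: $$\begin{array}{l|c|c} S & p\equiv 1 \pmod 4 & p\equiv 3\pmod 4\\ \hline RRRR & 2a_0+2a_1+a_4 & a_4\\ RRNR & -2a_0-a_4 & 2a_1-a_4\\ RNRR & -2a_0-a_4 & -2a_1-a_4\\ NRRR & -2a_1-a_4 & -a_4\\ RRRN & -2a_1-a_4 & -a_4\\ RRNN & a_4 & -2a_1+a_4\\ NNRR & a_4 & 2a_1+a_4\\ NRRN & -2a_0+2a_1+a_4 & a_4\\ RNNR & 2a_0-2a_1+a_4 & a_4\\ RNRN & a_4 & 2a_1+a_4\\ NRNR & a_4 & -2a_1+a_4\\ NNNR & 2a_1-a_4 & -a_4\\ RNNN & 2a_1-a_4 & -a_4\\ NRNN & 2a_0-a_4 & 2a_1-a_4\\ NNRN & 2a_0-a_4 & -2a_1-a_4\\ NNNN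 & -2a_0-2a_1+a_4 & a_4 \end{array}$$ Values of $16\cdot C_{S,\,p\bmod 24}$ (columns are indexed by the residue of $p$ modulo $24$): $$\begin{array}{l|r|r|r|r|r|r|r|r} S & 1 & 5 & 7 & 11 & 13 & 17 & 19 & 23\\ \hline RRRR & -39 & -7 & -7 & -7 & -7 & -23 & -7 & -15\\ NRRR & -7 & -7 & -7 & 1 & -7 & -7 & 1 & -15\\ RNRR & -7 & 1 & 1 & -7 & -7 & -7 & -7 & 1\\ NNRR & 1 & -7 & -15 & 1 & 1 & 1 & 1 & -15\\ RRNR & -7 & 1 & 1 & -7 & -7 & -7 & -7 & 1\\ NRNR & 1 & -7 & 1 & -15 & -15 & 1 & 1 & 1\\ RNNR & 1 & 1 & -7 & -7 & 1 & 1 & -7 & 1\\ NNNR & 1 & 1 & -7 & 1 & 1 & 1 & 1 & -15\\ RRRN & -7 & -7 & -7 & 1 & -7 & -7 & 1 & 1\\ NRRN & 1 & 1 & -7 & -7 & 1 & -15 & -7 & 1\\ RNRN & 1 & -7 & 1 & 1 & -15 & 1 & 1 & 1\\ NNRN & 1 & -7 & 1 & -7 & 1 & 1 & -7 & 1\\ RRNN & 1 & -7 & 1 & 1 & 1 & 1 & -15 & 1\\ NRNN & 1 & -7 & 1 & -7 & 1 & 1 & -7 & 1\\ RNNN & 1 & 1 & -7 & 1 & 1 & 1 & 1 & 1\\ NNNN & -7 & -7 & -7 & -7 & -7 & -7 & -7 & -15 \end{array}$$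
   Context: For an odd prime $p$ and $1\le n\le p-1$ put $w_p(n)=R$ if $\left(\frac{n}{p}\right)=1$ and $w_p(n)=N$ if $\left(\frac{n}{p}\right)=-1$ (Legendre symbol). For a word $S=s_1\cdots s_l\in\{R,N\}^l$ let $$n_p(S)=\#\{1\le x\le p-l:\ (w_p(x),w_p(x+1),\ldots,w_p(x+l-1))=S\}.$$ Here $l=4$. Curves $C_S^a$, $C_S$: fix a quadratic residue $\varepsilon_+$ and a quadratic nonresidue $\varepsilon_-$ in $\mathbb F_p^\times$, and for $S=s_1\cdots s_l$ put $\varepsilon_i=\varepsilon_+$ if $s_i=R$ and $\varepsilon_i=\varepsilon_-$ if $s_i=N$. The affine curve $C_S^a$ is the intersection of $l-1$ quadrics in the affine space with coordinates $x_1,\dots,x_l$, given by $$\varepsilon_{i+1}x_{i+1}^2-\varepsilon_i x_i^2=1,\qquad i=1,\dots,l-1.$$ $C_S$ denotes its smooth projective model, and $C_S^{a,\circ}\subset C_S^a$ is the set of points all of whose coordinates $x_1,\ldots,x_l$ are nonzero. Elliptic curves: $E_0,E_1,E_4$ are the smooth projective models of the affine curves $$E_0: y^2=x(x+1)(x+2),\quad E_1: y^2=x(x+1)(x+3),\quad E_4: y^2=x(x+1)(x+2)(x+3).$$ For $p\ge5$, $a_j=a_j(p)=p+1-|E_j(\mathbb F_p)|$ is the Frobenius trace of the reduction of $E_j$ over $\mathbb F_p$ (points counted on the smooth projective model). *)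

theory Defs
  imports
    "HOL-Library.Poly_Mapping"
    "HOL-Library.Function_Algebras"
    "HOL-Number_Theory.Number_Theory"
    "HOL-Algebra.Algebraic_Closure_Type"
    "Berlekamp_Zassenhaus.Finite_Field"
begin

section \<open>Residue patterns\<close>

datatype letter = R | N

definition residue_letter :: "nat \<Rightarrow> nat \<Rightarrow> letter" where
  "residue_letter p n = (if Legendre (int n) (int p) = 1 then R else N)"

definition pattern_count :: "nat \<Rightarrow> letter list \<Rightarrow> nat" where
  "pattern_count p S =
     card {x. 1 \<le> x \<and> x + length S \<le> p \<and>
              map (\<lambda>i. residue_letter p (x + i)) [0..<length S] = S}"

section \<open>The affine curve attached to a word\<close>

text \<open>Letters of a word are numbered from 1. A point of affine \<open>l\<close>-space is a function
  on the naturals supported on \<open>{1..l}\<close>; the index 0 is kept for the homogenising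
  coordinate.\<close>

definition word_coeff :: "'k \<Rightarrow> 'k \<Rightarrow> letter list \<Rightarrow> nat \<Rightarrow> 'k" where
  "word_coeff eps_plus eps_minus S i = (if S ! (i - 1) = R then eps_plus else eps_minus)"

definition affine_space :: "nat \<Rightarrow> (nat \<Rightarrow> 'k::field) set" where
  "affine_space l = {x. \<forall>i. i \<notin> {1..l} \<longrightarrow> x i = 0}"

definition word_curve :: "'k::field \<Rightarrow> 'k \<Rightarrow> letter list \<Rightarrow> (nat \<Rightarrow> 'k) set" where
  "word_curve eps_plus eps_minus S =
     {x \<in> affine_space (length S). \<forall>i \<in> {1..<length S}.
        word_coeff eps_plus eps_minus S (i + 1) * x (i + 1) ^ 2
          - word_coeff eps_plus eps_minus S i * x i ^ 2 = 1}"

definition word_curve_nonzero :: "'k::field \<Rightarrow> 'k \<Rightarrow> letter list \<Rightarrow> (nat \<Rightarrow> 'k) set" where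
  "word_curve_nonzero eps_plus eps_minus S =
     {x \<in> word_curve eps_plus eps_minus S. \<forall>i \<in> {1..length S}. x i \<noteq> 0}"

section \<open>Homogeneous polynomials\<close>

text \<open>Polynomials in the variables \<open>X\<^sub>0, X\<^sub>1, \<dots>\<close>: finitely supported maps from exponent
  vectors to coefficients.\<close>

type_synonym 'k mpoly = "(nat \<Rightarrow>\<^sub>0 nat) \<Rightarrow>\<^sub>0 'k"

definition mp_eval :: "'k::comm_ring_1 mpoly \<Rightarrow> (nat \<Rightarrow> 'k) \<Rightarrow> 'k" where
  "mp_eval f v = (\<Sum>m\<in>Poly_Mapping.keys f. Poly_Mapping.lookup f m *
      (\<Prod>i\<in>Poly_Mapping.keys m. v i ^ Poly_Mapping.lookup m i))"

text \<open>If \<open>X\<^sub>i\<close> does not occur in \<open>m\<close>, the truncated exponent is irrelevant since the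
  coefficient is 0.\<close>

definition mp_partial :: "nat \<Rightarrow> 'k::comm_ring_1 mpoly \<Rightarrow> 'k mpoly" where
  "mp_partial i f = (\<Sum>m\<in>Poly_Mapping.keys f.
      Poly_Mapping.single (m - Poly_Mapping.single i 1)
        (of_nat (Poly_Mapping.lookup m i) * Poly_Mapping.lookup f m))"

definition forms :: "nat \<Rightarrow> nat \<Rightarrow> 'k::comm_ring_1 mpoly set" where
  "forms n d = {f. \<forall>m\<in>Poly_Mapping.keys f.
      Poly_Mapping.keys m \<subseteq> {0..n} \<and> (\<Sum>i\<in>Poly_Mapping.keys m. Poly_Mapping.lookup m i) = d}"

section \<open>Projective curves\<close>

text \<open>A subset of projective \<open>n\<close>-space is represented by the set of all homogeneous
  coordinate vectors of its points, that is, by its affine cone without the origin.\<close>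

definition proj_space :: "nat \<Rightarrow> (nat \<Rightarrow> 'k::alg_closed_field) set" where
  "proj_space n = {v. (\<forall>i>n. v i = 0) \<and> v \<noteq> (\<lambda>_. 0)}"

definition vanishing_forms :: "nat \<Rightarrow> nat \<Rightarrow> (nat \<Rightarrow> 'k::alg_closed_field) set \<Rightarrow> 'k mpoly set" where
  "vanishing_forms n d Z = {f \<in> forms n d. \<forall>v\<in>Z. mp_eval f v = 0}"

definition zariski_closure :: "nat \<Rightarrow> (nat \<Rightarrow> 'k::alg_closed_field) set \<Rightarrow> (nat \<Rightarrow> 'k) set" where
  "zariski_closure n Z =
     {v \<in> proj_space n. \<forall>d. \<forall>f\<in>vanishing_forms n d Z. mp_eval f v = 0}"

definition zariski_closed :: "nat \<Rightarrow> (nat \<Rightarrow> 'k::alg_closed_field) set \<Rightarrow> bool" where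
  "zariski_closed n Z \<longleftrightarrow> zariski_closure n Z = Z"

definition irreducible_closed :: "nat \<Rightarrow> (nat \<Rightarrow> 'k::alg_closed_field) set \<Rightarrow> bool" where
  "irreducible_closed n Z \<longleftrightarrow> zariski_closed n Z \<and> Z \<noteq> {} \<and>
     (\<forall>A B. zariski_closed n A \<longrightarrow> zariski_closed n B \<longrightarrow> Z = A \<union> B \<longrightarrow> Z = A \<or> Z = B)"

text \<open>The last two conditions say that the Krull dimension is 1.\<close>

definition projective_curve :: "nat \<Rightarrow> (nat \<Rightarrow> 'k::alg_closed_field) set \<Rightarrow> bool" where
  "projective_curve n Z \<longleftrightarrow> irreducible_closed n Z \<and>
     (\<exists>Y. irreducible_closed n Y \<and> Y \<subset> Z) \<and>
     \<not> (\<exists>Y W. irreducible_closed n Y \<and> irreducible_closed n W \<and> Y \<subset> W \<and> W \<subset> Z)"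

text \<open>Jacobian criterion in homogeneous coordinates: the gradients of the forms in the
  vanishing ideal span a space of dimension \<open>n - 1\<close> at each point.\<close>

definition nonsingular_curve :: "nat \<Rightarrow> (nat \<Rightarrow> 'k::alg_closed_field) set \<Rightarrow> bool" where
  "nonsingular_curve n Z \<longleftrightarrow> projective_curve n Z \<and>
     (\<forall>v\<in>Z. vector_space.dim (\<lambda>c v i. c * v i)
        {(\<lambda>i. mp_eval (mp_partial i f) v) | f d. f \<in> vanishing_forms n d Z} + 1 = n)"

text \<open>Affine space is the chart \<open>X\<^sub>0 = 1\<close>.\<close>

definition projective_closure :: "nat \<Rightarrow> (nat \<Rightarrow> 'k::alg_closed_field) set \<Rightarrow> (nat \<Rightarrow> 'k) set" where
  "projective_closure n C = zariski_closure n ((\<lambda>x. x(0 := 1)) ` C)"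

text \<open>A nonsingular projective curve containing the affine curve as its nonempty, hence dense,
  open part outside the hyperplane \<open>X\<^sub>0 = 0\<close>. Such a curve is birational to \<open>C\<close> and
  thus is the smooth projective model of \<open>C\<close>, which is unique up to isomorphism.\<close>

definition smooth_projective_model ::
    "nat \<Rightarrow> (nat \<Rightarrow> 'k::alg_closed_field) set \<Rightarrow> (nat \<Rightarrow> 'k) set \<Rightarrow> bool" where
  "smooth_projective_model n Z C \<longleftrightarrow> nonsingular_curve n Z \<and> C \<noteq> {} \<and>
     C = {x \<in> affine_space n. x(0 := 1) \<in> Z}"

text \<open>Dimension of the degree \<open>d\<close> part of the homogeneous coordinate ring.\<close>

definition hilbert_function :: "nat \<Rightarrow> (nat \<Rightarrow> 'k::alg_closed_field) set \<Rightarrow> nat \<Rightarrow> int" where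
  "hilbert_function n Z d =
     int (vector_space.dim (\<lambda>c f. Poly_Mapping.single 0 c * f) (forms n d :: 'k mpoly set))
     - int (vector_space.dim (\<lambda>c f. Poly_Mapping.single 0 c * f) (vanishing_forms n d Z))"

definition hilbert_polynomial :: "nat \<Rightarrow> (nat \<Rightarrow> 'k::alg_closed_field) set \<Rightarrow> rat poly" where
  "hilbert_polynomial n Z =
     (THE P. \<exists>d0. \<forall>d\<ge>d0. of_int (hilbert_function n Z d) = poly P (of_nat d))"

text \<open>The genus of a nonsingular projective curve as \<open>1 - \<chi>(O\<^sub>Z)\<close>, where \<open>\<chi>(O\<^sub>Z)\<close> is the
  value at 0 of the Hilbert polynomial (degree times \<open>d\<close>, plus \<open>1 - g\<close>).\<close>

definition genus :: "nat \<Rightarrow> (nat \<Rightarrow> 'k::alg_closed_field) set \<Rightarrow> rat" where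
  "genus n Z = 1 - poly (hilbert_polynomial n Z) 0"

text \<open>The curve of a word over the algebraic closure of its field of definition.\<close>

definition geometric_word_curve ::
    "'k::field \<Rightarrow> 'k \<Rightarrow> letter list \<Rightarrow> (nat \<Rightarrow> 'k alg_closure) set" where
  "geometric_word_curve eps_plus eps_minus S = word_curve (to_ac eps_plus) (to_ac eps_minus) S"

definition projective_word_curve ::
    "'k::field \<Rightarrow> 'k \<Rightarrow> letter list \<Rightarrow> (nat \<Rightarrow> 'k alg_closure) set" where
  "projective_word_curve eps_plus eps_minus S =
     projective_closure (length S) (geometric_word_curve eps_plus eps_minus S)"

section \<open>Elliptic curves\<close>

text \<open>For squarefree \<open>f\<close> of degree 3 or 4 in characteristic \<open>\<noteq> 2\<close>, the smooth projective
  model of \<open>y\<^sup>2 = f(x)\<close> is the curve \<open>y\<^sup>2 = F(x, z)\<close> in the weighted projective plane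
  with weights 1, 2, 1 for \<open>x, y, z\<close>, where \<open>F(x, z) = z\<^sup>4 f(x/z)\<close>. It is covered by the
  smooth charts \<open>z = 1\<close>, which is \<open>y\<^sup>2 = f(x)\<close>, and \<open>x = 1\<close>, which is
  \<open>y\<^sup>2 = F(1, z)\<close>. There is one point with \<open>z = 0\<close> if the degree is 3; if the degree
  is 4 there are two or none over the ground field.\<close>

definition weighted_equiv :: "(('k::field \<times> 'k \<times> 'k) \<times> ('k \<times> 'k \<times> 'k)) set" where
  "weighted_equiv = {((x, y, z), (x', y', z')).
      \<exists>c. c \<noteq> 0 \<and> x' = c * x \<and> y' = c ^ 2 * y \<and> z' = c * z}"

definition model_points :: "'k::field poly \<Rightarrow> ('k \<times> 'k \<times> 'k) set set" where
  "model_points f =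
     {(x, y, z). (x, z) \<noteq> (0, 0) \<and> y ^ 2 = (\<Sum>i\<le>4. poly.coeff f i * x ^ i * z ^ (4 - i))}
       // weighted_equiv"

definition E0 :: "'k::field poly" where "E0 = [:0, 1:] * [:1, 1:] * [:2, 1:]"
definition E1 :: "'k::field poly" where "E1 = [:0, 1:] * [:1, 1:] * [:3, 1:]"
definition E4 :: "'k::field poly" where "E4 = [:0, 1:] * [:1, 1:] * [:2, 1:] * [:3, 1:]"

definition frobenius_trace :: "'p::prime_card mod_ring poly \<Rightarrow> int" where
  "frobenius_trace f = int CARD('p) + 1 - int (card (model_points f))"

section \<open>The tables\<close>

text \<open>The two entries of a row are for \<open>p \<equiv> 1\<close> and \<open>p \<equiv> 3\<close> modulo 4.\<close>

definition A_table :: "int \<Rightarrow> int \<Rightarrow> int \<Rightarrow> (letter list \<times> int \<times> int) list" where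
  "A_table a0 a1 a4 =
   [([R,R,R,R], 2 * a0 + 2 * a1 + a4, a4),
    ([R,R,N,R], -2 * a0 - a4, 2 * a1 - a4),
    ([R,N,R,R], -2 * a0 - a4, -2 * a1 - a4),
    ([N,R,R,R], -2 * a1 - a4, -a4),
    ([R,R,R,N], -2 * a1 - a4, -a4),
    ([R,R,N,N], a4, -2 * a1 + a4),
    ([N,N,R,R], a4, 2 * a1 + a4),
    ([N,R,R,N], -2 * a0 + 2 * a1 + a4, a4),
    ([R,N,N,R], 2 * a0 - 2 * a1 + a4, a4),
    ([R,N,R,N], a4, 2 * a1 + a4),
    ([N,R,N,R], a4, -2 * a1 + a4),
    ([N,N,N,R], 2 * a1 - a4, -a4),
    ([R,N,N,N], 2 * a1 - a4, -a4),
    ([N,R,N,N], 2 * a0 - a4, 2 * a1 - a4),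
    ([N,N,R,N], 2 * a0 - a4, -2 * a1 - a4),
    ([N,N,N,N], -2 * a0 - 2 * a1 + a4, a4)]"

definition A_term :: "int \<Rightarrow> int \<Rightarrow> int \<Rightarrow> letter list \<Rightarrow> nat \<Rightarrow> int" where
  "A_term a0 a1 a4 S r =
     (case the (map_of (A_table a0 a1 a4) S) of (u, v) \<Rightarrow> if r = 1 then u else v)"

text \<open>Rows of \<open>16 C\<close>, with columns indexed by the residue classes in \<open>C_columns\<close>.\<close>

definition C_columns :: "nat list" where
  "C_columns = [1, 5, 7, 11, 13, 17, 19, 23]"

definition C_table :: "(letter list \<times> int list) list" where
  "C_table =
   [([R,R,R,R], [-39, -7, -7, -7, -7, -23, -7, -15]),
    ([N,R,R,R], [-7, -7, -7, 1, -7, -7, 1, -15]),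
    ([R,N,R,R], [-7, 1, 1, -7, -7, -7, -7, 1]),
    ([N,N,R,R], [1, -7, -15, 1, 1, 1, 1, -15]),
    ([R,R,N,R], [-7, 1, 1, -7, -7, -7, -7, 1]),
    ([N,R,N,R], [1, -7, 1, -15, -15, 1, 1, 1]),
    ([R,N,N,R], [1, 1, -7, -7, 1, 1, -7, 1]),
    ([N,N,N,R], [1, 1, -7, 1, 1, 1, 1, -15]),
    ([R,R,R,N], [-7, -7, -7, 1, -7, -7, 1, 1]),
    ([N,R,R,N], [1, 1, -7, -7, 1, -15, -7, 1]),
    ([R,N,R,N], [1, -7, 1, 1, -15, 1, 1, 1]),
    ([N,N,R,N], [1, -7, 1, -7, 1, 1, -7, 1]),
    ([R,R,N,N], [1, -7, 1, 1, 1, 1, -15, 1]),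
    ([N,R,N,N], [1, -7, 1, -7, 1, 1, -7, 1]),
    ([R,N,N,N], [1, 1, -7, 1, 1, 1, 1, 1]),
    ([N,N,N,N], [-7, -7, -7, -7, -7, -7, -7, -15])]"

definition C_term :: "letter list \<Rightarrow> nat \<Rightarrow> real" where
  "C_term S r = real_of_int (the (map_of (zip C_columns (the (map_of C_table S))) r)) / 16"

end

theory Submission
  imports Defs
begin

text \<open>Eliminating successively, the curve is cut out by \<open>\<epsilon>\<^sub>i X\<^sub>i\<^sup>2 = \<epsilon>\<^sub>1 X\<^sub>1\<^sup>2 + (i - 1) X\<^sub>0\<^sup>2\<close> for
  \<open>i = 2, 3, 4\<close>. Modulo these quadrics every form is a combination of monomials with exponents at most 1
  in \<open>X\<^sub>2, X\<^sub>3, X\<^sub>4\<close>. On the chart \<open>X\<^sub>0 = 1\<close> the functions \<open>X\<^sub>2, X\<^sub>3, X\<^sub>4\<close> are square roots of separable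
  polynomials in \<open>X\<^sub>1\<close> without common roots, so they generate a tower of quadratic extensions: the eight
  products of these roots are linearly independent and there are no zero divisors. Hence the quadrics
  generate the vanishing ideal, it is prime, and counting reduced monomials gives the Hilbert
  polynomial \<open>8 d - 4\<close>, that is, genus 5. A nonzero element of the tower has a nonzero norm in \<open>k[X\<^sub>1]\<close>,
  so proper closed subsets are finite.

  For the count, put \<open>t = \<epsilon>\<^sub>1 x\<^sub>1\<^sup>2\<close>. A pattern at \<open>t\<close> contributes \<open>2\<^sup>4\<close> points, and its indicator is
  \<open>2\<^sup>-\<^sup>4\<close> times the product of the \<open>1 \<plusminus> \<chi>(t + i)\<close>, \<open>0 \<le> i \<le> 3\<close>. Expanding gives the character sums of
  the curves \<open>E\<^sub>0, E\<^sub>1, E\<^sub>4\<close>; the substitutions \<open>t \<mapsto> -3 - t\<close> and \<open>t \<mapsto> -2 - t\<close> produce the factor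
  \<open>\<chi>(-1)\<close> of \<open>a\<^sub>1\<close> and show \<open>a\<^sub>0 = \<chi>(-1) a\<^sub>0\<close>. The terms at \<open>t = 0, -1, -2, -3\<close> depend only on
  \<open>\<chi>(-1), \<chi>(2), \<chi>(3)\<close>.\<close>

section \<open>Towers of quadratic extensions\<close>

text \<open>The square roots are chosen point by point without any coherence, so the function field
  of the curve is not at hand as an algebraic object. Elements of the tower are therefore plain
  functions of a base point and a vector of signs: flipping one sign acts like a Galois
  automorphism, and an identity valid on all sheets splits into its even and odd parts. The crux is
  that each radicand stays a non-square over the levels below. A branch point over which those
  levels are unramified decides this. It exists because the radicands vanish where e_1 x_1^2 equals
  -1, -2 or -3: these values are nonzero and pairwise distinct as soon as 2 and 3 are invertible,
  hence p \<ge> 5. On the arithmetic side all sums run over the whole field rather than over an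
  interval of integers, so that substitutions cost nothing and the ends of the interval become four
  excluded values of t.\<close>

text \<open>A point of the covering given by the square roots: a point of the line together with a choice of
  signs. A datatype rather than a product, since automatic splitting of pairs gets in the way.\<close>

datatype 'k sheet_point = Sheet (base: 'k) (sheet: "nat \<Rightarrow> bool")

text \<open>No relation between the values of \<open>\<rho>\<close> at different points is assumed.
  The simple root \<open>r i\<close> marks a base point where level \<open>i\<close> ramifies and
  the earlier levels do not, which makes \<open>c i\<close> a non-square over them.\<close>

locale quadratic_tower =
  fixes n :: nat and c d :: "nat \<Rightarrow> 'k::field poly" and r :: "nat \<Rightarrow> 'k" and \<rho> :: "nat \<Rightarrow> 'k \<Rightarrow> 'k"
  assumes two_neq_0: "(2::'k) \<noteq> 0"
    and infinite_field: "infinite (UNIV :: 'k set)"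
    and root_square: "i < n \<Longrightarrow> \<rho> i x ^ 2 = poly (c i) x"
    and simple_root: "i < n \<Longrightarrow> c i = [:- r i, 1:] * d i" "i < n \<Longrightarrow> poly (d i) (r i) \<noteq> 0"
    and unramified: "i < n \<Longrightarrow> j < i \<Longrightarrow> poly (c j) (r i) \<noteq> 0"
begin

definition Y :: "nat \<Rightarrow> 'k sheet_point \<Rightarrow> 'k" where
  "Y i z = (if sheet z i then \<rho> i (base z) else - \<rho> i (base z))"

primrec tower :: "nat \<Rightarrow> ('k sheet_point \<Rightarrow> 'k) set" where
  "tower 0 = range (\<lambda>p z. poly p (base z))"
| "tower (Suc j) = {\<lambda>z. f z + g z * Y j z | f g. f \<in> tower j \<and> g \<in> tower j}"

lemma Y_square: "i < n \<Longrightarrow> Y i z * Y i z = poly (c i) (base z)"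
  using root_square[of i "base z"] by (simp add: Y_def power2_eq_square)

lemma poly_eqI_everywhere:
  assumes "\<And>x. poly p x = poly q x"
  shows "p = (q :: 'k poly)"
proof (rule ccontr)
  assume "p \<noteq> q"
  then have "finite {x. poly (p - q) x = 0}" by (intro poly_roots_finite) simp
  moreover have "{x. poly (p - q) x = 0} = UNIV" using assms by auto
  ultimately show False using infinite_field by simp
qed

lemma c_nonzero: assumes "i < n" shows "c i \<noteq> 0"
proof
  assume "c i = 0"
  with simple_root(1)[OF assms] have "d i = 0" by (metis mult_eq_0_iff pCons_eq_0_iff one_neq_zero)
  with simple_root(2)[OF assms] show False by simp
qed

declare tower.simps [simp del]

lemma tower_SucI: "f \<in> tower j \<Longrightarrow> g \<in> tower j \<Longrightarrow> (\<lambda>z. f z + g z * Y j z) \<in> tower (Suc j)"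
  unfolding tower.simps by blast

lemma tower_SucE:
  assumes "f \<in> tower (Suc j)"
  obtains a b where "a \<in> tower j" "b \<in> tower j" "f = (\<lambda>z. a z + b z * Y j z)"
  using assms unfolding tower.simps by blast

lemma tower_polyI: "f = (\<lambda>z. poly p (base z)) \<Longrightarrow> f \<in> tower 0"
  unfolding tower.simps by blast

lemma tower_0E:
  assumes "f \<in> tower 0"
  obtains p where "f = (\<lambda>z. poly p (base z))"
  using assms unfolding tower.simps by blast

lemma tower_poly: "j \<le> n \<Longrightarrow> (\<lambda>z. poly p (base z)) \<in> tower j"
proof (induction j arbitrary: p)
  case (Suc j)
  then have "(\<lambda>z. poly p (base z) + poly 0 (base z) * Y j z) \<in> tower (Suc j)"
    by (intro tower_SucI Suc.IH) auto
  then show ?case by simp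
qed (auto intro: tower_polyI)

lemma tower_Suc: "f \<in> tower j \<Longrightarrow> j < n \<Longrightarrow> f \<in> tower (Suc j)"
proof -
  assume "f \<in> tower j" "j < n"
  then show ?thesis using tower_SucI[of f j "\<lambda>z. poly 0 (base z)"] tower_poly[of j 0] by simp
qed

lemma tower_mono: "f \<in> tower i \<Longrightarrow> i \<le> j \<Longrightarrow> j \<le> n \<Longrightarrow> f \<in> tower j"
proof (induction j)
  case (Suc j)
  then show ?case using tower_Suc[of f j] by (cases "i = Suc j") auto
qed auto

lemma tower_Y: "i < j \<Longrightarrow> j \<le> n \<Longrightarrow> Y i \<in> tower j"
proof -
  assume *: "i < j" "j \<le> n"
  then have "(\<lambda>z. poly 0 (base z) + poly 1 (base z) * Y i z) \<in> tower (Suc i)"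
    by (intro tower_SucI tower_poly) auto
  then have "Y i \<in> tower (Suc i)" by simp
  then show ?thesis using tower_mono[of "Y i" "Suc i" j] * by auto
qed

lemma tower_add: "f \<in> tower j \<Longrightarrow> g \<in> tower j \<Longrightarrow> (\<lambda>z. f z + g z) \<in> tower j"
proof (induction j arbitrary: f g)
  case 0
  from 0(1) obtain p where "f = (\<lambda>z. poly p (base z))" by (rule tower_0E)
  moreover from 0(2) obtain q where "g = (\<lambda>z. poly q (base z))" by (rule tower_0E)
  ultimately have "(\<lambda>z. f z + g z) = (\<lambda>z. poly (p + q) (base z))" by simp
  then show ?case by (rule tower_polyI)
next
  case (Suc j)
  from Suc.prems(1) obtain a b where ab: "a \<in> tower j" "b \<in> tower j"
    and f: "f = (\<lambda>z. a z + b z * Y j z)" by (rule tower_SucE)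
  from Suc.prems(2) obtain a' b' where ab': "a' \<in> tower j" "b' \<in> tower j"
    and g: "g = (\<lambda>z. a' z + b' z * Y j z)" by (rule tower_SucE)
  note ab = ab ab' and eq = f g
  have "(\<lambda>z. f z + g z) = (\<lambda>z. (a z + a' z) + (b z + b' z) * Y j z)"
    by (simp add: eq algebra_simps)
  then show ?case using tower_SucI[OF Suc.IH[OF ab(1) ab(3)] Suc.IH[OF ab(2) ab(4)]] by simp
qed

lemma tower_mult: "f \<in> tower j \<Longrightarrow> g \<in> tower j \<Longrightarrow> j \<le> n \<Longrightarrow> (\<lambda>z. f z * g z) \<in> tower j"
proof (induction j arbitrary: f g)
  case 0
  from 0(1) obtain p where "f = (\<lambda>z. poly p (base z))" by (rule tower_0E)
  moreover from 0(2) obtain q where "g = (\<lambda>z. poly q (base z))" by (rule tower_0E)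
  ultimately have "(\<lambda>z. f z * g z) = (\<lambda>z. poly (p * q) (base z))" by simp
  then show ?case by (rule tower_polyI)
next
  case (Suc j)
  from Suc.prems(1) obtain a b where ab: "a \<in> tower j" "b \<in> tower j"
    and f: "f = (\<lambda>z. a z + b z * Y j z)" by (rule tower_SucE)
  from Suc.prems(2) obtain a' b' where ab': "a' \<in> tower j" "b' \<in> tower j"
    and g: "g = (\<lambda>z. a' z + b' z * Y j z)" by (rule tower_SucE)
  note ab = ab ab' and eq = f g
  have j: "j \<le> n" "j < n" using Suc by auto
  define u where "u = (\<lambda>z. a z * a' z + poly (c j) (base z) * (b z * b' z))"
  define w where "w = (\<lambda>z. a z * b' z + b z * a' z)"
  have "u \<in> tower j" "w \<in> tower j"
    unfolding u_def w_def by (intro tower_add Suc.IH tower_poly ab j(1))+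
  moreover have "(\<lambda>z. f z * g z) = (\<lambda>z. u z + w z * Y j z)"
    by (rule ext) (simp add: eq u_def w_def algebra_simps flip: Y_square[OF j(2)])
  ultimately show ?case using tower_SucI[of u j w] by simp
qed

lemma tower_const: "j \<le> n \<Longrightarrow> (\<lambda>z. k) \<in> tower j"
  using tower_poly[of j "[:k:]"] by simp

lemma tower_uminus: "f \<in> tower j \<Longrightarrow> j \<le> n \<Longrightarrow> (\<lambda>z. - f z) \<in> tower j"
  using tower_mult[OF tower_const[of j "-1"], of f] by simp

lemma tower_diff: "f \<in> tower j \<Longrightarrow> g \<in> tower j \<Longrightarrow> j \<le> n \<Longrightarrow> (\<lambda>z. f z - g z) \<in> tower j"
  using tower_add[OF _ tower_uminus[of g j], of f] by simp

lemma tower_sum: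
  "finite K \<Longrightarrow> (\<And>k. k \<in> K \<Longrightarrow> f k \<in> tower j) \<Longrightarrow> j \<le> n \<Longrightarrow> (\<lambda>z. \<Sum>k\<in>K. f k z) \<in> tower j"
  by (induction K rule: finite_induct) (simp_all add: tower_const tower_add)

lemma tower_prod:
  "finite K \<Longrightarrow> (\<And>k. k \<in> K \<Longrightarrow> f k \<in> tower j) \<Longrightarrow> j \<le> n \<Longrightarrow> (\<lambda>z. \<Prod>k\<in>K. f k z) \<in> tower j"
  by (induction K rule: finite_induct) (simp_all add: tower_const tower_mult)

lemma tower_power: "f \<in> tower j \<Longrightarrow> j \<le> n \<Longrightarrow> (\<lambda>z. f z ^ m) \<in> tower j"
  by (induction m) (simp_all add: tower_const tower_mult)

section \<open>Separation of the sheets by sign changes\<close>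

lemma tower_sign_irrelevant: "f \<in> tower j \<Longrightarrow> j \<le> i \<Longrightarrow> f (Sheet x (s(i := b))) = f (Sheet x s)"
proof (induction j arbitrary: f)
  case 0
  then show ?case by (auto elim: tower_0E)
next
  case (Suc j)
  from Suc.prems(1) obtain a b where ab: "a \<in> tower j" "b \<in> tower j" and eq: "f = (\<lambda>z. a z + b z * Y j z)"
    by (rule tower_SucE)
  then show ?case using Suc.IH[OF ab(1)] Suc.IH[OF ab(2)] Suc.prems by (simp add: Y_def)
qed

text \<open>Flipping the sign at \<open>j\<close> fixes \<open>f\<close> and \<open>g\<close> and
  negates \<open>Y j\<close>; adding and subtracting the two equations isolates both parts because 2
  is invertible. This happens over a single base point, so \<open>g\<close> may still be nonzero
  where \<open>Y j\<close> vanishes.\<close>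

lemma sign_split:
  assumes "f \<in> tower j" "g \<in> tower j"
    and "\<And>s. f (Sheet x s) + g (Sheet x s) * Y j (Sheet x s) = 0"
  shows "f (Sheet x s) = 0 \<and> g (Sheet x s) * Y j (Sheet x s) = 0"
proof -
  have "f (Sheet x s) + g (Sheet x s) * \<rho> j x = 0"
    using assms(3)[of "s(j := True)"] tower_sign_irrelevant[OF assms(1), of j]
      tower_sign_irrelevant[OF assms(2), of j] by (simp add: Y_def)
  moreover have "f (Sheet x s) - g (Sheet x s) * \<rho> j x = 0"
    using assms(3)[of "s(j := False)"] tower_sign_irrelevant[OF assms(1), of j]
      tower_sign_irrelevant[OF assms(2), of j] by (simp add: Y_def)
  ultimately have "2 * f (Sheet x s) = 0" "f (Sheet x s) = g (Sheet x s) * \<rho> j x"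
    by (simp_all add: algebra_simps)
  with two_neq_0 show ?thesis by (auto simp: Y_def)
qed

lemma Y_nonzero: "i < n \<Longrightarrow> poly (c i) x \<noteq> 0 \<Longrightarrow> Y i (Sheet x s) \<noteq> 0"
  using Y_square[of i "Sheet x s"] by auto

text \<open>Identities obtained by cancelling x - x0 hold only away from x0; this extends them to
  all points. Splitting by signs leads down to a polynomial with infinitely many zeros, and the
  roots of \<open>c j\<close> join the exceptional set because \<open>Y j\<close> cannot be
  cancelled there.\<close>

lemma tower_eq_0I:
  assumes "f \<in> tower j" "j \<le> n" "finite B" "\<And>x s. x \<notin> B \<Longrightarrow> f (Sheet x s) = 0"
  shows "f z = 0"
  using assms
proof (induction j arbitrary: f B z)
  case 0
  from 0(1) obtain p where p: "f = (\<lambda>z. poly p (base z))" by (rule tower_0E)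
  have "p = 0"
  proof (rule ccontr)
    assume "p \<noteq> 0"
    then have "finite {x. poly p x = 0}" by (rule poly_roots_finite)
    moreover have "UNIV - B \<subseteq> {x. poly p x = 0}" using 0 p by auto
    ultimately show False using infinite_field 0(3) by (meson finite_Diff2 finite_subset)
  qed
  then show ?case using p by simp
next
  case (Suc j)
  from Suc.prems(1) obtain a b where ab: "a \<in> tower j" "b \<in> tower j" and eq: "f = (\<lambda>z. a z + b z * Y j z)"
    by (rule tower_SucE)
  have j: "j \<le> n" "j < n" using Suc by auto
  have *: "a (Sheet x s) = 0 \<and> b (Sheet x s) * Y j (Sheet x s) = 0" if "x \<notin> B" for x s
    using Suc.prems(4)[OF that] unfolding eq by (rule sign_split[OF ab])
  have "finite (B \<union> {x. poly (c j) x = 0})"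
    using Suc.prems(3) poly_roots_finite[OF c_nonzero[OF j(2)]] by simp
  moreover have "b (Sheet x s) = 0" if "x \<notin> B \<union> {x. poly (c j) x = 0}" for x s
    using *[of x s] Y_nonzero[OF j(2), of x s] that by simp
  ultimately have "b z = 0" by (rule Suc.IH[OF ab(2) j(1)])
  moreover have "a z = 0" using conjunct1[OF *] by (rule Suc.IH[OF ab(1) j(1) Suc.prems(3)])
  ultimately show ?case by (simp add: eq)
qed

text \<open>Away from the roots of \<open>c j\<close> the odd part can be divided by
  \<open>Y j\<close>, and finitely many exceptions are harmless. So 1 and \<open>Y j\<close> are
  linearly independent over level \<open>j\<close>.\<close>

lemma tower_split_unique:
  assumes "f \<in> tower j" "g \<in> tower j" "j < n" "\<And>z. f z + g z * Y j z = 0"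
  shows "f z = 0" "g z = 0"
proof -
  have *: "f (Sheet x s) = 0 \<and> g (Sheet x s) * Y j (Sheet x s) = 0" for x s
    using assms(4) by (rule sign_split[OF assms(1,2)])
  then show "f z = 0" by (metis sheet_point.exhaust)
  have "g (Sheet x s) = 0" if "poly (c j) x \<noteq> 0" for x s
    using *[of x s] Y_nonzero[OF assms(3) that, of s] by simp
  then show "g z = 0"
    using tower_eq_0I[OF assms(2) less_imp_le[OF assms(3)] poly_roots_finite[OF c_nonzero[OF assms(3)]]]
    by simp
qed

text \<open>Since the radicands involved do not vanish at \<open>x0\<close>, each \<open>Y\<close>
  can be cancelled there, both parts vanish on the whole fibre, and the division descends to
  polynomials. Over a root of \<open>c j\<close> this fails: \<open>Y j\<close> vanishes there
  without being divisible.\<close>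

lemma tower_divide_root:
  assumes "f \<in> tower j" "j \<le> n" "\<And>i. i < j \<Longrightarrow> poly (c i) x0 \<noteq> 0" "\<And>s. f (Sheet x0 s) = 0"
  shows "\<exists>g \<in> tower j. \<forall>z. f z = (base z - x0) * g z"
  using assms
proof (induction j arbitrary: f)
  case 0
  from 0(1) obtain p where p: "f = (\<lambda>z. poly p (base z))" by (rule tower_0E)
  with 0 have "[:- x0, 1:] dvd p" by (simp add: poly_eq_0_iff_dvd)
  then obtain q where q: "p = [:- x0, 1:] * q" by (rule dvdE)
  show ?case unfolding p q
    by (intro bexI[of _ "\<lambda>z. poly q (base z)"] allI tower_polyI[OF refl]) (simp add: algebra_simps)
next
  case (Suc j)
  from Suc.prems(1) obtain a b where ab: "a \<in> tower j" "b \<in> tower j" and eq: "f = (\<lambda>z. a z + b z * Y j z)"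
    by (rule tower_SucE)
  have j: "j \<le> n" "j < n" using Suc by auto
  have *: "a (Sheet x0 s) = 0 \<and> b (Sheet x0 s) * Y j (Sheet x0 s) = 0" for s
    using Suc.prems(4) unfolding eq by (rule sign_split[OF ab])
  have c0: "poly (c i) x0 \<noteq> 0" if "i < j" for i using Suc.prems(3) that by simp
  obtain a' where a': "a' \<in> tower j" "\<And>z. a z = (base z - x0) * a' z"
    using Suc.IH[OF ab(1) j(1) c0 conjunct1[OF *]] by blast
  have "b (Sheet x0 s) = 0" for s
    using *[of s] Y_nonzero[OF j(2) Suc.prems(3)[OF lessI], of s] by simp
  then obtain b' where b': "b' \<in> tower j" "\<And>z. b z = (base z - x0) * b' z"
    using Suc.IH[OF ab(2) j(1) c0] by blast
  have "f z = (base z - x0) * (a' z + b' z * Y j z)" for z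
    unfolding eq a'(2)[of z] b'(2)[of z] by (simp add: algebra_simps)
  then show ?case using tower_SucI[OF a'(1) b'(1)] by (intro bexI[of _ "\<lambda>z. a' z + b' z * Y j z"] allI)
qed

text \<open>A nonzero polynomial is not divisible by a power of x - x0 beyond its degree, and
  uniqueness of the split passes divisibility on to the two parts. This is what stops the
  descent.\<close>

lemma tower_infinitely_divisible:
  assumes "f \<in> tower j" "j \<le> n" "\<And>m. \<exists>g \<in> tower j. \<forall>z. f z = (base z - x0) ^ m * g z"
  shows "f z = 0"
  using assms
proof (induction j arbitrary: f z)
  case 0
  from 0(1) obtain p where p: "f = (\<lambda>z. poly p (base z))" by (rule tower_0E)
  have "p = 0"
  proof (rule ccontr)
    assume "p \<noteq> 0"
    obtain h where "h \<in> tower 0" and h: "\<forall>z. f z = (base z - x0) ^ Suc (Polynomial.degree p) * h z"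
      using 0(3)[of "Suc (Polynomial.degree p)"] by blast
    from this(1) obtain q where q: "h = (\<lambda>z. poly q (base z))" by (rule tower_0E)
    have "poly p x = poly ([:- x0, 1:] ^ Suc (Polynomial.degree p) * q) x" for x
      using h[rule_format, of "Sheet x undefined"] unfolding p q poly_mult poly_power by simp
    then have "p = [:- x0, 1:] ^ Suc (Polynomial.degree p) * q"
      by (rule poly_eqI_everywhere)
    then have "[:- x0, 1:] ^ Suc (Polynomial.degree p) dvd p" by (metis dvd_triv_left)
    from dvd_imp_degree_le[OF this \<open>p \<noteq> 0\<close>] show False by (simp only: degree_linear_power)
  qed
  then show ?case using p by simp
next
  case (Suc j)
  from Suc.prems(1) obtain a b where ab: "a \<in> tower j" "b \<in> tower j" and eq: "f = (\<lambda>z. a z + b z * Y j z)"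
    by (rule tower_SucE)
  have j: "j \<le> n" "j < n" using Suc by auto
  have *: "\<exists>a'\<in>tower j. \<exists>b'\<in>tower j. \<forall>z. a z = (base z - x0) ^ m * a' z \<and> b z = (base z - x0) ^ m * b' z" for m
  proof -
    obtain a' b' where ab': "a' \<in> tower j" "b' \<in> tower j"
      and eq': "\<forall>z. f z = (base z - x0) ^ m * (a' z + b' z * Y j z)"
    proof -
      obtain h where "h \<in> tower (Suc j)" and h: "\<forall>z. f z = (base z - x0) ^ m * h z"
        using Suc.prems(3)[of m] by blast
      from this(1) obtain a' b' where "a' \<in> tower j" "b' \<in> tower j" "h = (\<lambda>z. a' z + b' z * Y j z)"
        by (rule tower_SucE)
      with h that show ?thesis by simp
    qed
    have pm: "(\<lambda>z. (base z - x0) ^ m) \<in> tower j"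
      using tower_power[OF tower_poly[of j "[:- x0, 1:]"], of m] j by simp
    have t: "(\<lambda>z. a z - (base z - x0) ^ m * a' z) \<in> tower j" "(\<lambda>z. b z - (base z - x0) ^ m * b' z) \<in> tower j"
      by (intro tower_diff tower_mult pm ab ab' j)+
    have "a z - (base z - x0) ^ m * a' z + (b z - (base z - x0) ^ m * b' z) * Y j z = 0" for z
      using eq' unfolding eq by (simp add: algebra_simps)
    from tower_split_unique[OF t j(2) this]
    have "a z = (base z - x0) ^ m * a' z" "b z = (base z - x0) ^ m * b' z" for z by simp_all
    with ab' show ?thesis by blast
  qed
  have "\<exists>g\<in>tower j. \<forall>z. a z = (base z - x0) ^ m * g z" "\<exists>g\<in>tower j. \<forall>z. b z = (base z - x0) ^ m * g z" for m
    using *[of m] by blast+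
  then have "a z = 0" "b z = 0" using Suc.IH[OF ab(1) j(1)] Suc.IH[OF ab(2) j(1)] by blast+
  then show ?case by (simp add: eq)
qed

text \<open>Descent: a solution vanishes over the simple root \<open>r j\<close> of \<open>c j\<close>, where the lower levels are
  unramified, so both entries can be divided by \<open>x - r j\<close> again and again.\<close>

lemma tower_not_square:
  assumes "a \<in> tower j" "b \<in> tower j" "j < n" and "\<And>z. a z ^ 2 = poly (c j) (base z) * b z ^ 2"
  shows "a z = 0 \<and> b z = 0"
proof -
  have j: "j \<le> n" using assms by auto
  define x0 where "x0 = r j"
  have cj: "poly (c j) x = (x - x0) * poly (d j) x" for x
    by (subst simple_root(1)[OF assms(3)]) (simp add: x0_def algebra_simps)
  have lin: "(\<lambda>z. base z - x0) \<in> tower j"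
    using tower_poly[of j "[:- x0, 1:]"] j by simp
  have *: "\<exists>a'\<in>tower j. \<exists>b'\<in>tower j. \<forall>z. a z = (base z - x0) ^ m * a' z \<and> b z = (base z - x0) ^ m * b' z
     \<and> a' z ^ 2 = poly (c j) (base z) * b' z ^ 2" for m
  proof (induction m)
    case 0
    then show ?case using assms by auto
  next
    case (Suc m)
    then obtain a' b' where ab': "a' \<in> tower j" "b' \<in> tower j"
      and eq: "\<And>z. a z = (base z - x0) ^ m * a' z" "\<And>z. b z = (base z - x0) ^ m * b' z"
        "\<And>z. a' z ^ 2 = poly (c j) (base z) * b' z ^ 2" by blast
    have "a' (Sheet x0 s) = 0" for s using eq(3)[of "Sheet x0 s"] by (simp add: cj)
    then obtain a2 where a2: "a2 \<in> tower j" "\<And>z. a' z = (base z - x0) * a2 z"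
      using tower_divide_root[OF ab'(1) j, of x0] unramified[OF assms(3)] by (auto simp: x0_def)
    \<comment> \<open>One factor x - x0 of \<open>c j\<close> is cancelled, legitimately only off
      \<open>x0\<close>, and the identity is then extended. At \<open>x0\<close> it leaves
      \<open>poly (d j) x0 * b'^2 = 0\<close>; the root is simple, so \<open>b'\<close> vanishes on
      the fibre too.\<close>
    have key: "(base z - x0) * a2 z ^ 2 - poly (d j) (base z) * b' z ^ 2 = 0" for z
    proof (rule tower_eq_0I[of _ j "{x0}"])
      show "(\<lambda>z. (base z - x0) * a2 z ^ 2 - poly (d j) (base z) * b' z ^ 2) \<in> tower j"
        by (intro tower_diff tower_mult tower_power lin a2 ab' tower_poly j)
      fix x s assume x: "x \<notin> {x0}"
      have "(x - x0) * ((x - x0) * a2 (Sheet x s) ^ 2) = (x - x0) * (poly (d j) x * b' (Sheet x s) ^ 2)"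
        using eq(3)[of "Sheet x s"] unfolding a2(2) cj power2_eq_square sheet_point.sel by (simp only: mult_ac)
      with x show "(base (Sheet x s) - x0) * a2 (Sheet x s) ^ 2 - poly (d j) (base (Sheet x s)) * b' (Sheet x s) ^ 2 = 0"
        by simp
    qed (use j in auto)
    have "b' (Sheet x0 s) = 0" for s using key[of "Sheet x0 s"] simple_root(2)[OF assms(3)] by (simp add: x0_def)
    then obtain b2 where b2: "b2 \<in> tower j" "\<And>z. b' z = (base z - x0) * b2 z"
      using tower_divide_root[OF ab'(2) j, of x0] unramified[OF assms(3)] by (auto simp: x0_def)
    have key2: "a2 z ^ 2 - poly (c j) (base z) * b2 z ^ 2 = 0" for z
    proof (rule tower_eq_0I[of _ j "{x0}"])
      show "(\<lambda>z. a2 z ^ 2 - poly (c j) (base z) * b2 z ^ 2) \<in> tower j"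
        by (intro tower_diff tower_mult tower_power lin a2 b2 tower_poly j)
      fix x s assume x: "x \<notin> {x0}"
      have "(x - x0) * a2 (Sheet x s) ^ 2 = (x - x0) * (poly (c j) x * b2 (Sheet x s) ^ 2)"
        using key[of "Sheet x s"] unfolding b2(2) cj power2_eq_square sheet_point.sel right_minus_eq
        by (simp only: mult_ac)
      with x show "a2 (Sheet x s) ^ 2 - poly (c j) (base (Sheet x s)) * b2 (Sheet x s) ^ 2 = 0"
        by simp
    qed (use j in auto)
    then have "a2 z ^ 2 = poly (c j) (base z) * b2 z ^ 2" for z by simp
    moreover have "a z = (base z - x0) ^ Suc m * a2 z" "b z = (base z - x0) ^ Suc m * b2 z" for z
      unfolding eq(1,2)[of z] a2(2) b2(2) power_Suc by (simp_all only: mult_ac)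
    ultimately show ?case using a2(1) b2(1) by blast
  qed
  have "\<exists>g\<in>tower j. \<forall>z. a z = (base z - x0) ^ m * g z" "\<exists>g\<in>tower j. \<forall>z. b z = (base z - x0) ^ m * g z" for m
    using *[of m] by blast+
  then show ?thesis
    using tower_infinitely_divisible[OF assms(1) j] tower_infinitely_divisible[OF assms(2) j] by blast
qed

text \<open>The relative norm a^2 - c b^2 of a + b Y is nonzero because \<open>c j\<close> is not a
  square over level \<open>j\<close>. Its own cofactor from below, times the conjugate a - b Y, is
  the cofactor sought.\<close>

lemma tower_norm:
  assumes "f \<in> tower j" "j \<le> n" "f z0 \<noteq> 0"
  shows "\<exists>g \<in> tower j. \<exists>p. p \<noteq> 0 \<and> (\<forall>z. f z * g z = poly p (base z))"
  using assms
proof (induction j arbitrary: f z0)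
  case 0
  from 0(1) obtain p where p: "f = (\<lambda>z. poly p (base z))" by (rule tower_0E)
  have "(\<lambda>z. 1) \<in> tower 0" by (rule tower_const) simp
  with p 0 show ?case by (intro bexI[of _ "\<lambda>z. 1"] exI[of _ p]) auto
next
  case (Suc j)
  from Suc.prems(1) obtain a b where ab: "a \<in> tower j" "b \<in> tower j" and eq: "f = (\<lambda>z. a z + b z * Y j z)"
    by (rule tower_SucE)
  have j: "j \<le> n" "j < n" using Suc by auto
  define u where "u = (\<lambda>z. a z ^ 2 - poly (c j) (base z) * b z ^ 2)"
  have u: "u \<in> tower j" unfolding u_def by (intro tower_diff tower_mult tower_power tower_poly ab j)
  have "\<exists>z. u z \<noteq> 0"
  proof (rule ccontr)
    assume "\<not> ?thesis"
    then have "a z ^ 2 = poly (c j) (base z) * b z ^ 2" for z by (simp add: u_def)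
    from tower_not_square[OF ab j(2) this, of z0] Suc.prems(3) show False by (auto simp: eq)
  qed
  then obtain g p where g: "g \<in> tower j" "p \<noteq> 0" "\<forall>z. u z * g z = poly p (base z)"
    using Suc.IH[OF u j(1)] by blast
  define h where "h = (\<lambda>z. (a z - b z * Y j z) * g z)"
  have "h \<in> tower (Suc j)" unfolding h_def
    by (intro tower_mult tower_diff tower_Y tower_Suc ab g j Suc.prems) auto
  moreover have "f z * h z = poly p (base z)" for z
  proof -
    have "f z * h z = (a z ^ 2 - (Y j z * Y j z) * b z ^ 2) * g z"
      unfolding eq h_def by (simp add: algebra_simps power2_eq_square)
    also have "\<dots> = u z * g z" unfolding Y_square[OF j(2)] u_def by simp
    finally show ?thesis using g by simp
  qed
  ultimately show ?case using g by blast
qed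

lemma tower_no_zero_divisors:
  assumes "f \<in> tower j" "g \<in> tower j" "j \<le> n" "\<And>z. f z * g z = 0"
  shows "(\<forall>z. f z = 0) \<or> (\<forall>z. g z = 0)"
proof (rule ccontr)
  assume "\<not> ?thesis"
  then obtain z0 z1 where z: "f z0 \<noteq> 0" "g z1 \<noteq> 0" by auto
  obtain f' p where f': "p \<noteq> 0" "\<And>z. f z * f' z = poly p (base z)" using tower_norm[OF assms(1,3) z(1)] by metis
  obtain g' q where g': "q \<noteq> 0" "\<And>z. g z * g' z = poly q (base z)" using tower_norm[OF assms(2,3) z(2)] by metis
  have "poly p x * poly q x = 0" for x
    using f'(2)[of "Sheet x undefined"] g'(2)[of "Sheet x undefined"] assms(4)[of "Sheet x undefined"] by (metis sheet_point.sel mult_eq_0_iff)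
  then have "p * q = 0" by (intro poly_eqI_everywhere) simp
  then show False using f' g' by simp
qed

text \<open>Different indices may carry the same exponents, hence a conclusion about sums over one
  exponent pattern \<open>b\<close>. Grouping by the exponent of the top root gives an even and an
  odd part, each zero by uniqueness of the split.\<close>

lemma tower_independent_monomials:
  assumes "finite K" "j \<le> n" "\<And>m i. m \<in> K \<Longrightarrow> i < j \<Longrightarrow> e m i \<le> (1::nat)"
    and "\<And>z. (\<Sum>m\<in>K. poly (p m) (base z) * (\<Prod>i<j. Y i z ^ e m i)) = 0"
  shows "(\<Sum>m | m \<in> K \<and> (\<forall>i<j. e m i = b i). p m) = 0"
  using assms
proof (induction j arbitrary: K)
  case 0
  have "poly (\<Sum>m\<in>K. p m) x = 0" for x using 0(4)[of "Sheet x undefined"] by (simp add: poly_sum)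
  then have "(\<Sum>m\<in>K. p m) = 0" by (intro poly_eqI_everywhere) simp
  then show ?case by simp
next
  case (Suc j)
  have j: "j \<le> n" "j < n" using Suc by auto
  define F where "F = (\<lambda>a z. \<Sum>m | m \<in> K \<and> e m j = a. poly (p m) (base z) * (\<Prod>i<j. Y i z ^ e m i))"
  have F: "F a \<in> tower j" for a
    unfolding F_def using Suc.prems(1) j
    by (intro tower_sum tower_mult tower_poly tower_prod tower_power tower_Y) auto
  have "F 0 z + F 1 z * Y j z = 0" for z
  proof -
    have "0 = (\<Sum>m\<in>K. poly (p m) (base z) * (\<Prod>i<Suc j. Y i z ^ e m i))" using Suc.prems(4) by simp
    also have "\<dots> = (\<Sum>m | m \<in> K \<and> e m j = 0. poly (p m) (base z) * (\<Prod>i<Suc j. Y i z ^ e m i))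
                + (\<Sum>m | m \<in> K \<and> e m j = 1. poly (p m) (base z) * (\<Prod>i<Suc j. Y i z ^ e m i))"
    proof (subst sum.union_disjoint[symmetric])
      have "e m j = 0 \<or> e m j = 1" if "m \<in> K" for m using Suc.prems(3)[OF that, of j] by linarith
      then have "K = {m. m \<in> K \<and> e m j = 0} \<union> {m. m \<in> K \<and> e m j = 1}" by auto
      then show "(\<Sum>m\<in>K. poly (p m) (base z) * (\<Prod>i<Suc j. Y i z ^ e m i)) =
        (\<Sum>m\<in>{m. m \<in> K \<and> e m j = 0} \<union> {m. m \<in> K \<and> e m j = 1}. poly (p m) (base z) * (\<Prod>i<Suc j. Y i z ^ e m i))"
        by simp
    qed (use Suc.prems(1) in auto)
    also have "\<dots> = F 0 z + F 1 z * Y j z"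
      unfolding F_def sum_distrib_right by (intro arg_cong2[of _ _ _ _ "(+)"] sum.cong) (auto simp: mult_ac)
    finally show ?thesis by simp
  qed
  note F0 = tower_split_unique[OF F F j(2) this]
  have "F (b j) z = 0" if "b j \<le> 1" for z
    using F0[of z] that by (cases "b j = 0") (auto simp: le_Suc_eq)
  then have *: "F (b j) z = 0" for z
  proof (cases "b j \<le> 1")
    case False
    then have "{m. m \<in> K \<and> e m j = b j} = {}" using Suc.prems(3) by fastforce
    then show ?thesis unfolding F_def by (simp only: sum.empty)
  qed
  have "(\<Sum>m | m \<in> {m. m \<in> K \<and> e m j = b j} \<and> (\<forall>i<j. e m i = b i). p m) = 0"
    by (rule Suc.IH) (use Suc.prems * in \<open>auto simp: F_def\<close>)
  moreover have "{m. m \<in> {m. m \<in> K \<and> e m j = b j} \<and> (\<forall>i<j. e m i = b i)} = {m. m \<in> K \<and> (\<forall>i<Suc j. e m i = b i)}"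
    by (auto simp: less_Suc_eq)
  ultimately show ?case by simp
qed

end

section \<open>Polynomials as finitely supported maps\<close>

definition monom_eval :: "(nat \<Rightarrow>\<^sub>0 nat) \<Rightarrow> (nat \<Rightarrow> 'k::comm_ring_1) \<Rightarrow> 'k" where
  "monom_eval m v = (\<Prod>i\<in>Poly_Mapping.keys m. v i ^ Poly_Mapping.lookup m i)"

definition monom_degree :: "(nat \<Rightarrow>\<^sub>0 nat) \<Rightarrow> nat" where
  "monom_degree m = (\<Sum>i\<in>Poly_Mapping.keys m. Poly_Mapping.lookup m i)"

abbreviation unit_monom :: "nat \<Rightarrow> (nat \<Rightarrow>\<^sub>0 nat)" where
  "unit_monom i \<equiv> Poly_Mapping.single i 1"

lemma monom_eval_superset:
  "finite A \<Longrightarrow> Poly_Mapping.keys m \<subseteq> A \<Longrightarrow> monom_eval m v = (\<Prod>i\<in>A. v i ^ Poly_Mapping.lookup m i)"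
  unfolding monom_eval_def by (rule prod.mono_neutral_left) (auto simp: in_keys_iff)

lemma monom_degree_superset:
  "finite A \<Longrightarrow> Poly_Mapping.keys m \<subseteq> A \<Longrightarrow> monom_degree m = (\<Sum>i\<in>A. Poly_Mapping.lookup m i)"
  unfolding monom_degree_def by (rule sum.mono_neutral_left) (auto simp: in_keys_iff)

lemma keys_plus_nat: "Poly_Mapping.keys (m + n :: nat \<Rightarrow>\<^sub>0 nat) = Poly_Mapping.keys m \<union> Poly_Mapping.keys n"
  by (auto simp: in_keys_iff lookup_add)

lemma monom_eval_add: "monom_eval (m + n) v = monom_eval m v * monom_eval n v"
  by (simp add: monom_eval_superset[of "Poly_Mapping.keys m \<union> Poly_Mapping.keys n"]
      keys_plus_nat lookup_add power_add prod.distrib)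

lemma monom_degree_add: "monom_degree (m + n) = monom_degree m + monom_degree n"
  by (simp add: monom_degree_superset[of "Poly_Mapping.keys m \<union> Poly_Mapping.keys n"]
      keys_plus_nat lookup_add sum.distrib)

lemma monom_eval_single [simp]: "monom_eval (Poly_Mapping.single i k) v = v i ^ k"
  by (simp add: monom_eval_def)

lemma monom_degree_single [simp]: "monom_degree (Poly_Mapping.single i k) = k"
  by (simp add: monom_degree_def)

lemma monom_eval_0 [simp]: "monom_eval 0 v = 1" and monom_degree_0 [simp]: "monom_degree 0 = 0"
  by (simp_all add: monom_eval_def monom_degree_def)

lemma monom_eval_scale:
  "monom_eval m (\<lambda>i. c * v i) = c ^ monom_degree m * monom_eval m (v :: nat \<Rightarrow> 'k::comm_ring_1)"
  unfolding monom_eval_def monom_degree_def by (simp add: power_mult_distrib prod.distrib power_sum)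

lemma mp_eval_superset:
  "finite K \<Longrightarrow> Poly_Mapping.keys f \<subseteq> K \<Longrightarrow>
    mp_eval f v = (\<Sum>m\<in>K. Poly_Mapping.lookup f m * monom_eval m v)"
  unfolding mp_eval_def monom_eval_def[symmetric]
  by (rule sum.mono_neutral_left) (auto simp: in_keys_iff)

lemma mp_eval_0 [simp]: "mp_eval 0 v = 0"
  by (simp add: mp_eval_def)

lemma mp_eval_single [simp]: "mp_eval (Poly_Mapping.single m c) v = c * monom_eval m v"
  by (subst mp_eval_superset[of "{m}"]) auto

lemma mp_eval_add: "mp_eval (f + g) v = mp_eval f v + mp_eval g v"
proof -
  let ?K = "Poly_Mapping.keys f \<union> Poly_Mapping.keys g"
  have "Poly_Mapping.keys (f + g) \<subseteq> ?K" by (rule keys_add)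
  then show ?thesis
    by (simp add: mp_eval_superset[of ?K] lookup_add distrib_right sum.distrib)
qed

lemma mp_eval_sum: "mp_eval (\<Sum>i\<in>A. f i) v = (\<Sum>i\<in>A. mp_eval (f i) v)"
  by (induction A rule: infinite_finite_induct) (auto simp: mp_eval_add)

lemma mpoly_expansion: "(f :: 'k::comm_ring_1 mpoly) = (\<Sum>m\<in>Poly_Mapping.keys f. Poly_Mapping.single m (Poly_Mapping.lookup f m))"
  by (rule poly_mapping_eqI) (auto simp: lookup_sum lookup_single when_def in_keys_iff)

lemma mpoly_induct [case_names zero single add]:
  assumes "P 0" "\<And>m c. P (Poly_Mapping.single m c)" "\<And>f g. P f \<Longrightarrow> P g \<Longrightarrow> P (f + g)"
  shows "P (f :: 'k::comm_ring_1 mpoly)"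
proof -
  have "finite K \<Longrightarrow> P (\<Sum>m\<in>K. Poly_Mapping.single m (Poly_Mapping.lookup f m))" for K
    by (induction K rule: finite_induct) (auto intro: assms)
  then show ?thesis using mpoly_expansion[of f] by (metis finite_keys)
qed

lemma mp_eval_mult: "mp_eval (f * g) v = mp_eval f v * mp_eval g v"
proof (induction f rule: mpoly_induct)
  case (single m c)
  show ?case
    by (induction g rule: mpoly_induct)
       (auto simp: mult_single monom_eval_add mp_eval_add distrib_left distrib_right mult_ac)
qed (auto simp: mp_eval_add distrib_right)

lemma mp_eval_uminus: "mp_eval (- f) v = - mp_eval f v"
  using mp_eval_add[of f "- f" v] by (simp add: eq_neg_iff_add_eq_0 add.commute)

lemma mp_eval_diff: "mp_eval (f - g) v = mp_eval f v - mp_eval g v"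
  using mp_eval_add[of f "- g" v] by (simp add: mp_eval_uminus)

lemmas mp_eval_simps = mp_eval_add mp_eval_diff mp_eval_mult mp_eval_uminus mp_eval_sum

section \<open>Partial derivatives and the product rule\<close>

lemma mp_partial_superset:
  "finite K \<Longrightarrow> Poly_Mapping.keys f \<subseteq> K \<Longrightarrow> mp_partial i f = (\<Sum>m\<in>K.
      Poly_Mapping.single (m - unit_monom i) (of_nat (Poly_Mapping.lookup m i) * Poly_Mapping.lookup f m))"
  unfolding mp_partial_def by (rule sum.mono_neutral_left) (auto simp: in_keys_iff)

lemma mp_partial_single:
  "mp_partial i (Poly_Mapping.single m c) =
    Poly_Mapping.single (m - unit_monom i) (of_nat (Poly_Mapping.lookup m i) * c)"
  by (subst mp_partial_superset[of "{m}"]) auto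

lemma mp_partial_add: "mp_partial i (f + g) = mp_partial i f + mp_partial i g"
proof -
  let ?K = "Poly_Mapping.keys f \<union> Poly_Mapping.keys g"
  have "Poly_Mapping.keys (f + g) \<subseteq> ?K" by (rule keys_add)
  then show ?thesis
    by (simp add: mp_partial_superset[of ?K] lookup_add distrib_left single_add sum.distrib)
qed

lemma mp_partial_0 [simp]: "mp_partial i 0 = 0"
  by (simp add: mp_partial_def)

definition gradient :: "'k::comm_ring_1 mpoly \<Rightarrow> (nat \<Rightarrow> 'k) \<Rightarrow> nat \<Rightarrow> 'k" where
  "gradient f v i = mp_eval (mp_partial i f) v"

lemma gradient_0 [simp]: "gradient 0 v i = 0"
  by (simp add: gradient_def)

lemma gradient_add: "gradient (f + g) v i = gradient f v i + gradient g v i"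
  by (simp add: gradient_def mp_partial_add mp_eval_add)

lemma gradient_single:
  "gradient (Poly_Mapping.single m c) v i = of_nat (Poly_Mapping.lookup m i) * c * monom_eval (m - unit_monom i) v"
  by (simp add: gradient_def mp_partial_single)

lemma gradient_uminus: "gradient (- f) v i = - gradient f v i"
  using gradient_add[of f "- f" v i] by (simp add: eq_neg_iff_add_eq_0 add.commute)

lemma gradient_diff: "gradient (f - g) v i = gradient f v i - gradient g v i"
  using gradient_add[of f "- g" v i] by (simp add: gradient_uminus)

text \<open>The scalar factor covers the case where the exponent in \<open>m\<close> is 0 and
  truncated subtraction would take the unit from \<open>n\<close> instead.\<close>

lemma monom_eval_add_minus_unit:
  "of_nat (Poly_Mapping.lookup m i) * monom_eval (m + n - unit_monom i) v
    = of_nat (Poly_Mapping.lookup m i) * (monom_eval (m - unit_monom i) v * monom_eval n v)"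
proof (cases "Poly_Mapping.lookup m i = 0")
  case False
  have "m + n - unit_monom i = (m - unit_monom i) + n"
    by (rule poly_mapping_eqI) (use False in \<open>auto simp: lookup_add lookup_minus lookup_single when_def\<close>)
  then show ?thesis by (simp add: monom_eval_add)
qed simp

lemma gradient_mult: "gradient (f * g) v i = gradient f v i * mp_eval g v + mp_eval f v * gradient g v i"
proof (induction f rule: mpoly_induct)
  case (single m a)
  show ?case
  proof (induction g rule: mpoly_induct)
    case (single n b)
    have "gradient (Poly_Mapping.single m a * Poly_Mapping.single n b) v i
      = a * b * (of_nat (Poly_Mapping.lookup m i) * monom_eval (m + n - unit_monom i) v)
      + a * b * (of_nat (Poly_Mapping.lookup n i) * monom_eval (n + m - unit_monom i) v)"
      by (simp add: mult_single gradient_single lookup_add algebra_simps)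
    also have "\<dots> = gradient (Poly_Mapping.single m a) v i * mp_eval (Poly_Mapping.single n b) v
      + mp_eval (Poly_Mapping.single m a) v * gradient (Poly_Mapping.single n b) v i"
      unfolding monom_eval_add_minus_unit by (simp add: gradient_single algebra_simps)
    finally show ?case .
  qed (auto simp: gradient_add mp_eval_add algebra_simps)
qed (auto simp: gradient_add mp_eval_add algebra_simps)

section \<open>Forms\<close>

lemma forms_iff:
  "f \<in> forms n d \<longleftrightarrow> (\<forall>m\<in>Poly_Mapping.keys f. Poly_Mapping.keys m \<subseteq> {0..n} \<and> monom_degree m = d)"
  by (simp add: forms_def monom_degree_def)

lemma forms_0 [simp]: "0 \<in> forms n d"
  by (simp add: forms_iff)

lemma forms_add: "f \<in> forms n d \<Longrightarrow> g \<in> forms n d \<Longrightarrow> f + g \<in> forms n d"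
  unfolding forms_iff using keys_add[of f g] by blast

lemma forms_uminus: "f \<in> forms n d \<Longrightarrow> - f \<in> forms n d"
  unfolding forms_iff by (simp add: in_keys_iff)

lemma forms_diff: "f \<in> forms n d \<Longrightarrow> g \<in> forms n d \<Longrightarrow> f - g \<in> forms n d"
  using forms_add[OF _ forms_uminus, of f n d g] by simp

lemma forms_mult: "f \<in> forms n d \<Longrightarrow> g \<in> forms n e \<Longrightarrow> f * g \<in> forms n (d + e)"
  unfolding forms_iff
proof
  fix m assume *: "\<forall>m\<in>Poly_Mapping.keys f. Poly_Mapping.keys m \<subseteq> {0..n} \<and> monom_degree m = d"
    "\<forall>m\<in>Poly_Mapping.keys g. Poly_Mapping.keys m \<subseteq> {0..n} \<and> monom_degree m = e"
    "m \<in> Poly_Mapping.keys (f * g)"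
  then obtain a b where "a \<in> Poly_Mapping.keys f" "b \<in> Poly_Mapping.keys g" "m = a + b"
    using keys_mult[of f g] by blast
  then show "Poly_Mapping.keys m \<subseteq> {0..n} \<and> monom_degree m = d + e"
    using * by (auto simp: keys_plus_nat monom_degree_add)
qed

lemma forms_single:
  "Poly_Mapping.keys m \<subseteq> {0..n} \<Longrightarrow> monom_degree m = d \<Longrightarrow> Poly_Mapping.single m c \<in> forms n d"
  by (auto simp: forms_iff)

lemma forms_scale: "f \<in> forms n d \<Longrightarrow> Poly_Mapping.single 0 c * f \<in> forms n d"
  using forms_mult[OF forms_single[of 0 n 0 c], of f d] by simp

lemma mp_eval_homogeneous:
  assumes "f \<in> forms n d"
  shows "mp_eval f (\<lambda>i. c * v i) = c ^ d * mp_eval f (v :: nat \<Rightarrow> 'k::comm_ring_1)"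
proof -
  have "mp_eval f (\<lambda>i. c * v i) = (\<Sum>m\<in>Poly_Mapping.keys f. Poly_Mapping.lookup f m * (c ^ d * monom_eval m v))"
    unfolding mp_eval_superset[OF finite_keys order.refl, of f] using assms
    by (intro sum.cong) (auto simp: monom_eval_scale forms_iff)
  then show ?thesis
    by (simp add: mp_eval_superset[OF finite_keys order.refl, of f] sum_distrib_left mult_ac)
qed

section \<open>Zariski closed sets\<close>

lemma vanishing_formsD: "f \<in> vanishing_forms n d Z \<Longrightarrow> v \<in> Z \<Longrightarrow> mp_eval f v = 0"
  by (simp add: vanishing_forms_def)

lemma vanishing_forms_antimono: "Z \<subseteq> W \<Longrightarrow> vanishing_forms n d W \<subseteq> vanishing_forms n d Z"
  by (auto simp: vanishing_forms_def)

lemma zariski_closedI: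
  assumes "Z \<subseteq> proj_space n"
    and "\<And>v. v \<in> proj_space n \<Longrightarrow> v \<notin> Z \<Longrightarrow> \<exists>d. \<exists>f\<in>vanishing_forms n d Z. mp_eval f v \<noteq> 0"
  shows "zariski_closed n Z"
  unfolding zariski_closed_def zariski_closure_def
  using assms by (auto simp: vanishing_forms_def) blast

lemma zariski_closed_subset: "zariski_closed n Z \<Longrightarrow> Z \<subseteq> proj_space n"
  unfolding zariski_closed_def zariski_closure_def by auto

lemma zariski_closed_separate:
  "zariski_closed n Z \<Longrightarrow> v \<in> proj_space n \<Longrightarrow> v \<notin> Z \<Longrightarrow> \<exists>d. \<exists>f\<in>vanishing_forms n d Z. mp_eval f v \<noteq> 0"
  unfolding zariski_closed_def zariski_closure_def by blast

lemma zariski_closed_Un: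
  fixes A B :: "(nat \<Rightarrow> 'k::alg_closed_field) set"
  assumes "zariski_closed n A" "zariski_closed n B"
  shows "zariski_closed n (A \<union> B)"
proof (rule zariski_closedI)
  show "A \<union> B \<subseteq> proj_space n" using assms zariski_closed_subset by auto
  fix v :: "nat \<Rightarrow> 'k" assume v: "v \<in> proj_space n" "v \<notin> A \<union> B"
  obtain d f where f: "f \<in> vanishing_forms n d A" "mp_eval f v \<noteq> 0"
    using zariski_closed_separate[OF assms(1) v(1)] v by blast
  obtain e g where g: "g \<in> vanishing_forms n e B" "mp_eval g v \<noteq> 0"
    using zariski_closed_separate[OF assms(2) v(1)] v by blast
  have "f * g \<in> vanishing_forms n (d + e) (A \<union> B)"
    using f g by (auto simp: vanishing_forms_def mp_eval_mult intro: forms_mult)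
  moreover have "mp_eval (f * g) v \<noteq> 0" using f g by (simp add: mp_eval_mult)
  ultimately show "\<exists>d. \<exists>f\<in>vanishing_forms n d (A \<union> B). mp_eval f v \<noteq> 0" by blast
qed

lemma zariski_closed_empty: "zariski_closed n ({} :: (nat \<Rightarrow> 'k::alg_closed_field) set)"
proof (rule zariski_closedI)
  fix v :: "nat \<Rightarrow> 'k"
  have "Poly_Mapping.single 0 1 \<in> vanishing_forms n 0 ({} :: (nat \<Rightarrow> 'k) set)"
    by (auto simp: vanishing_forms_def simp del: single_one intro!: forms_single)
  moreover have "mp_eval (Poly_Mapping.single 0 1) v \<noteq> 0"
    unfolding mp_eval_single by simp
  ultimately show "\<exists>d. \<exists>f\<in>vanishing_forms n d {}. mp_eval f v \<noteq> 0" by blast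
qed simp

lemma zariski_closed_Int:
  fixes A B :: "(nat \<Rightarrow> 'k::alg_closed_field) set"
  assumes "zariski_closed n A" "zariski_closed n B"
  shows "zariski_closed n (A \<inter> B)"
proof (rule zariski_closedI)
  show "A \<inter> B \<subseteq> proj_space n" using assms zariski_closed_subset by auto
  fix v :: "nat \<Rightarrow> 'k" assume "v \<in> proj_space n" "v \<notin> A \<inter> B"
  then have "(\<exists>d. \<exists>f\<in>vanishing_forms n d A. mp_eval f v \<noteq> 0) \<or> (\<exists>d. \<exists>f\<in>vanishing_forms n d B. mp_eval f v \<noteq> 0)"
    using zariski_closed_separate assms by blast
  then show "\<exists>d. \<exists>f\<in>vanishing_forms n d (A \<inter> B). mp_eval f v \<noteq> 0"
    using vanishing_forms_antimono[of "A \<inter> B" A n] vanishing_forms_antimono[of "A \<inter> B" B n] by blast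
qed

lemma zariski_closed_UN:
  "finite I \<Longrightarrow> (\<And>i. i \<in> I \<Longrightarrow> zariski_closed n (C i)) \<Longrightarrow> zariski_closed n (\<Union>i\<in>I. C i)"
  by (induction I rule: finite_induct) (auto intro: zariski_closed_Un zariski_closed_empty)

lemma zariski_closed_zariski_closure: "zariski_closed n (zariski_closure n Z)"
proof (rule zariski_closedI)
  fix v assume v: "v \<in> proj_space n" "v \<notin> zariski_closure n Z"
  then obtain d f where f: "f \<in> vanishing_forms n d Z" "mp_eval f v \<noteq> 0"
    unfolding zariski_closure_def by blast
  then have "f \<in> vanishing_forms n d (zariski_closure n Z)"
    by (auto simp: vanishing_forms_def zariski_closure_def)
  with f show "\<exists>d. \<exists>f\<in>vanishing_forms n d (zariski_closure n Z). mp_eval f v \<noteq> 0" by blast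
qed (auto simp: zariski_closure_def)

lemma zariski_closed_scale:
  assumes "zariski_closed n Z" "v \<in> Z" "c \<noteq> 0"
  shows "(\<lambda>i. c * v i) \<in> Z"
proof (rule ccontr)
  assume *: "(\<lambda>i. c * v i) \<notin> Z"
  have "v \<in> proj_space n" using assms zariski_closed_subset by blast
  then have "(\<lambda>i. c * v i) \<in> proj_space n"
    using assms(3) by (auto simp: proj_space_def fun_eq_iff)
  then obtain d f where f: "f \<in> vanishing_forms n d Z" "mp_eval f (\<lambda>i. c * v i) \<noteq> 0"
    using zariski_closed_separate[OF assms(1)] * by blast
  then show False using assms(2) mp_eval_homogeneous[of f n d c v]
    by (auto simp: vanishing_forms_def)
qed

text \<open>Intersecting with one \<open>C i\<close> and with the union of the others splits
  \<open>Z\<close> into two closed parts.\<close>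

lemma irreducible_closed_cover:
  assumes "irreducible_closed n Z" "finite I" "\<And>i. i \<in> I \<Longrightarrow> zariski_closed n (C i)" "Z \<subseteq> (\<Union>i\<in>I. C i)"
  shows "\<exists>i\<in>I. Z \<subseteq> C i"
  using assms(2-4)
proof (induction I rule: finite_induct)
  case empty
  then show ?case using assms(1) by (auto simp: irreducible_closed_def)
next
  case (insert i I)
  have Z: "zariski_closed n Z" using assms(1) by (simp add: irreducible_closed_def)
  have "zariski_closed n (Z \<inter> C i)" "zariski_closed n (Z \<inter> (\<Union>i\<in>I. C i))"
    using insert Z by (intro zariski_closed_Int zariski_closed_UN; auto)+
  moreover have "Z = (Z \<inter> C i) \<union> (Z \<inter> (\<Union>i\<in>I. C i))" using insert.prems by auto
  ultimately have "Z = Z \<inter> C i \<or> Z = Z \<inter> (\<Union>i\<in>I. C i)"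
    using assms(1) unfolding irreducible_closed_def by blast
  then show ?case using insert by blast
qed

section \<open>Points of projective space\<close>

text \<open>The affine cone without origin of the projective point with coordinates \<open>v\<close>.\<close>

definition proj_point :: "(nat \<Rightarrow> 'k::field) \<Rightarrow> (nat \<Rightarrow> 'k) set" where
  "proj_point v = {\<lambda>i. c * v i | c. c \<noteq> 0}"

lemma self_in_proj_point: "v \<in> proj_point v"
  unfolding proj_point_def by (rule CollectI, rule exI[of _ 1]) auto

lemma zariski_closed_proj_point:
  fixes v :: "nat \<Rightarrow> 'k::alg_closed_field"
  assumes "v \<in> proj_space n"
  shows "zariski_closed n (proj_point v)"
proof (rule zariski_closedI)
  show "proj_point v \<subseteq> proj_space n" using assms by (auto simp: proj_point_def proj_space_def fun_eq_iff)
  fix w :: "nat \<Rightarrow> 'k" assume w: "w \<in> proj_space n" "w \<notin> proj_point v"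
  obtain j where j: "v j \<noteq> 0" using assms by (auto simp: proj_space_def fun_eq_iff)
  then have "j \<le> n" using assms by (force simp: proj_space_def)
  \<comment> \<open>With v_j nonzero, the linear forms v_j X_i - v_i X_j cut out the line through
    \<open>v\<close>: a vector on which all of them vanish is a multiple of
    \<open>v\<close>.\<close>
  have "\<exists>i\<le>n. v j * w i \<noteq> v i * w j"
  proof (rule ccontr)
    assume "\<not> ?thesis"
    then have eq: "v j * w i = v i * w j" if "i \<le> n" for i using that by blast
    have "w = (\<lambda>i. (w j / v j) * v i)"
    proof
      fix i show "w i = (w j / v j) * v i"
        using eq[of i] j w(1) assms by (cases "i \<le> n") (auto simp: field_simps proj_space_def)
    qed
    moreover have "w j \<noteq> 0"
    proof
      assume "w j = 0"
      with calculation have "w i = 0" for i by (metis div_0 mult_zero_left)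
      with w(1) show False by (auto simp: proj_space_def)
    qed
    with j have "w j / v j \<noteq> 0" by simp
    ultimately show False using w(2) unfolding proj_point_def by blast
  qed
  then obtain i where i: "i \<le> n" "v j * w i \<noteq> v i * w j" by blast
  define f where "f = Poly_Mapping.single (unit_monom i) (v j) - Poly_Mapping.single (unit_monom j) (v i)"
  have "f \<in> vanishing_forms n 1 (proj_point v)"
    unfolding vanishing_forms_def f_def
    using i \<open>j \<le> n\<close> by (auto intro!: forms_diff forms_single simp: mp_eval_simps proj_point_def)
  moreover have "mp_eval f w \<noteq> 0" using i by (simp add: f_def mp_eval_simps)
  ultimately show "\<exists>d. \<exists>f\<in>vanishing_forms n d (proj_point v). mp_eval f w \<noteq> 0" by blast
qed

text \<open>Closed sets are stable under scaling, so one vector of a punctured line brings in the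
  whole line. This makes points the minimal nonempty closed sets.\<close>

lemma zariski_closed_subset_proj_point:
  assumes "zariski_closed n Z" "Z \<subseteq> proj_point v" "Z \<noteq> {}"
  shows "Z = proj_point v"
proof -
  obtain c where c: "c \<noteq> 0" "(\<lambda>i. c * v i) \<in> Z" using assms unfolding proj_point_def by blast
  have "(\<lambda>i. e * v i) \<in> Z" if "e \<noteq> 0" for e
    using zariski_closed_scale[OF assms(1) c(2), of "e / c"] c that by (simp add: field_simps)
  then show ?thesis using assms(2) by (auto simp: proj_point_def)
qed

lemma irreducible_closed_proj_point:
  "v \<in> proj_space n \<Longrightarrow> irreducible_closed n (proj_point v)"
  unfolding irreducible_closed_def
  using zariski_closed_proj_point self_in_proj_point zariski_closed_subset_proj_point
  by (metis Un_upper1 Un_upper2 empty_iff sup_bot.left_neutral)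

lemma poly_mapping_vector_space:
  "vector_space (\<lambda>c f. Poly_Mapping.single 0 c * f :: 'k::field mpoly)"
  by unfold_locales (simp_all add: algebra_simps single_add mult_single flip: mult.assoc)

lemma function_vector_space: "vector_space (\<lambda>c (v :: nat \<Rightarrow> 'k::field) i. c * v i)"
  by unfold_locales (auto simp: fun_eq_iff algebra_simps)

section \<open>The projective curve\<close>

text \<open>As in Euclid's argument on primes: the product of all linear factors x - a, plus 1,
  would have positive degree and no root.\<close>

lemma alg_closed_infinite: "infinite (UNIV :: 'k::alg_closed_field set)"
proof
  assume fin: "finite (UNIV :: 'k set)"
  define p where "p = (\<Prod>a\<in>(UNIV :: 'k set). [:- a, 1:]) + 1"
  have val: "poly p x = 1" for x
    using fin by (simp add: p_def poly_prod prod_zero[of UNIV] prod_zero_iff)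
  have "Polynomial.degree (\<Prod>a\<in>(UNIV :: 'k set). [:- a, 1:]) = card (UNIV :: 'k set)"
    by (simp add: degree_prod_eq_sum_degree)
  moreover have "card (UNIV :: 'k set) > 0" using fin by (simp add: card_gt_0_iff)
  ultimately have "Polynomial.degree p > 0" unfolding p_def by (subst degree_add_eq_left) auto
  then obtain x where "poly p x = 0" using alg_closed_imp_poly_has_root by blast
  with val show False by simp
qed

lemma finite_bounded_vectors:
  assumes "finite F"
  shows "finite {v :: nat \<Rightarrow> 'k::zero. (\<forall>i>n. v i = 0) \<and> (\<forall>i\<le>n. v i \<in> F)}"
proof (rule finite_subset)
  show "{v. (\<forall>i>n. v i = 0) \<and> (\<forall>i\<le>n. v i \<in> F)} \<subseteq> {v. \<forall>i. (i \<in> {..n} \<longrightarrow> v i \<in> F) \<and> (i \<notin> {..n} \<longrightarrow> v i = 0)}"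
    by auto
  show "finite {v :: nat \<Rightarrow> 'k. \<forall>i. (i \<in> {..n} \<longrightarrow> v i \<in> F) \<and> (i \<notin> {..n} \<longrightarrow> v i = 0)}"
    using assms by (intro finite_set_of_finite_funs) auto
qed

declare single_numeral [simp del]

text \<open>Abstracts from the word: \<open>e i\<close> is the coefficient at position
  \<open>i\<close>. Characteristic different from 2 and 3 makes the constants 0, 1, 2, 3 by which
  the four scaled squares differ pairwise distinct.\<close>

locale diagonal_curve =
  fixes e :: "nat \<Rightarrow> 'k::alg_closed_field"
  assumes e_nonzero: "i \<in> {1..4} \<Longrightarrow> e i \<noteq> 0"
    and two: "(2::'k) \<noteq> 0" and three: "(3::'k) \<noteq> 0"
begin

definition quadric :: "nat \<Rightarrow> 'k mpoly" where
  "quadric i = Poly_Mapping.single (Poly_Mapping.single i 2) (e i)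
     - Poly_Mapping.single (Poly_Mapping.single 1 2) (e 1)
     - Poly_Mapping.single (Poly_Mapping.single 0 2) (of_nat (i - 1))"

definition proj_curve :: "(nat \<Rightarrow> 'k) set" where
  "proj_curve = {v \<in> proj_space 4. \<forall>i\<in>{2,3,4}. mp_eval (quadric i) v = 0}"

definition affine_part :: "(nat \<Rightarrow> 'k) set" where
  "affine_part = {v \<in> proj_curve. v 0 = 1}"

text \<open>The multipliers are arbitrary polynomials, not forms; the graded pieces are recovered by
  intersecting with \<open>forms 4 d\<close>.\<close>

definition quadric_ideal :: "'k mpoly set" where
  "quadric_ideal = {\<Sum>i\<in>{2,3,4}. g i * quadric i | g. True}"

definition reduced_forms :: "nat \<Rightarrow> 'k mpoly set" where
  "reduced_forms d = {g \<in> forms 4 d. \<forall>m\<in>Poly_Mapping.keys g. \<forall>i\<in>{2,3,4}. Poly_Mapping.lookup m i \<le> 1}"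

lemma mp_eval_quadric: "mp_eval (quadric i) v = e i * v i ^ 2 - e 1 * v 1 ^ 2 - of_nat (i - 1) * v 0 ^ 2"
  by (simp add: quadric_def mp_eval_simps)

lemma quadric_form: "i \<in> {2,3,4} \<Longrightarrow> quadric i \<in> forms 4 2"
  unfolding quadric_def by (intro forms_diff forms_single) auto

lemma proj_curve_iff: "v \<in> proj_curve \<longleftrightarrow> v \<in> proj_space 4 \<and>
    (\<forall>i\<in>{2,3,4}. e i * v i ^ 2 = e 1 * v 1 ^ 2 + of_nat (i - 1) * v 0 ^ 2)"
  by (auto simp: proj_curve_def mp_eval_quadric diff_diff_eq)

lemma quadric_ideal_add: "f \<in> quadric_ideal \<Longrightarrow> g \<in> quadric_ideal \<Longrightarrow> f + g \<in> quadric_ideal"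
proof -
  assume "f \<in> quadric_ideal" "g \<in> quadric_ideal"
  then obtain a b where "f = (\<Sum>i\<in>{2,3,4}. a i * quadric i)" "g = (\<Sum>i\<in>{2,3,4}. b i * quadric i)"
    by (auto simp: quadric_ideal_def)
  then have "f + g = (\<Sum>i\<in>{2,3,4}. (a i + b i) * quadric i)" by (simp add: distrib_right)
  then show ?thesis unfolding quadric_ideal_def by (intro CollectI exI[of _ "\<lambda>i. a i + b i"]) simp
qed

lemma quadric_ideal_mult: "i \<in> {2,3,4} \<Longrightarrow> g * quadric i \<in> quadric_ideal"
  unfolding quadric_ideal_def
  by (intro CollectI exI[of _ "\<lambda>j. if j = i then g else 0"]) (auto simp: if_distrib[of "\<lambda>x. x * _"] cong: if_cong)

lemma quadric_ideal_0: "0 \<in> quadric_ideal"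
  unfolding quadric_ideal_def by (intro CollectI exI[of _ "\<lambda>_. 0"]) simp

lemma quadric_ideal_vanishes: "f \<in> quadric_ideal \<Longrightarrow> v \<in> proj_curve \<Longrightarrow> mp_eval f v = 0"
  by (auto simp: quadric_ideal_def proj_curve_def mp_eval_simps)

text \<open>By the product rule, the terms that differentiate a multiplier carry a factor
  \<open>quadric i\<close> evaluated at \<open>v\<close>, which is 0 on the curve.\<close>

lemma quadric_ideal_gradient:
  assumes "f \<in> quadric_ideal" "v \<in> proj_curve"
  shows "\<exists>l. \<forall>j. gradient f v j = (\<Sum>i\<in>{2,3,4}. l i * gradient (quadric i) v j)"
proof -
  obtain g where "f = (\<Sum>i\<in>{2,3,4}. g i * quadric i)" using assms(1) by (auto simp: quadric_ideal_def)
  then have "\<forall>j. gradient f v j = (\<Sum>i\<in>{2,3,4}. mp_eval (g i) v * gradient (quadric i) v j)"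
    using assms(2) by (simp add: gradient_add gradient_mult proj_curve_def)
  then show ?thesis by (intro exI[of _ "\<lambda>i. mp_eval (g i) v"])
qed

section \<open>Normal forms modulo the quadrics\<close>

lemma reduced_forms_0: "0 \<in> reduced_forms d"
  by (simp add: reduced_forms_def)

lemma reduced_forms_add: "f \<in> reduced_forms d \<Longrightarrow> g \<in> reduced_forms d \<Longrightarrow> f + g \<in> reduced_forms d"
  unfolding reduced_forms_def using keys_add[of f g] by (auto intro: forms_add)

text \<open>Trading X_i^2 for (e_1 X_1^2 + (i - 1) X_0^2) / e_i moves two exponents to X_1 or X_0,
  so the total exponent in X_2, X_3, X_4 drops and the rewriting ends.\<close>

lemma reduce_monomial:
  "Poly_Mapping.keys m \<subseteq> {0..4} \<Longrightarrow> monom_degree m = d \<Longrightarrow>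
    \<exists>g\<in>reduced_forms d. \<exists>h\<in>quadric_ideal. Poly_Mapping.single m c = g + h"
proof (induction "Poly_Mapping.lookup m 2 + Poly_Mapping.lookup m 3 + Poly_Mapping.lookup m 4"
    arbitrary: m c rule: less_induct)
  case less
  show ?case
  proof (cases "\<forall>i\<in>{2,3,4}. Poly_Mapping.lookup m i \<le> 1")
    case True
    then have "Poly_Mapping.single m c \<in> reduced_forms d"
      using less.prems by (auto simp: reduced_forms_def intro: forms_single)
    then show ?thesis using quadric_ideal_0 by force
  next
    case False
    then obtain i where i: "i \<in> {2,3,4}" "Poly_Mapping.lookup m i \<ge> 2" by force
    define m' where "m' = m - Poly_Mapping.single i 2"
    have m: "m = m' + Poly_Mapping.single i 2"
      unfolding m'_def by (rule poly_mapping_eqI)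
        (use i(2) in \<open>auto simp: lookup_add lookup_minus lookup_single when_def\<close>)
    have keys: "Poly_Mapping.keys m' \<subseteq> {0..4}" and deg: "monom_degree m' + 2 = d"
      using less.prems unfolding m keys_plus_nat monom_degree_add by auto
    have ei: "e i \<noteq> 0" using e_nonzero[of i] i(1) by auto
    have ex: "\<exists>g\<in>reduced_forms d. \<exists>h\<in>quadric_ideal. Poly_Mapping.single (m' + Poly_Mapping.single k 2) a = g + h"
      if "k \<in> {0, 1}" for k a
    proof (rule less.hyps)
      show "Poly_Mapping.lookup (m' + Poly_Mapping.single k 2) 2 + Poly_Mapping.lookup (m' + Poly_Mapping.single k 2) 3
        + Poly_Mapping.lookup (m' + Poly_Mapping.single k 2) 4
        < Poly_Mapping.lookup m 2 + Poly_Mapping.lookup m 3 + Poly_Mapping.lookup m 4"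
        using i(1) that unfolding m by (auto simp: lookup_add lookup_single when_def)
    qed (use keys deg that in \<open>auto simp: keys_plus_nat monom_degree_add\<close>)
    have split: "Poly_Mapping.single m c = Poly_Mapping.single m' (c / e i) * quadric i
      + Poly_Mapping.single (m' + Poly_Mapping.single 1 2) (c / e i * e 1)
      + Poly_Mapping.single (m' + Poly_Mapping.single 0 2) (c / e i * of_nat (i - 1))"
      unfolding quadric_def m using ei by (simp add: right_diff_distrib mult_single)
    obtain g1 h1 g2 h2 where gh: "g1 \<in> reduced_forms d" "h1 \<in> quadric_ideal" "g2 \<in> reduced_forms d" "h2 \<in> quadric_ideal"
      "Poly_Mapping.single (m' + Poly_Mapping.single 1 2) (c / e i * e 1) = g1 + h1"
      "Poly_Mapping.single (m' + Poly_Mapping.single 0 2) (c / e i * of_nat (i - 1)) = g2 + h2"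
      using ex[of 1 "c / e i * e 1"] ex[of 0 "c / e i * of_nat (i - 1)"] by blast
    have "Poly_Mapping.single m c = (g1 + g2) + (Poly_Mapping.single m' (c / e i) * quadric i + h1 + h2)"
      unfolding split gh by (simp add: algebra_simps)
    then show ?thesis
      using reduced_forms_add[OF gh(1,3)]
        quadric_ideal_add[OF quadric_ideal_add[OF quadric_ideal_mult[OF i(1), of "Poly_Mapping.single m' (c / e i)"] gh(2)] gh(4)]
      by blast
  qed
qed

lemma reduce_form:
  assumes "f \<in> forms 4 d"
  shows "\<exists>g\<in>reduced_forms d. \<exists>h\<in>quadric_ideal. f = g + h"
proof -
  have "finite K \<Longrightarrow> K \<subseteq> Poly_Mapping.keys f \<Longrightarrow> \<exists>g\<in>reduced_forms d. \<exists>h\<in>quadric_ideal.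
    (\<Sum>m\<in>K. Poly_Mapping.single m (Poly_Mapping.lookup f m)) = g + h" for K
  proof (induction K rule: finite_induct)
    case empty
    then show ?case using reduced_forms_0 quadric_ideal_0 by force
  next
    case (insert m K)
    then obtain g h where gh: "g \<in> reduced_forms d" "h \<in> quadric_ideal"
      "(\<Sum>m\<in>K. Poly_Mapping.single m (Poly_Mapping.lookup f m)) = g + h" by auto
    obtain g' h' where gh': "g' \<in> reduced_forms d" "h' \<in> quadric_ideal"
      "Poly_Mapping.single m (Poly_Mapping.lookup f m) = g' + h'"
      using reduce_monomial[of m d "Poly_Mapping.lookup f m"] assms insert.prems by (auto simp: forms_iff)
    have "(\<Sum>m\<in>insert m K. Poly_Mapping.single m (Poly_Mapping.lookup f m)) = (g' + g) + (h' + h)"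
      using insert.hyps by (simp add: gh gh' algebra_simps)
    then show ?case using reduced_forms_add[OF gh'(1) gh(1)] quadric_ideal_add[OF gh'(2) gh(2)] by blast
  qed
  from this[OF finite_keys order.refl] show ?thesis using mpoly_expansion[of f] by metis
qed

text \<open>On the chart \<open>X\<^sub>0 = 1\<close>, the coordinate \<open>X\<close> with index \<open>j + 2\<close> is a square root of \<open>radicand j\<close>
  evaluated at \<open>X\<^sub>1\<close>.\<close>

definition radicand :: "nat \<Rightarrow> 'k poly" where
  "radicand j = smult (inverse (e (j + 2))) [:of_nat (j + 1), 0, e 1:]"

definition branch_root :: "nat \<Rightarrow> 'k" where
  "branch_root j = (SOME r. r ^ 2 = - of_nat (j + 1) / e 1)"

text \<open>The radicand is an even polynomial, so its other zero is the negative of the chosen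
  one.\<close>

definition cofactor :: "nat \<Rightarrow> 'k poly" where
  "cofactor j = smult (e 1 / e (j + 2)) [:branch_root j, 1:]"

definition square_root :: "nat \<Rightarrow> 'k \<Rightarrow> 'k" where
  "square_root j x = (SOME y. y ^ 2 = poly (radicand j) x)"

lemma branch_root: "branch_root j ^ 2 = - of_nat (j + 1) / e 1"
  unfolding branch_root_def by (rule someI_ex) (use nth_root_exists[of 2] in auto)

lemma square_root: "square_root j x ^ 2 = poly (radicand j) x"
  unfolding square_root_def by (rule someI_ex) (use nth_root_exists[of 2] in auto)

lemma small_nat_nonzero: "n \<in> {1, 2, 3} \<Longrightarrow> (of_nat n :: 'k) \<noteq> 0"
  using two three by auto

lemma poly_radicand: "poly (radicand j) x = (e 1 * x ^ 2 + of_nat (j + 1)) / e (j + 2)"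
  by (simp add: radicand_def divide_inverse algebra_simps power2_eq_square)

sublocale sheets: quadratic_tower 3 radicand cofactor branch_root square_root
proof
  show "(2::'k) \<noteq> 0" by (rule two)
  show "infinite (UNIV :: 'k set)" by (rule alg_closed_infinite)
  fix j :: nat
  have e1: "e 1 \<noteq> 0" using e_nonzero by simp
  show "square_root j x ^ 2 = poly (radicand j) x" for x by (rule square_root)
  have sq: "e 1 * branch_root j ^ 2 = - of_nat (j + 1)" using branch_root[of j] e1 by simp
  assume j: "j < 3"
  have ej: "e (j + 2) \<noteq> 0" using e_nonzero[of "j + 2"] j by auto
  show "radicand j = [:- branch_root j, 1:] * cofactor j"
  proof -
    have "[:- branch_root j, 1:] * [:branch_root j, 1:] = [:of_nat (j + 1) / e 1, 0, 1:]"
    proof -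
      have "of_nat (j + 1) / e 1 = - (branch_root j * branch_root j)"
        by (simp only: branch_root[unfolded power2_eq_square] minus_divide_left minus_minus)
      then show ?thesis by simp
    qed
    then have "[:- branch_root j, 1:] * cofactor j = smult (e 1 / e (j + 2)) [:of_nat (j + 1) / e 1, 0, 1:]"
      unfolding cofactor_def mult_smult_right by simp
    then show ?thesis using e1 by (simp add: radicand_def divide_inverse mult_ac)
  qed
  \<comment> \<open>A branch point is nonzero, its square being -(j + 1) / e_1 with j + 1 among 1,
    2, 3. It therefore differs from its negative and is a simple root.\<close>
  have "of_nat (j + 1) \<noteq> (0 :: 'k)" using j by (intro small_nat_nonzero) auto
  then have "branch_root j \<noteq> 0" using sq by (metis mult_zero_right neg_equal_0_iff_equal zero_power2)
  moreover have "poly (cofactor j) (branch_root j) = e 1 / e (j + 2) * (2 * branch_root j)"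
    by (simp add: cofactor_def algebra_simps)
  ultimately show "poly (cofactor j) (branch_root j) \<noteq> 0" using e1 ej two by simp
  fix l assume l: "l < j"
  have el: "e (l + 2) \<noteq> 0" using e_nonzero[of "l + 2"] j l by auto
  \<comment> \<open>At this branch point e_1 x^2 = -(j + 1), so the numerator of radicand
    \<open>l\<close> is (l + 1) - (j + 1), and j - l is 1 or 2.\<close>
  have "poly (radicand l) (branch_root j) = - of_nat (j - l) / e (l + 2)"
    unfolding poly_radicand sq using l by (simp add: of_nat_diff)
  moreover have "of_nat (j - l) \<noteq> (0 :: 'k)" using j l by (intro small_nat_nonzero) auto
  ultimately show "poly (radicand l) (branch_root j) \<noteq> 0" using el by simp
qed

text \<open>A parametrisation of the affine part that is surjective but not injective: the sign of a
  vanishing root and all signs from index 3 on have no effect.\<close>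

definition curve_point :: "'k sheet_point \<Rightarrow> nat \<Rightarrow> 'k" where
  "curve_point z i = (if i = 0 then 1 else if i = 1 then base z else if i \<le> 4 then sheets.Y (i - 2) z else 0)"

lemma curve_point_simps: "curve_point z 0 = 1" "curve_point z (Suc 0) = base z" "curve_point z 1 = base z"
  "curve_point z 2 = sheets.Y 0 z" "curve_point z 3 = sheets.Y 1 z" "curve_point z 4 = sheets.Y 2 z"
  by (simp_all add: curve_point_def)

lemma curve_point_in: "curve_point z \<in> affine_part"
proof -
  have "e (j + 2) * sheets.Y j z ^ 2 = e 1 * base z ^ 2 + of_nat (j + 1)" if "j < 3" for j
    using sheets.Y_square[OF that, of z] e_nonzero[of "j + 2"] that
    unfolding power2_eq_square[of "sheets.Y j z"] poly_radicand by (simp add: power2_eq_square)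
  from this[of 0] this[of 1] this[of 2]
  have "e 2 * sheets.Y 0 z ^ 2 = e 1 * base z ^ 2 + of_nat 1" "e 3 * sheets.Y 1 z ^ 2 = e 1 * base z ^ 2 + of_nat 2"
    "e 4 * sheets.Y 2 z ^ 2 = e 1 * base z ^ 2 + of_nat 3" by (simp_all add: eval_nat_numeral)
  moreover have "curve_point z \<in> proj_space 4"
    using curve_point_simps(1)[of z] unfolding proj_space_def by (auto simp: curve_point_def fun_eq_iff)
  ultimately show ?thesis unfolding affine_part_def proj_curve_iff
    by (auto simp: curve_point_simps)
qed

lemma affine_part_curve_point:
  assumes "v \<in> affine_part"
  shows "\<exists>z. v = curve_point z"
proof -
  define z where "z = Sheet (v 1) (\<lambda>j. v (j + 2) = square_root j (v 1))"
  have Y: "sheets.Y j z = v (j + 2)" if "j < 3" for j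
  proof -
    have "e (j + 2) * v (j + 2) ^ 2 = e 1 * v 1 ^ 2 + of_nat (j + 1)"
      using assms that by (auto simp: affine_part_def proj_curve_iff less_Suc_eq numeral_3_eq_3 eval_nat_numeral)
    then have "v (j + 2) ^ 2 = square_root j (v 1) ^ 2"
      using e_nonzero[of "j + 2"] that unfolding square_root poly_radicand by (simp add: field_simps)
    then show ?thesis by (auto simp: sheets.Y_def z_def power2_eq_iff)
  qed
  have "v i = curve_point z i" for i
  proof -
    consider "i = 0" | "i = 1" | "i = 2" | "i = 3" | "i = 4" | "i > 4" by linarith
    then show ?thesis
      using assms Y[of 0] Y[of 1] Y[of 2]
      by cases (auto simp: affine_part_def proj_curve_def proj_space_def curve_point_simps z_def
          eval_nat_numeral curve_point_def)
  qed
  then show ?thesis by blast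
qed

lemma mp_eval_curve_point_tower: "(\<lambda>z. mp_eval f (curve_point z)) \<in> sheets.tower 3"
proof (induction f rule: mpoly_induct)
  case (single m c)
  have "(\<lambda>z. curve_point z i) \<in> sheets.tower 3" for i
  proof -
    consider "i = 0" | "i = 1" | "i \<in> {2..4}" | "i > 4" by force
    then show ?thesis
      using sheets.tower_const[of 3] sheets.tower_poly[of 3 "[:0, 1:]"] sheets.tower_Y[of "i - 2" 3]
      by cases (auto simp: curve_point_def)
  qed
  then show ?case unfolding mp_eval_single monom_eval_def
    by (intro sheets.tower_mult sheets.tower_const sheets.tower_prod sheets.tower_power) auto
qed (auto simp: mp_eval_add intro: sheets.tower_const sheets.tower_add)

text \<open>On the chart X_0 = 1 a reduced monomial becomes a power of x times a product of distinct
  roots. Independence treats each pattern of roots separately, the power of x separates the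
  monomials of one pattern, and homogeneity restores the lost exponent of X_0.\<close>

lemma reduced_form_vanishing:
  assumes "g \<in> reduced_forms d" "\<And>z. mp_eval g (curve_point z) = 0"
  shows "g = 0"
proof (rule ccontr)
  assume "g \<noteq> 0"
  then obtain m0 where m0: "m0 \<in> Poly_Mapping.keys g" using keys_eq_empty[of g] by fastforce
  let ?e = "\<lambda>m i. Poly_Mapping.lookup m (i + 2)"
  let ?p = "\<lambda>m. Polynomial.monom (Poly_Mapping.lookup g m) (Poly_Mapping.lookup m 1)"
  have g: "monom_degree m = d" "Poly_Mapping.keys m \<subseteq> {0..4}" "\<forall>i\<in>{2,3,4}. Poly_Mapping.lookup m i \<le> 1"
    if "m \<in> Poly_Mapping.keys g" for m
    using assms(1) that by (auto simp: reduced_forms_def forms_iff)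
  have five: "{0..4::nat} = {0,1,2,3,4}" by auto
  have "(\<Sum>m | m \<in> Poly_Mapping.keys g \<and> (\<forall>i<3. ?e m i = ?e m0 i). ?p m) = 0"
  proof (rule sheets.tower_independent_monomials)
    fix m i assume "m \<in> Poly_Mapping.keys g" "i < (3::nat)"
    then show "?e m i \<le> 1" using g(3)[of m] by (auto simp: less_Suc_eq numeral_3_eq_3 eval_nat_numeral)
  next
    fix z
    have "monom_eval m (curve_point z) = base z ^ Poly_Mapping.lookup m 1 * (\<Prod>i<3. sheets.Y i z ^ ?e m i)"
      if "m \<in> Poly_Mapping.keys g" for m
    proof -
      have "{..<3::nat} = {0,1,2}" by auto
      then show ?thesis unfolding monom_eval_superset[OF finite_atLeastAtMost g(2)[OF that]] five
        by (simp add: curve_point_simps mult_ac flip: numeral_2_eq_2 numeral_3_eq_3)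
    qed
    then have "mp_eval g (curve_point z) = (\<Sum>m\<in>Poly_Mapping.keys g. poly (?p m) (base z) * (\<Prod>i<3. sheets.Y i z ^ ?e m i))"
      unfolding mp_eval_superset[OF finite_keys order.refl, of g]
      by (intro sum.cong) (auto simp: poly_monom)
    with assms(2) show "(\<Sum>m\<in>Poly_Mapping.keys g. poly (?p m) (base z) * (\<Prod>i<3. sheets.Y i z ^ ?e m i)) = 0"
      by metis
  qed auto
  then have "0 = Polynomial.coeff (\<Sum>m | m \<in> Poly_Mapping.keys g \<and> (\<forall>i<3. ?e m i = ?e m0 i). ?p m) (Poly_Mapping.lookup m0 1)"
    by simp
  also have "\<dots> = (\<Sum>m | m \<in> Poly_Mapping.keys g \<and> (\<forall>i<3. ?e m i = ?e m0 i).
      if m = m0 then Poly_Mapping.lookup g m else 0)"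
    unfolding coeff_sum coeff_monom
  proof (rule sum.cong)
    fix m assume "m \<in> {m. m \<in> Poly_Mapping.keys g \<and> (\<forall>i<3. ?e m i = ?e m0 i)}"
    then have m: "m \<in> Poly_Mapping.keys g" and eq': "\<And>i. i < 3 \<Longrightarrow> ?e m i = ?e m0 i"
      by blast+
    have eq: "?e m 0 = ?e m0 0" "?e m 1 = ?e m0 1" "?e m 2 = ?e m0 2" by (rule eq'; simp)+
    have "m = m0" if 1: "Poly_Mapping.lookup m 1 = Poly_Mapping.lookup m0 1"
    proof (rule poly_mapping_eqI)
      have "(\<Sum>i\<in>{0..4}. Poly_Mapping.lookup m i) = (\<Sum>i\<in>{0..4}. Poly_Mapping.lookup m0 i)"
        using g(1,2)[OF m] g(1,2)[OF m0] monom_degree_superset[of "{0..4}" m] monom_degree_superset[of "{0..4}" m0]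
        by simp
      then have 0: "Poly_Mapping.lookup m 0 = Poly_Mapping.lookup m0 0"
        using eq 1 by (simp add: five eval_nat_numeral)
      fix i :: nat
      consider "i = 0" | "i = 1" | "i = 2" | "i = 3" | "i = 4" | "i > 4" by linarith
      then show "Poly_Mapping.lookup m i = Poly_Mapping.lookup m0 i"
      proof cases
        case 6
        then have "i \<notin> Poly_Mapping.keys m" "i \<notin> Poly_Mapping.keys m0" using g(2)[OF m] g(2)[OF m0] by auto
        then show ?thesis by (simp add: in_keys_iff)
      qed (use 0 1 eq in \<open>auto simp: eval_nat_numeral\<close>)
    qed
    then show "(if Poly_Mapping.lookup m 1 = Poly_Mapping.lookup m0 1 then Poly_Mapping.lookup g m else 0)
      = (if m = m0 then Poly_Mapping.lookup g m else 0)" by auto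
  qed simp
  also have "\<dots> = Poly_Mapping.lookup g m0" using m0 by simp
  finally show False using m0 by (simp add: in_keys_iff)
qed

section \<open>The vanishing ideal and irreducibility\<close>

lemma vanishing_form_in_ideal:
  assumes "f \<in> forms 4 d" "\<And>z. mp_eval f (curve_point z) = 0"
  shows "f \<in> quadric_ideal"
proof -
  obtain g h where gh: "g \<in> reduced_forms d" "h \<in> quadric_ideal" "f = g + h" using reduce_form[OF assms(1)] by blast
  have "mp_eval g (curve_point z) = 0" for z
    using assms(2)[of z] quadric_ideal_vanishes[OF gh(2), of "curve_point z"] curve_point_in[of z]
    by (simp add: gh(3) mp_eval_add affine_part_def)
  from reduced_form_vanishing[OF gh(1) this] gh show ?thesis by simp
qed

lemma vanishing_forms_affine_part: "vanishing_forms 4 d affine_part = forms 4 d \<inter> quadric_ideal"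
  using vanishing_form_in_ideal curve_point_in quadric_ideal_vanishes
  unfolding vanishing_forms_def affine_part_def by blast

lemma vanishing_forms_proj_curve: "vanishing_forms 4 d proj_curve = forms 4 d \<inter> quadric_ideal"
proof
  show "vanishing_forms 4 d proj_curve \<subseteq> forms 4 d \<inter> quadric_ideal"
    unfolding vanishing_forms_affine_part[symmetric]
    by (rule vanishing_forms_antimono) (auto simp: affine_part_def)
qed (auto simp: vanishing_forms_def intro: quadric_ideal_vanishes)

text \<open>A form that vanishes on the affine part already lies in the ideal of the quadrics, so it
  vanishes at the points with X_0 = 0 too; no component hides at infinity.\<close>

lemma closure_affine_part: "zariski_closure 4 affine_part = proj_curve"
proof
  show "proj_curve \<subseteq> zariski_closure 4 affine_part"
    unfolding zariski_closure_def vanishing_forms_affine_part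
    by (auto intro: quadric_ideal_vanishes simp: proj_curve_def)
  have "quadric i \<in> vanishing_forms 4 2 affine_part" if "i \<in> {2,3,4}" for i
    using quadric_form[OF that] that unfolding vanishing_forms_def affine_part_def proj_curve_def by blast
  then show "zariski_closure 4 affine_part \<subseteq> proj_curve"
    unfolding zariski_closure_def proj_curve_def by blast
qed

lemma zariski_closed_proj_curve: "zariski_closed 4 proj_curve"
  unfolding closure_affine_part[symmetric] by (rule zariski_closed_zariski_closure)

text \<open>Two closed parts that each miss a point would give two forms outside the ideal whose
  product vanishes on the chart, against the absence of zero divisors in the tower.\<close>

lemma irreducible_proj_curve: "irreducible_closed 4 proj_curve"
  unfolding irreducible_closed_def
proof (intro conjI allI impI)
  show "zariski_closed 4 proj_curve" by (rule zariski_closed_proj_curve)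
  show "proj_curve \<noteq> {}" using curve_point_in by (auto simp: affine_part_def)
  fix A B assume A: "zariski_closed 4 A" and B: "zariski_closed 4 B" and AB: "proj_curve = A \<union> B"
  show "proj_curve = A \<or> proj_curve = B"
  proof (rule ccontr)
    assume "\<not> ?thesis"
    then obtain v w where vw: "v \<in> proj_curve" "v \<notin> A" "w \<in> proj_curve" "w \<notin> B" using AB by blast
    obtain d f where f: "f \<in> vanishing_forms 4 d A" "mp_eval f v \<noteq> 0"
      using zariski_closed_separate[OF A _ vw(2)] vw(1) by (auto simp: proj_curve_def)
    obtain d' g where g: "g \<in> vanishing_forms 4 d' B" "mp_eval g w \<noteq> 0"
      using zariski_closed_separate[OF B _ vw(4)] vw(3) by (auto simp: proj_curve_def)
    have "mp_eval f (curve_point z) * mp_eval g (curve_point z) = 0" for z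
    proof -
      have "curve_point z \<in> A \<union> B" using curve_point_in[of z] unfolding AB[symmetric] affine_part_def by simp
      then show ?thesis using f(1) g(1) by (auto simp: vanishing_forms_def)
    qed
    then have "(\<forall>z. mp_eval f (curve_point z) = 0) \<or> (\<forall>z. mp_eval g (curve_point z) = 0)"
      by (intro sheets.tower_no_zero_divisors[of _ 3] mp_eval_curve_point_tower) auto
    then have "f \<in> quadric_ideal \<or> g \<in> quadric_ideal"
      using f(1) g(1) vanishing_form_in_ideal by (auto simp: vanishing_forms_def)
    then show False using f(2) g(2) vw(1,3) quadric_ideal_vanishes by auto
  qed
qed

end

section \<open>Dimension, smoothness and genus\<close>

lemma sum_fun_apply: "(\<Sum>i\<in>A. f i) x = (\<Sum>i\<in>A. f i x)"
  by (induction A rule: infinite_finite_induct) auto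

lemma finite_square_roots: "(a::'k::field) \<noteq> 0 \<Longrightarrow> finite {y. a * y ^ 2 = b}"
proof -
  assume "a \<noteq> 0"
  then have "finite {y. poly [:- b, 0, a:] y = 0}" by (intro poly_roots_finite) simp
  moreover have "{y. poly [:- b, 0, a:] y = 0} = {y. a * y ^ 2 = b}"
    by (auto simp: power2_eq_square algebra_simps)
  ultimately show ?thesis by simp
qed

lemma gradient_square:
  "gradient (Poly_Mapping.single (Poly_Mapping.single i 2) c) v j = (if j = i then 2 * c * v i else 0)"
proof -
  have "Poly_Mapping.single i 2 - unit_monom i = unit_monom i"
    by (rule poly_mapping_eqI) (simp add: lookup_minus lookup_single when_def)
  then show ?thesis by (simp add: gradient_single lookup_single when_def)
qed

lemma poly_eqI_eventually:
  fixes p q :: "rat poly"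
  assumes "\<And>d. d \<ge> d0 \<Longrightarrow> poly p (of_nat d) = poly q (of_nat d)"
  shows "p = q"
proof (rule ccontr)
  assume "p \<noteq> q"
  then have "finite {x. poly (p - q) x = 0}" by (intro poly_roots_finite) simp
  moreover have "of_nat ` {d0..} \<subseteq> {x. poly (p - q) x = 0}" using assms by auto
  moreover have "infinite (of_nat ` {d0..} :: rat set)"
    by (subst finite_image_iff) (auto intro: inj_onI simp: infinite_Ici)
  ultimately show False by (meson finite_subset)
qed

section \<open>Proper closed subsets and dimension one\<close>

context diagonal_curve
begin

text \<open>Every point can therefore be normalised either to X_0 = 1 or to X_0 = 0, X_1 =
  1.\<close>

lemma proj_curve_coordinate_0:
  assumes "v \<in> proj_curve" "v 0 = 0"
  shows "v 1 \<noteq> 0"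
proof
  assume v1: "v 1 = 0"
  have "v i = 0" if "i \<in> {2,3,4}" for i
    using assms v1 that e_nonzero[of i] by (auto simp: proj_curve_iff)
  moreover have "v i = 0" if "i > 4" for i using assms that by (auto simp: proj_curve_iff proj_space_def)
  ultimately have "v i = 0" for i
  proof -
    consider "i = 0" | "i = 1" | "i \<in> {2,3,4}" | "i > 4" by force
    then show ?thesis using assms v1 \<open>\<And>i. i \<in> {2,3,4} \<Longrightarrow> v i = 0\<close> \<open>\<And>i. i > 4 \<Longrightarrow> v i = 0\<close> by cases auto
  qed
  then have "v = (\<lambda>_. 0)" by auto
  with assms show False by (simp add: proj_curve_iff proj_space_def)
qed

text \<open>On the chart, the norm turns zeros of \<open>f\<close> into roots of a polynomial in
  x_1. The remaining coordinates solve quadratic equations with finitely many right-hand sides, so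
  all normalised zeros have their coordinates in one finite set.\<close>

lemma finite_zeros:
  assumes f: "f \<in> forms 4 d" "f \<notin> quadric_ideal"
  shows "\<exists>T. finite T \<and> T \<subseteq> proj_curve \<and> (\<forall>w\<in>proj_curve. mp_eval f w = 0 \<longrightarrow> (\<exists>t\<in>T. w \<in> proj_point t))"
proof -
  obtain z0 where "mp_eval f (curve_point z0) \<noteq> 0" using vanishing_form_in_ideal f by blast
  then obtain g p where p: "p \<noteq> 0" "\<And>z. mp_eval f (curve_point z) * g z = poly p (base z)"
    using sheets.tower_norm[OF mp_eval_curve_point_tower[of f] order.refl] by blast
  \<comment> \<open>The value 1 is included for the points at infinity, which are normalised by X_1
    = 1.\<close>
  define P where "P = insert 1 {x. poly p x = 0}"
  define F where "F = {0, 1} \<union> P \<union> (\<Union>i\<in>{2,3,4}. \<Union>a\<in>P. \<Union>b\<in>{0,1}. {y. e i * y ^ 2 = e 1 * a ^ 2 + of_nat (i - 1) * b ^ 2})"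
  have finP: "finite P" using poly_roots_finite[OF p(1)] by (simp add: P_def)
  have "finite {y. e i * y ^ 2 = c}" if "i \<in> {2,3,4}" for i c
    using e_nonzero[of i] that by (intro finite_square_roots) auto
  then have finF: "finite F" unfolding F_def using finP by (intro finite_UnI finite_UN_I) auto
  define T where "T = {v \<in> proj_curve. \<forall>i\<le>4. v i \<in> F}"
  have TI: "v \<in> T" if v: "v \<in> proj_curve" "v 0 \<in> {0,1}" "v 1 \<in> P" for v
  proof -
    have "v i \<in> F" if "i \<in> {2,3,4}" for i
    proof -
      have "e i * v i ^ 2 = e 1 * v 1 ^ 2 + of_nat (i - 1) * v 0 ^ 2" using v(1) that unfolding proj_curve_iff by blast
      then show ?thesis unfolding F_def using v(2,3) that by blast
    qed
    moreover have "v 0 \<in> F" "v 1 \<in> F" using v unfolding F_def by auto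
    moreover have "i \<in> {0, 1, 2, 3, 4}" if "i \<le> 4" for i :: nat using that by auto
    ultimately show ?thesis unfolding T_def using v(1) by blast
  qed
  have scale: "(\<lambda>i. inverse c * w i) \<in> proj_curve" "w \<in> proj_point (\<lambda>i. inverse c * w i)"
    if "w \<in> proj_curve" "c \<noteq> 0" for w c
  proof -
    show "(\<lambda>i. inverse c * w i) \<in> proj_curve"
      by (rule zariski_closed_scale[OF zariski_closed_proj_curve]) (use that in auto)
    show "w \<in> proj_point (\<lambda>i. inverse c * w i)"
      unfolding proj_point_def using that by (intro CollectI exI[of _ c]) (auto simp: fun_eq_iff)
  qed
  have "\<exists>t\<in>T. w \<in> proj_point t" if w: "w \<in> proj_curve" "mp_eval f w = 0" for w
  proof (cases "w 0 = 0")
    case True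
    then have w1: "w 1 \<noteq> 0" using proj_curve_coordinate_0 w by blast
    have "(\<lambda>i. inverse (w 1) * w i) \<in> T"
      by (rule TI[OF scale(1)[OF w(1) w1]]) (use True w1 in \<open>auto simp: P_def\<close>)
    with scale(2)[OF w(1) w1] show ?thesis by blast
  next
    case False
    let ?v = "\<lambda>i. inverse (w 0) * w i"
    have "?v \<in> affine_part" unfolding affine_part_def using scale(1)[OF w(1) False] False by simp
    then obtain z where z: "?v = curve_point z" using affine_part_curve_point by blast
    have "mp_eval f ?v = 0" using mp_eval_homogeneous[OF f(1), of "inverse (w 0)" w] w by simp
    then have "poly p (base z) = 0" using p(2)[of z] unfolding z by simp
    moreover have "?v 1 = base z" using fun_cong[OF z, of 1] by (simp only: curve_point_simps)
    ultimately have "?v 1 \<in> P" by (simp only: P_def) simp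
    then have "?v \<in> T" using False by (intro TI[OF scale(1)[OF w(1) False]]) auto
    with scale(2)[OF w(1) False] show ?thesis by blast
  qed
  moreover have "finite T"
    by (rule finite_subset[OF _ finite_bounded_vectors[OF finF, of 4]]) (auto simp: T_def proj_curve_def proj_space_def)
  moreover have "T \<subseteq> proj_curve" by (auto simp: T_def)
  ultimately show ?thesis by blast
qed

text \<open>A form vanishing on \<open>W\<close> but not on the whole curve has finitely many
  projective zeros, and irreducibility leaves only one of them.\<close>

lemma irreducible_proper_subset_point:
  assumes W: "irreducible_closed 4 W" "W \<subset> proj_curve"
  shows "\<exists>t\<in>proj_curve. W = proj_point t"
proof -
  have cl: "zariski_closed 4 W" and ne: "W \<noteq> {}" using W by (auto simp: irreducible_closed_def)
  obtain v where v: "v \<in> proj_curve" "v \<notin> W" using W by blast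
  obtain d f where f: "f \<in> vanishing_forms 4 d W" "mp_eval f v \<noteq> 0"
    using zariski_closed_separate[OF cl _ v(2)] v(1) by (auto simp: proj_curve_def)
  have form: "f \<in> forms 4 d" "f \<notin> quadric_ideal"
    using f v quadric_ideal_vanishes by (auto simp: vanishing_forms_def)
  from finite_zeros[OF form] obtain T where T: "finite T" "T \<subseteq> proj_curve" "\<forall>w\<in>proj_curve. mp_eval f w = 0 \<longrightarrow> (\<exists>t\<in>T. w \<in> proj_point t)"
    by (elim exE conjE)
  have "W \<subseteq> (\<Union>t\<in>T. proj_point t)"
  proof
    fix w assume w: "w \<in> W"
    then have "w \<in> proj_curve" using W(2) by blast
    with T(3) vanishing_formsD[OF f(1) w] show "w \<in> (\<Union>t\<in>T. proj_point t)" by blast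
  qed
  moreover have "zariski_closed 4 (proj_point t)" if "t \<in> T" for t
    using T(2) that by (intro zariski_closed_proj_point) (auto simp: proj_curve_def)
  ultimately obtain t where "t \<in> T" "W \<subseteq> proj_point t"
    using irreducible_closed_cover[OF W(1) T(1)] by blast
  then show ?thesis using zariski_closed_subset_proj_point[OF cl _ ne] T(2) by blast
qed

lemma projective_curve_proj_curve: "projective_curve 4 proj_curve"
  unfolding projective_curve_def
proof (intro conjI)
  show "irreducible_closed 4 proj_curve" by (rule irreducible_proj_curve)
  define v w where "v = curve_point (Sheet 0 (\<lambda>_. True))" and "w = curve_point (Sheet 1 (\<lambda>_. True))"
  have v: "v \<in> proj_curve" "v 0 = 1" "v 1 = 0" and w: "w \<in> proj_curve" "w 0 = 1" "w 1 = 1"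
    using curve_point_in unfolding v_def w_def affine_part_def by (auto simp: curve_point_simps)
  have "w \<notin> proj_point v"
  proof
    assume "w \<in> proj_point v"
    then obtain c where "w = (\<lambda>i. c * v i)" unfolding proj_point_def by blast
    with v w show False by simp
  qed
  moreover have "proj_point v \<subseteq> proj_curve"
    using zariski_closed_scale[OF zariski_closed_proj_curve v(1)] by (auto simp: proj_point_def)
  ultimately have "proj_point v \<subset> proj_curve" using w by blast
  moreover have "irreducible_closed 4 (proj_point v)"
    using v(1) by (intro irreducible_closed_proj_point) (auto simp: proj_curve_def)
  ultimately show "\<exists>Y. irreducible_closed 4 Y \<and> Y \<subset> proj_curve" by blast
  show "\<not> (\<exists>Y W. irreducible_closed 4 Y \<and> irreducible_closed 4 W \<and> Y \<subset> W \<and> W \<subset> proj_curve)"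
  proof
    assume "\<exists>Y W. irreducible_closed 4 Y \<and> irreducible_closed 4 W \<and> Y \<subset> W \<and> W \<subset> proj_curve"
    then obtain Y W where YW: "irreducible_closed 4 Y" "irreducible_closed 4 W" "Y \<subset> W" "W \<subset> proj_curve" by blast
    obtain t where "W = proj_point t" using irreducible_proper_subset_point[OF YW(2,4)] by blast
    then have "Y = W" using zariski_closed_subset_proj_point[of 4 Y t] YW by (auto simp: irreducible_closed_def)
    with YW show False by blast
  qed
qed

section \<open>The Jacobian criterion\<close>

lemma gradient_quadric:
  "gradient (quadric i) v j = (if j = i then 2 * e i * v i else 0) - (if j = 1 then 2 * e 1 * v 1 else 0)
     - (if j = 0 then 2 * of_nat (i - 1) * v 0 else 0)"
  unfolding quadric_def gradient_diff gradient_square ..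

text \<open>For j = 2, 3, 4, coordinate j of the relation gives l_j v_j = 0. With t = e_1 v_1^2 and
  s = v_0^2, not both zero, the scaled squares t + (j - 1) s cannot vanish for two values of j. So
  if l_i is nonzero, it is the only nonzero coefficient and v_i = 0; coordinate 1 then gives v_1 =
  0, and s and t would both vanish.\<close>

lemma gradients_independent:
  assumes v: "v \<in> proj_curve"
    and zero: "\<And>j. (\<Sum>i\<in>{2,3,4}. l i * gradient (quadric i) v j) = 0"
    and i: "i \<in> {2,3,4}"
  shows "l i = 0"
proof -
  have coord: "l j = 0 \<or> v j = 0" if "j \<in> {2,3,4}" for j
    using zero[of j] that two e_nonzero[of j] by (auto simp: gradient_quadric)
  have coord1: "l 2 + l 3 + l 4 = 0 \<or> v 1 = 0"
  proof -
    have "- (2 * e 1 * v 1 * (l 2 + l 3 + l 4)) = 0" using zero[of 1] by (simp add: gradient_quadric algebra_simps)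
    then show ?thesis using two e_nonzero[of 1] by auto
  qed
  define s t where "s = v 0 ^ 2" and "t = e 1 * v 1 ^ 2"
  have eq: "e j * v j ^ 2 = t + of_nat (j - 1) * s" if "j \<in> {2,3,4}" for j
    using v that by (auto simp: proj_curve_iff s_def t_def)
  have nz: "\<not> (s = 0 \<and> t = 0)" using proj_curve_coordinate_0[OF v] e_nonzero[of 1] by (auto simp: s_def t_def)
  have two_zeros: "v j \<noteq> 0 \<or> v k \<noteq> 0" if "j \<in> {2,3,4}" "k \<in> {2,3,4}" "j < k" for j k
  proof (rule ccontr)
    assume "\<not> ?thesis"
    then have 0: "t + of_nat (j - 1) * s = 0" "t + of_nat (k - 1) * s = 0" using eq[OF that(1)] eq[OF that(2)] by auto
    have "of_nat (k - j) * s = (t + of_nat (k - 1) * s) - (t + of_nat (j - 1) * s)"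
      using that by (auto simp: algebra_simps)
    then have "of_nat (k - j) * s = 0" unfolding 0 by simp
    moreover have "of_nat (k - j) \<noteq> (0 :: 'k)" using that by (intro small_nat_nonzero) auto
    ultimately have "s = 0" by simp
    with 0 nz show False by simp
  qed
  show ?thesis
  proof (rule ccontr)
    assume li: "l i \<noteq> 0"
    then have vi: "v i = 0" using coord i by blast
    have "l j = 0" if "j \<in> {2,3,4}" "j \<noteq> i" for j
      using coord[OF that(1)] two_zeros[of i j] two_zeros[of j i] vi i that by (metis linorder_neqE_nat)
    then have "l 2 + l 3 + l 4 = l i" using i by auto
    with coord1 li have "v 1 = 0" by simp
    then have "t = 0" by (simp add: t_def)
    with eq[OF i] vi have "of_nat (i - 1) * s = 0" by simp
    moreover have "of_nat (i - 1) \<noteq> (0 :: 'k)" using i by (intro small_nat_nonzero) auto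
    ultimately show False using nz \<open>t = 0\<close> by simp
  qed
qed

lemma nonsingular_proj_curve: "nonsingular_curve 4 proj_curve"
  unfolding nonsingular_curve_def
proof (intro conjI ballI)
  show "projective_curve 4 proj_curve" by (rule projective_curve_proj_curve)
  fix v assume v: "v \<in> proj_curve"
  interpret V: vector_space "\<lambda>c (v :: nat \<Rightarrow> 'k) i. c * v i" by (rule function_vector_space)
  let ?G = "{(\<lambda>i. mp_eval (mp_partial i f) v) | f d. f \<in> vanishing_forms 4 d proj_curve}"
  let ?b = "\<lambda>i. gradient (quadric i) v"
  let ?B = "?b ` {2,3,4}"
  \<comment> \<open>Linear relations are indexed by the set of gradients, so these must be distinct;
    two equal ones would satisfy a relation with coefficients 1 and -1.\<close>
  have inj: "inj_on ?b {2,3,4}"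
  proof (rule inj_onI, rule ccontr)
    fix i k :: nat assume ik: "i \<in> {2,3,4}" "k \<in> {2,3,4}" "?b i = ?b k" "i \<noteq> k"
    have "(\<Sum>h\<in>{2,3,4}. (if h = i then 1 else if h = k then - 1 else 0) * gradient (quadric h) v j) = 0" for j
    proof -
      have "gradient (quadric i) v j = gradient (quadric k) v j" using ik(3) by (rule fun_cong)
      then show ?thesis using ik(1,2,4) by auto
    qed
    from gradients_independent[OF v this ik(1)] show False by simp
  qed
  have "V.dim ?G = 3"
  proof (rule V.dim_unique)
    show "?B \<subseteq> ?G"
    proof (rule image_subsetI)
      fix i :: nat assume i: "i \<in> {2,3,4}"
      have "quadric i \<in> vanishing_forms 4 2 proj_curve"
        using vanishing_forms_proj_curve[of 2] quadric_form[OF i] quadric_ideal_mult[OF i, of 1] by simp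
      then show "?b i \<in> ?G" unfolding gradient_def[abs_def] by blast
    qed
    show "?G \<subseteq> V.span ?B"
    proof
      fix x assume "x \<in> ?G"
      then obtain f d where f: "f \<in> vanishing_forms 4 d proj_curve" and x: "x = gradient f v"
        unfolding gradient_def[abs_def] by blast
      obtain l where l: "\<forall>j. gradient f v j = (\<Sum>i\<in>{2,3,4}. l i * gradient (quadric i) v j)"
        using quadric_ideal_gradient[OF _ v, of f] f vanishing_forms_proj_curve by blast
      have "x = (\<Sum>i\<in>{2,3,4}. (\<lambda>j. l i * ?b i j))"
        unfolding x by (rule ext) (simp only: sum_fun_apply l)
      also have "\<dots> \<in> V.span ?B" by (intro V.span_sum V.span_scale V.span_base) auto
      finally show "x \<in> V.span ?B" .
    qed
    show "V.independent ?B"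
    proof (rule V.independent_if_scalars_zero)
      fix u x assume sum: "(\<Sum>x\<in>?B. (\<lambda>i. u x * x i)) = 0" and x: "x \<in> ?B"
      then obtain i where i: "i \<in> {2,3,4}" "x = ?b i" by blast
      have "(\<Sum>i\<in>{2,3,4}. u (?b i) * gradient (quadric i) v j) = 0" for j
      proof -
        have "(\<Sum>i\<in>{2,3,4}. u (?b i) * gradient (quadric i) v j) = (\<Sum>x\<in>?B. (\<lambda>i. u x * x i)) j"
          unfolding sum.reindex[OF inj] sum_fun_apply comp_def ..
        then show ?thesis unfolding sum by simp
      qed
      from gradients_independent[OF v this i(1)] i(2) show "u x = 0" by simp
    qed simp
    show "card ?B = 3" unfolding card_image[OF inj] by simp
  qed
  then show "V.dim ?G + 1 = 4" by simp
qed

section \<open>Hilbert function and genus\<close>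

definition reduced_monoms :: "nat \<Rightarrow> (nat \<Rightarrow>\<^sub>0 nat) set" where
  "reduced_monoms d = {m. Poly_Mapping.keys m \<subseteq> {0..4} \<and> monom_degree m = d \<and> (\<forall>i\<in>{2,3,4}. Poly_Mapping.lookup m i \<le> 1)}"

text \<open>The total degree is fixed, so the exponent of X_0 is the slack in the last
  inequality.\<close>

lemma bij_betw_reduced_monoms:
  "bij_betw (\<lambda>m. ((Poly_Mapping.lookup m 2, Poly_Mapping.lookup m 3, Poly_Mapping.lookup m 4), Poly_Mapping.lookup m 1))
     (reduced_monoms d) {((a, b, c), j). a \<le> 1 \<and> b \<le> 1 \<and> c \<le> 1 \<and> a + b + c + j \<le> d}"
  (is "bij_betw ?f _ ?A")
proof -
  define g :: "(nat \<times> nat \<times> nat) \<times> nat \<Rightarrow> (nat \<Rightarrow>\<^sub>0 nat)" where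
    "g = (\<lambda>((a, b, c), j). Poly_Mapping.single 0 (d - (a + b + c + j)) + Poly_Mapping.single 1 j
      + Poly_Mapping.single 2 a + Poly_Mapping.single 3 b + Poly_Mapping.single 4 c)"
  have five: "{0..4::nat} = {0,1,2,3,4}" by auto
  have deg: "Poly_Mapping.lookup m 0 + Poly_Mapping.lookup m 1 + Poly_Mapping.lookup m 2 + Poly_Mapping.lookup m 3
      + Poly_Mapping.lookup m 4 = d" if "m \<in> reduced_monoms d" for m
    using that monom_degree_superset[of "{0..4}" m] by (simp add: reduced_monoms_def five)
  have gf: "g (?f m) = m" if m: "m \<in> reduced_monoms d" for m
  proof -
    have "Poly_Mapping.lookup m i = 0" if "i \<notin> {0,1,2,3,4}" for i
      using that m unfolding reduced_monoms_def five by (auto simp: in_keys_iff)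
    then show ?thesis
      using deg[OF m] unfolding g_def by (auto intro!: poly_mapping_eqI simp: lookup_add lookup_single when_def)
  qed
  have f: "?f m \<in> ?A" if "m \<in> reduced_monoms d" for m
    using deg[OF that] that by (auto simp: reduced_monoms_def)
  have fg: "?f (g x) = x \<and> g x \<in> reduced_monoms d" if "x \<in> ?A" for x
  proof -
    obtain a b c j where x: "x = ((a, b, c), j)" by (metis surj_pair)
    have le: "a \<le> 1" "b \<le> 1" "c \<le> 1" "a + b + c + j \<le> d" using that by (simp_all add: x)
    have lookup: "Poly_Mapping.lookup (g x) 1 = j" "Poly_Mapping.lookup (g x) 2 = a"
      "Poly_Mapping.lookup (g x) 3 = b" "Poly_Mapping.lookup (g x) 4 = c"
      by (simp_all add: g_def x lookup_add lookup_single)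
    have "Poly_Mapping.keys (g x) \<subseteq> {0..4}"
    proof
      fix i assume i: "i \<in> Poly_Mapping.keys (g x)"
      show "i \<in> {0..4}"
      proof (rule ccontr)
        assume "i \<notin> {0..4}"
        then have "Poly_Mapping.lookup (g x) i = 0" by (simp add: g_def x lookup_add lookup_single)
        with i show False by (simp add: in_keys_iff)
      qed
    qed
    moreover have "monom_degree (g x) = d" using le by (simp add: g_def x monom_degree_add)
    ultimately have "g x \<in> reduced_monoms d" using le(1-3) unfolding reduced_monoms_def by (simp add: lookup(2-4))
    moreover have "?f (g x) = x" unfolding lookup by (simp add: x)
    ultimately show ?thesis by blast
  qed
  show ?thesis
  proof (rule bij_betw_byWitness[where f' = g])
    show "\<forall>m\<in>reduced_monoms d. g (?f m) = m" by (rule ballI) (rule gf)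
    show "\<forall>x\<in>?A. ?f (g x) = x" using fg by (intro ballI) (rule conjunct1)
    show "?f ` reduced_monoms d \<subseteq> ?A" by (rule image_subsetI) (rule f)
    show "g ` ?A \<subseteq> reduced_monoms d" using fg by (intro image_subsetI) (rule conjunct2)
  qed
qed

text \<open>Each choice of exponents (a, b, c) leaves d + 1 - (a + b + c) powers of X_1, in total 8
  (d + 1) - 12. For d \<ge> 3 no subtraction is truncated.\<close>

lemma card_reduced_monoms: "d \<ge> 3 \<Longrightarrow> card (reduced_monoms d) + 4 = 8 * d"
proof -
  assume d: "d \<ge> 3"
  let ?I = "{0,1} \<times> {0,1} \<times> {0,1::nat}"
  have "card (reduced_monoms d) = card {((a, b, c), j). a \<le> 1 \<and> b \<le> 1 \<and> c \<le> 1 \<and> a + b + c + j \<le> (d::nat)}"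
    by (rule bij_betw_same_card[OF bij_betw_reduced_monoms])
  also have "{((a, b, c), j). a \<le> 1 \<and> b \<le> 1 \<and> c \<le> 1 \<and> a + b + c + j \<le> (d::nat)} = (SIGMA (a, b, c):?I. {..d - (a + b + c)})"
    using d by (auto simp: le_Suc_eq)
  also have "card \<dots> = (\<Sum>(a, b, c)\<in>?I. Suc (d - (a + b + c)))"
    by (subst card_SigmaI) (auto intro!: sum.cong)
  also have "\<dots> + 4 = 8 * d"
    using d by (simp add: sum.cartesian_product[symmetric])
  finally show ?thesis .
qed

lemma finite_monoms: "finite {m. Poly_Mapping.keys m \<subseteq> {0..4} \<and> monom_degree m = d}"
proof -
  have "Poly_Mapping.lookup m \<in> {v. (\<forall>i>4. v i = 0) \<and> (\<forall>i\<le>4. v i \<in> {0..d})}"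
    if "Poly_Mapping.keys m \<subseteq> {0..4}" "monom_degree m = d" for m
  proof -
    have "(\<Sum>i\<in>{0..4}. Poly_Mapping.lookup m i) = d"
      using monom_degree_superset[OF finite_atLeastAtMost that(1)] that(2) by simp
    then have "Poly_Mapping.lookup m i \<le> d" if "i \<le> 4" for i
      using member_le_sum[of i "{0..4}" "Poly_Mapping.lookup m"] that by simp
    moreover have "Poly_Mapping.lookup m i = 0" if "i > 4" for i
    proof -
      have "i \<notin> Poly_Mapping.keys m" using \<open>Poly_Mapping.keys m \<subseteq> {0..4}\<close> that by force
      then show ?thesis by (simp add: in_keys_iff)
    qed
    ultimately show ?thesis by simp
  qed
  then have "Poly_Mapping.lookup ` {m. Poly_Mapping.keys m \<subseteq> {0..4} \<and> monom_degree m = d}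
      \<subseteq> {v. (\<forall>i>4. v i = 0) \<and> (\<forall>i\<le>4. v i \<in> {0..d})}"
    by (intro image_subsetI) (elim CollectE conjE)
  then have "finite (Poly_Mapping.lookup ` {m. Poly_Mapping.keys m \<subseteq> {0..4} \<and> monom_degree m = d})"
    by (rule finite_subset) (intro finite_bounded_vectors finite_atLeastAtMost)
  then show ?thesis by (rule finite_imageD) (rule inj_onI, rule poly_mapping_eqI, simp)
qed

text \<open>Forms are the direct sum of reduced forms and vanishing forms, so the reduced monomials
  complete a basis of the vanishing forms to a basis of all forms.\<close>

lemma hilbert_function_proj_curve: "hilbert_function 4 proj_curve d = int (card (reduced_monoms d))"
proof -
  interpret V: vector_space "\<lambda>c f. Poly_Mapping.single 0 c * f :: 'k mpoly" by (rule poly_mapping_vector_space)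
  let ?F = "forms 4 d :: 'k mpoly set" and ?I = "vanishing_forms 4 d proj_curve"
  let ?s = "\<lambda>m. Poly_Mapping.single m (1 :: 'k)"
  let ?N = "{m. Poly_Mapping.keys m \<subseteq> {0..4} \<and> monom_degree m = d}"
  have expand: "f = (\<Sum>m\<in>Poly_Mapping.keys f. Poly_Mapping.single 0 (Poly_Mapping.lookup f m) * ?s m)" for f :: "'k mpoly"
    by (subst mpoly_expansion[of f]) (simp add: mult_single)
  have span_I: "V.subspace ?I"
    by (auto simp: V.subspace_def vanishing_forms_def mp_eval_simps intro: forms_add forms_scale)
  have span_R: "V.subspace (reduced_forms d)"
  proof (rule V.subspaceI)
    fix c f assume f: "f \<in> reduced_forms d"
    have "Poly_Mapping.keys (Poly_Mapping.single 0 c * f) \<subseteq> Poly_Mapping.keys f"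
      using keys_mult[of "Poly_Mapping.single 0 c" f] by (cases "c = 0") auto
    with f show "Poly_Mapping.single 0 c * f \<in> reduced_forms d"
      by (auto simp: reduced_forms_def intro: forms_scale)
  qed (auto intro: reduced_forms_0 reduced_forms_add)
  have reduced_span: "f \<in> V.span (?s ` reduced_monoms d)" if "f \<in> reduced_forms d" for f
    by (subst expand[of f], intro V.span_sum V.span_scale V.span_base)
       (use that in \<open>auto simp: reduced_forms_def reduced_monoms_def forms_iff\<close>)
  have monom_reduced: "?s m \<in> reduced_forms d" if "m \<in> reduced_monoms d" for m
    using that by (auto simp: reduced_forms_def reduced_monoms_def intro: forms_single)
  obtain B where B: "B \<subseteq> ?I" "V.independent B" "?I \<subseteq> V.span B" "card B = V.dim ?I"
    by (rule V.basis_exists)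
  have "?F \<subseteq> V.span (?s ` ?N)"
  proof
    fix f assume "f \<in> ?F"
    then show "f \<in> V.span (?s ` ?N)"
      by (subst expand[of f], intro V.span_sum V.span_scale V.span_base) (auto simp: forms_iff)
  qed
  then have finB: "finite B"
    using V.independent_span_bound[OF finite_imageI[OF finite_monoms[of d]] B(2), of ?s] B(1)
    unfolding vanishing_forms_def by blast
  have finN: "finite (reduced_monoms d)"
    by (rule finite_subset[OF _ finite_monoms[of d]]) (auto simp: reduced_monoms_def)
  have inj: "inj ?s" by (rule injI) (metis lookup_single_eq lookup_single_not_eq zero_neq_one)
  have ind: "V.independent (?s ` K \<union> B) \<and> card (?s ` K \<union> B) = card K + card B"
    if "finite K" "K \<subseteq> reduced_monoms d" for K
    using that
  proof (induction K rule: finite_induct)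
    case empty
    then show ?case using B by simp
  next
    case (insert m K)
    \<comment> \<open>If the new monomial were x + y with x in the span of the earlier monomials and
      y vanishing on the curve, y would be reduced as well, hence 0. But the coefficient at
      \<open>m\<close> is 0 on that span.\<close>
    have notin: "?s m \<notin> V.span (?s ` K \<union> B)"
    proof
      assume "?s m \<in> V.span (?s ` K \<union> B)"
      then obtain x y where xy: "?s m = x + y" "x \<in> V.span (?s ` K)" "y \<in> V.span B"
        unfolding V.span_Un by blast
      have "V.span B \<subseteq> ?I" by (rule V.span_minimal[OF B(1) span_I])
      then have y: "y \<in> ?I" using xy by blast
      have "V.span (?s ` K) \<subseteq> reduced_forms d"
        by (rule V.span_minimal[OF _ span_R]) (use insert.prems monom_reduced in auto)
      then have "?s m - x \<in> reduced_forms d"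
        using xy(2) insert.prems by (intro V.subspace_diff[OF span_R] monom_reduced) auto
      then have "y \<in> reduced_forms d" unfolding xy(1) by simp
      moreover have "mp_eval y (curve_point z) = 0" for z
        using y curve_point_in[of z] by (auto simp: vanishing_forms_def affine_part_def)
      ultimately have "y = 0" using reduced_form_vanishing by blast
      then have "?s m \<in> V.span (?s ` K)" using xy by simp
      moreover have "V.span (?s ` K) \<subseteq> {f. Poly_Mapping.lookup f m = 0}"
      proof (rule V.span_minimal)
        show "?s ` K \<subseteq> {f. Poly_Mapping.lookup f m = 0}" using insert.hyps(2) by (auto simp: lookup_single when_def)
        show "V.subspace {f. Poly_Mapping.lookup f m = 0}"
        proof (rule V.subspaceI)
          fix c f assume f: "f \<in> {f :: 'k mpoly. Poly_Mapping.lookup f m = 0}"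
          then have "m \<notin> Poly_Mapping.keys (Poly_Mapping.single 0 c * f)"
            using keys_mult[of "Poly_Mapping.single 0 c" f] by (cases "c = 0") (auto simp: in_keys_iff)
          then show "Poly_Mapping.single 0 c * f \<in> {f. Poly_Mapping.lookup f m = 0}" by (simp add: in_keys_iff)
        qed (auto simp: lookup_add)
      qed
      ultimately show False by auto
    qed
    then have new: "?s m \<notin> ?s ` K \<union> B" using V.span_superset by (meson subsetD)
    have IH: "V.independent (?s ` K \<union> B)" "card (?s ` K \<union> B) = card K + card B"
      using insert.IH insert.prems by simp_all
    have "?s ` insert m K \<union> B = insert (?s m) (?s ` K \<union> B)" by simp
    moreover have "finite (?s ` K \<union> B)" using insert.hyps finB by simp
    ultimately show ?case
      using V.independent_insertI[OF notin IH(1)] IH(2) new insert.hyps by (simp only: card_insert_disjoint) simp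
  qed
  have "V.dim ?F = card (?s ` reduced_monoms d \<union> B)"
  proof (rule V.dim_unique[OF _ _ _ refl])
    show "?s ` reduced_monoms d \<union> B \<subseteq> ?F"
      using B(1) monom_reduced by (auto simp: vanishing_forms_def reduced_forms_def)
    show "?F \<subseteq> V.span (?s ` reduced_monoms d \<union> B)"
    proof
      fix f assume f: "f \<in> ?F"
      obtain g h where gh: "g \<in> reduced_forms d" "h \<in> quadric_ideal" "f = g + h" using reduce_form[OF f] by blast
      have "h = f - g" using gh by simp
      moreover have "g \<in> forms 4 d" using gh(1) by (simp add: reduced_forms_def)
      ultimately have "h \<in> forms 4 d" using forms_diff f by blast
      then have "h \<in> ?I" using gh(2) vanishing_forms_proj_curve[of d] by blast
      then have "h \<in> V.span B" using B by blast
      then show "f \<in> V.span (?s ` reduced_monoms d \<union> B)"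
        unfolding gh(3) V.span_Un using reduced_span[OF gh(1)] by blast
    qed
  qed (use ind[OF finN order.refl] in simp)
  then show ?thesis unfolding hilbert_function_def using ind[OF finN order.refl] B(4) by simp
qed

lemma genus_proj_curve: "genus 4 proj_curve = 5"
proof -
  have *: "of_int (hilbert_function 4 proj_curve d) = poly [:-4, 8:] (of_nat d :: rat)" if "d \<ge> 3" for d
  proof -
    have "of_nat (card (reduced_monoms d) + 4) = (of_nat (8 * d) :: rat)"
      using card_reduced_monoms[OF that] by simp
    then show ?thesis by (simp add: hilbert_function_proj_curve algebra_simps)
  qed
  have "hilbert_polynomial 4 proj_curve = [:-4, 8:]"
    unfolding hilbert_polynomial_def
  proof (rule the_equality)
    show "\<exists>d0. \<forall>d\<ge>d0. of_int (hilbert_function 4 proj_curve d) = poly [:-4, 8:] (of_nat d :: rat)"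
      using * by blast
    fix P :: "rat poly" assume "\<exists>d0. \<forall>d\<ge>d0. of_int (hilbert_function 4 proj_curve d) = poly P (of_nat d)"
    then obtain d0 where "\<forall>d\<ge>d0. of_int (hilbert_function 4 proj_curve d) = poly P (of_nat d)" by blast
    then show "P = [:-4, 8:]" by (intro poly_eqI_eventually[of "max d0 3"]) (metis * max.bounded_iff)
  qed
  then show ?thesis by (simp add: genus_def)
qed

end

section \<open>The quadratic character of a prime field\<close>

text \<open>The Legendre symbol on field elements instead of integers, so that sums can be reindexed
  by translation, reflection and inversion.\<close>

definition quad_char :: "'a::field \<Rightarrow> int" where
  "quad_char x = (if x = 0 then 0 else if \<exists>y. x = y ^ 2 then 1 else -1)"

lemma quad_char_0 [simp]: "quad_char 0 = 0"
  by (simp add: quad_char_def)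

lemma quad_char_1 [simp]: "quad_char 1 = 1"
  by (auto simp: quad_char_def intro: exI[of _ 1])

lemma quad_char_values: "x \<noteq> 0 \<Longrightarrow> quad_char x = 1 \<or> quad_char x = - 1"
  by (simp add: quad_char_def)

lemma of_int_mod_ring_eq_iff:
  "(of_int a :: 'p::prime_card mod_ring) = of_int b \<longleftrightarrow> [a = b] (mod int CARD('p))"
  by (simp add: of_int_eq_iff_cong_CHAR)

lemma surj_of_int_mod_ring: "\<exists>a. (x :: 'p::prime_card mod_ring) = of_int a"
  using surj_of_nat_mod_ring[of x] by (metis of_int_of_nat_eq)

lemma quad_char_of_int: "quad_char (of_int a :: 'p::prime_card mod_ring) = Legendre a (int CARD('p))"
proof -
  have "(of_int a :: 'p mod_ring) = 0 \<longleftrightarrow> [a = 0] (mod int CARD('p))"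
    using of_int_mod_ring_eq_iff[of a 0, where 'p = 'p] by simp
  moreover have "(\<exists>y. (of_int a :: 'p mod_ring) = y ^ 2) \<longleftrightarrow> QuadRes (int CARD('p)) a"
  proof
    assume "\<exists>y. (of_int a :: 'p mod_ring) = y ^ 2"
    then obtain b where "(of_int a :: 'p mod_ring) = of_int (b ^ 2)"
      using surj_of_int_mod_ring by (metis of_int_power)
    then show "QuadRes (int CARD('p)) a"
      unfolding QuadRes_def of_int_mod_ring_eq_iff using cong_sym by blast
  next
    assume "QuadRes (int CARD('p)) a"
    then obtain b where "[b ^ 2 = a] (mod int CARD('p))" by (auto simp: QuadRes_def)
    then have "(of_int a :: 'p mod_ring) = of_int b ^ 2"
      using of_int_mod_ring_eq_iff[of a "b ^ 2", where 'p = 'p] cong_sym by simp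
    then show "\<exists>y. (of_int a :: 'p mod_ring) = y ^ 2" ..
  qed
  ultimately show ?thesis by (simp add: quad_char_def Legendre_def)
qed

text \<open>Euler's criterion makes both sides congruent modulo p, and two numbers among -1, 0, 1
  differ by at most 2 < p.\<close>

lemma Legendre_mult:
  assumes "Factorial_Ring.prime p" "2 < p"
  shows "Legendre (a * b) (int p) = Legendre a (int p) * Legendre b (int p)"
proof -
  let ?L = "\<lambda>a. Legendre a (int p)"
  have "[?L (a * b) = (a * b) ^ ((p - 1) div 2)] (mod int p)" using assms by (rule euler_criterion)
  also have "(a * b) ^ ((p - 1) div 2) = a ^ ((p - 1) div 2) * b ^ ((p - 1) div 2)" by (rule power_mult_distrib)
  also have "[a ^ ((p - 1) div 2) * b ^ ((p - 1) div 2) = ?L a * ?L b] (mod int p)"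
    using assms by (intro cong_mult cong_sym[OF euler_criterion])
  finally have "int p dvd ?L (a * b) - ?L a * ?L b" by (simp add: cong_iff_dvd_diff)
  moreover have "\<bar>?L (a * b) - ?L a * ?L b\<bar> < int p"
    using assms(2) by (auto simp: Legendre_def)
  ultimately show ?thesis using dvd_imp_le_int[of "?L (a * b) - ?L a * ?L b" "int p"] by fastforce
qed

lemma quad_char_mult:
  assumes "CARD('p::prime_card) > 2"
  shows "quad_char (x * y :: 'p mod_ring) = quad_char x * quad_char y"
proof -
  obtain a b where "x = of_int a" "y = of_int b" using surj_of_int_mod_ring by metis
  then show ?thesis
    using Legendre_mult[OF prime_card assms] quad_char_of_int[where 'p = 'p]
    by (metis of_int_mult)
qed

lemma Legendre_minus_one:
  assumes "Factorial_Ring.prime p" "2 < p"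
  shows "Legendre (- 1) (int p) = (- 1) ^ ((p - 1) div 2)"
proof -
  have "int p dvd Legendre (- 1) (int p) - (- 1) ^ ((p - 1) div 2)"
    using euler_criterion[OF assms, of "- 1"] by (simp add: cong_iff_dvd_diff)
  moreover have "\<bar>Legendre (- 1) (int p) - (- 1) ^ ((p - 1) div 2)\<bar> < int p"
    using assms(2) neg_one_even_power neg_one_odd_power by (cases "even ((p - 1) div 2)") (auto simp: Legendre_def)
  ultimately show ?thesis
    using dvd_imp_le_int[of "Legendre (- 1) (int p) - (- 1) ^ ((p - 1) div 2)" "int p"] by fastforce
qed

text \<open>Gauss's lemma: the doubles 2, 4, ..., p - 1 need no reduction modulo p. With h = (p - 1)
  / 2, those above h come from h / 2 < x \<le> h, which are h - h div 2 in number.\<close>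

lemma Legendre_two:
  assumes "Factorial_Ring.prime p" "2 < p"
  shows "Legendre 2 (int p) = (- 1) ^ ((p - 1) div 2 - (p - 1) div 2 div 2)"
proof -
  interpret GAUSS p 2
  proof
    show "[2 \<noteq> 0] (mod int p)"
      using assms(2) zdvd_imp_le[of "int p" 2] by (auto simp: cong_0_iff)
  qed (use assms in auto)
  obtain h where p: "p = 2 * h + 1" using odd_p by (elim oddE)
  have A: "A = {0<..int h}" unfolding A_def by (simp add: p)
  have "E = (\<lambda>x. x * 2) ` {int h div 2<..int h}"
  proof -
    have "C = (\<lambda>x. x * 2) ` {0<..int h}"
      unfolding C_def B_def A image_image by (intro image_cong) (auto simp: p)
    then show ?thesis unfolding E_def by (auto simp: p)
  qed
  then have "card E = h - h div 2"
    by (simp add: card_image inj_on_def nat_diff_distrib flip: zdiv_int)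
  then show ?thesis using gauss_lemma p by simp
qed

lemma Legendre_three:
  assumes "Factorial_Ring.prime p" "3 < p"
  shows "Legendre 3 (int p) = (- 1) ^ ((p - 1) div 2) * (if p mod 3 = 1 then 1 else - 1)"
proof -
  have "Legendre (int p) (int 3) * Legendre (int 3) (int p) = (- 1) ^ ((p - 1) div 2 * ((3 - 1) div 2))"
    using assms by (intro Quadratic_Reciprocity) auto
  moreover have "Legendre (int p) 3 = (if p mod 3 = 1 then 1 else - 1)"
  proof -
    have "\<not> 3 dvd p" using assms primes_dvd_imp_eq[of 3 p] by auto
    then have "p mod 3 = 1 \<or> p mod 3 = 2" by (auto simp: dvd_eq_mod_eq_0)
    moreover have "QuadRes 3 (int p)" if "p mod 3 = 1"
      unfolding QuadRes_def by (rule exI[of _ 1]) (use that in \<open>auto simp: cong_def zmod_int[symmetric, of p 3, simplified]\<close>)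
    moreover have "\<not> QuadRes 3 (int p)" if p2: "p mod 3 = 2"
    proof
      assume "QuadRes 3 (int p)"
      then obtain y where "y ^ 2 mod 3 = int p mod 3" by (auto simp: QuadRes_def cong_def)
      moreover have "int p mod 3 = 2" using p2 zmod_int[of p 3] by simp
      moreover have "y ^ 2 mod 3 = (y mod 3) ^ 2 mod 3" by (simp add: power_mod)
      moreover have "y mod 3 = 0 \<or> y mod 3 = 1 \<or> y mod 3 = 2" by presburger
      ultimately show False by auto
    qed
    moreover have "\<not> [int p = 0] (mod 3)"
      using \<open>\<not> 3 dvd p\<close> by (metis cong_0_iff int_dvd_int_iff of_nat_numeral)
    ultimately show ?thesis by (auto simp: Legendre_def)
  qed
  ultimately have "Legendre 3 (int p) * (if p mod 3 = 1 then 1 else - 1) = (- 1) ^ ((p - 1) div 2)"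
    by (simp add: mult.commute)
  then show ?thesis by (auto split: if_splits)
qed

section \<open>Sums of quadratic characters\<close>

lemma card_square_roots:
  assumes "(2::'a::{field,finite}) \<noteq> 0"
  shows "int (card {y::'a. y ^ 2 = t}) = 1 + quad_char t"
proof (cases "\<exists>y. t = y ^ 2")
  case True
  then obtain y where y: "t = y ^ 2" by blast
  have eq: "{x. x ^ 2 = t} = {y, - y}" by (auto simp: y power2_eq_iff)
  show ?thesis
  proof (cases "y = 0")
    case False
    then have "y \<noteq> - y" using assms by (metis add_eq_0_iff mult_2 mult_eq_0_iff)
    then show ?thesis unfolding eq using y False by (auto simp: quad_char_def)
  qed (simp add: eq y)
next
  case False
  then have "{y. y ^ 2 = t} = {}" by auto
  then show ?thesis using False by (auto simp: quad_char_def intro: exI[of _ 0])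
qed

text \<open>Fibring the field over the squaring map counts every element once, so the sum of 1 +
  \<chi>(t) is the size of the field.\<close>

lemma sum_quad_char:
  assumes "(2::'a::{field,finite}) \<noteq> 0"
  shows "(\<Sum>t\<in>(UNIV::'a set). quad_char t) = 0"
proof -
  have "(\<Sum>t\<in>(UNIV::'a set). 1 + quad_char t) = int (\<Sum>t\<in>(UNIV::'a set). card {y. y ^ 2 = t})"
    by (simp add: card_square_roots[OF assms])
  also have "(\<Sum>t\<in>(UNIV::'a set). card {y. y ^ 2 = t}) = card (\<Union>t\<in>(UNIV::'a set). {y::'a. y ^ 2 = t})"
    by (rule card_UN_disjoint[symmetric]) auto
  also have "(\<Union>t\<in>(UNIV::'a set). {y::'a. y ^ 2 = t}) = UNIV" by auto
  finally show ?thesis by (simp add: sum.distrib)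
qed

lemma sum_shift: "(\<Sum>t\<in>(UNIV::'a::{field,finite} set). f (t + a)) = (\<Sum>t\<in>UNIV. f t)"
  by (rule sum.reindex_bij_witness[of _ "\<lambda>t. t - a" "\<lambda>t. t + a"]) auto

lemma sum_reflect: "(\<Sum>t\<in>(UNIV::'a::{field,finite} set). f (a - t)) = (\<Sum>t\<in>UNIV. f t)"
  by (rule sum.reindex_bij_witness[of _ "\<lambda>t. a - t" "\<lambda>t. a - t"]) auto

text \<open>After a translation, \<chi>(s) \<chi>(s + c) = \<chi>(1 + c / s) for nonzero s. The
  argument 1 + c / s runs through everything except 1, so the sum is 0 - \<chi>(1).\<close>

lemma sum_quad_char_pair:
  fixes a b :: "'p::prime_card mod_ring"
  assumes p: "CARD('p) > 2" and "a \<noteq> b"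
  shows "(\<Sum>t\<in>UNIV. quad_char (t + a) * quad_char (t + b)) = - 1"
proof -
  define c where "c = b - a"
  have c: "c \<noteq> 0" using assms by (simp add: c_def)
  have two: "(2 :: 'p mod_ring) \<noteq> 0"
    using of_nat_0_mod_ring_dvd[of 2, where 'a = 'p] p by (auto dest!: dvd_imp_le)
  have "(\<Sum>t\<in>UNIV. quad_char (t + a) * quad_char (t + b)) = (\<Sum>s\<in>UNIV. quad_char s * quad_char (s + c))"
    using sum_shift[of "\<lambda>s. quad_char s * quad_char (s + c)" a] by (simp add: c_def algebra_simps)
  also have "\<dots> = (\<Sum>s\<in>UNIV - {0}. quad_char s * quad_char (s + c))"
    by (rule sum.mono_neutral_right) auto
  also have "\<dots> = (\<Sum>s\<in>UNIV - {0}. quad_char (1 + c / s))"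
  proof (rule sum.cong)
    fix s :: "'p mod_ring" assume "s \<in> UNIV - {0}"
    then have s: "s \<noteq> 0" by simp
    then have "s + c = s * (1 + c / s)" by (simp add: field_simps)
    then have "quad_char s * quad_char (s + c) = quad_char s * quad_char s * quad_char (1 + c / s)"
      by (simp only: quad_char_mult[OF p] mult.assoc)
    moreover have "quad_char s * quad_char s = 1" using quad_char_values[OF s] by auto
    ultimately show "quad_char s * quad_char (s + c) = quad_char (1 + c / s)" by simp
  qed simp
  also have "\<dots> = (\<Sum>r\<in>UNIV - {1 :: 'p mod_ring}. quad_char r)"
    by (rule sum.reindex_bij_witness[of _ "\<lambda>r. c / (r - 1)" "\<lambda>s. 1 + c / s"]) (use c in auto)
  also have "\<dots> = - 1"
    using sum_quad_char[OF two] by (simp add: sum_diff1)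
  finally show ?thesis .
qed

section \<open>Frobenius traces as character sums\<close>

lemma equiv_weighted: "equiv UNIV (weighted_equiv :: (('k::field \<times> 'k \<times> 'k) \<times> _) set)"
proof (rule equivI)
  show "refl (weighted_equiv :: (('k \<times> 'k \<times> 'k) \<times> _) set)"
    unfolding refl_on_def weighted_equiv_def by (auto intro!: exI[of _ 1])
  show "sym (weighted_equiv :: (('k \<times> 'k \<times> 'k) \<times> _) set)"
  proof (rule symI)
    fix u w :: "'k \<times> 'k \<times> 'k" assume *: "(u, w) \<in> weighted_equiv"
    obtain x y z where u: "u = (x, y, z)" by (cases u)
    obtain c where "c \<noteq> 0" "w = (c * x, c ^ 2 * y, c * z)" using * unfolding u weighted_equiv_def by auto
    then show "(w, u) \<in> weighted_equiv"
      unfolding u weighted_equiv_def by (auto intro!: exI[of _ "inverse c"] simp: power_inverse)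
  qed
  show "trans (weighted_equiv :: (('k \<times> 'k \<times> 'k) \<times> _) set)"
  proof (rule transI)
    fix u v w :: "'k \<times> 'k \<times> 'k" assume *: "(u, v) \<in> weighted_equiv" "(v, w) \<in> weighted_equiv"
    obtain x y z where u: "u = (x, y, z)" by (cases u)
    obtain c where c: "c \<noteq> 0" "v = (c * x, c ^ 2 * y, c * z)" using *(1) unfolding u weighted_equiv_def by auto
    obtain d where d: "d \<noteq> 0" "w = (d * (c * x), d ^ 2 * (c ^ 2 * y), d * (c * z))"
      using *(2) unfolding c weighted_equiv_def by auto
    show "(u, w) \<in> weighted_equiv"
      unfolding u d weighted_equiv_def using c d by (auto intro!: exI[of _ "d * c"] simp: power_mult_distrib)
  qed
qed auto

lemma binary_form_affine:
  fixes f :: "'k::field poly"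
  assumes "Polynomial.degree f \<le> 4"
  shows "(\<Sum>i\<le>4. poly.coeff f i * x ^ i * 1 ^ (4 - i)) = poly f x"
proof -
  have "poly f x = (\<Sum>i\<le>4. poly.coeff f i * x ^ i)"
    unfolding poly_altdef using assms by (intro sum.mono_neutral_left) (auto simp: coeff_eq_0)
  then show ?thesis by simp
qed

text \<open>Scaling by 1 / z, or by 1 / x if z = 0, brings each point into the form (x, y, 1) or (1,
  y, 0), and these normal forms are pairwise inequivalent. The latter are the points at
  infinity.\<close>

lemma card_model_points:
  fixes f :: "'k::{field,finite} poly"
  assumes f: "Polynomial.degree f \<le> 4"
  shows "card (model_points f) = (\<Sum>x\<in>UNIV. card {y. y ^ 2 = poly f x}) + card {y. y ^ 2 = poly.coeff f 4}"
proof -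
  define F where "F = (\<lambda>x z. \<Sum>i\<le>4. poly.coeff f i * x ^ i * z ^ (4 - i))"
  have F1: "F x 1 = poly f x" for x using binary_form_affine[OF f] by (simp add: F_def)
  have Fc: "F (c * x) (c * z) = c ^ 4 * F x z" for c x z
  proof -
    have "poly.coeff f i * (c * x) ^ i * (c * z) ^ (4 - i) = c ^ 4 * (poly.coeff f i * x ^ i * z ^ (4 - i))"
      if "i \<le> 4" for i
    proof -
      have "c ^ 4 = c ^ i * c ^ (4 - i)" using that by (simp flip: power_add)
      then show ?thesis by (simp add: power_mult_distrib mult_ac)
    qed
    then show ?thesis unfolding F_def sum_distrib_left by (intro sum.cong) auto
  qed
  have F0: "F 1 0 = poly.coeff f 4"
  proof -
    have "F 1 0 = (\<Sum>i\<le>(4::nat). if i = 4 then poly.coeff f 4 else 0)"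
      unfolding F_def by (intro sum.cong) (auto simp: power_0_left)
    then show ?thesis by simp
  qed
  define P where "P = {(x, y, z). (x, z) \<noteq> (0, 0) \<and> y ^ 2 = F x z}"
  define U where "U = (\<lambda>(x, y). (x, y, 1 :: 'k)) ` (SIGMA x:UNIV. {y. y ^ 2 = poly f x})"
  define W where "W = (\<lambda>y. (1 :: 'k, y, 0 :: 'k)) ` {y. y ^ 2 = poly.coeff f 4}"
  have sub: "U \<union> W \<subseteq> P" by (auto simp: U_def W_def P_def F1 F0)
  have "inj_on (\<lambda>u. weighted_equiv `` {u}) (U \<union> W)"
  proof (rule inj_onI)
    fix u w assume uw: "u \<in> U \<union> W" "w \<in> U \<union> W" "weighted_equiv `` {u} = weighted_equiv `` {w}"
    then have "(u, w) \<in> weighted_equiv" using eq_equiv_class_iff[OF equiv_weighted] by blast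
    with uw(1,2) show "u = w" by (auto simp: weighted_equiv_def U_def W_def)
  qed
  then have "card (U \<union> W) = card ((\<lambda>u. weighted_equiv `` {u}) ` (U \<union> W))" by (rule card_image[symmetric])
  also have "(\<lambda>u. weighted_equiv `` {u}) ` (U \<union> W) = P // weighted_equiv"
  proof
    show "(\<lambda>u. weighted_equiv `` {u}) ` (U \<union> W) \<subseteq> P // weighted_equiv" using sub by (auto simp: quotient_def)
    show "P // weighted_equiv \<subseteq> (\<lambda>u. weighted_equiv `` {u}) ` (U \<union> W)"
    proof
      fix A assume "A \<in> P // weighted_equiv"
      then obtain x y z where A: "A = weighted_equiv `` {(x, y, z)}" and xyz: "(x, y, z) \<in> P"
        by (auto simp: quotient_def)
      define c where "c = (if z = 0 then inverse x else inverse z)"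
      have c: "c \<noteq> 0" using xyz by (auto simp: c_def P_def)
      have rel: "((x, y, z), (c * x, c ^ 2 * y, c * z)) \<in> weighted_equiv"
        using c by (auto simp: weighted_equiv_def)
      have eq: "(c ^ 2 * y) ^ 2 = F (c * x) (c * z)"
        using xyz by (simp add: Fc P_def power_mult_distrib flip: power_mult)
      have "(c * x, c ^ 2 * y, c * z) \<in> U \<union> W"
      proof (cases "z = 0")
        case True
        then have "c * x = 1" using xyz by (auto simp: c_def P_def)
        then show ?thesis using eq True F0 by (auto simp: W_def)
      next
        case False
        then have "c * z = 1" by (simp add: c_def)
        then show ?thesis using eq F1 by (auto simp: U_def image_iff)
      qed
      moreover have "A = weighted_equiv `` {(c * x, c ^ 2 * y, c * z)}"
        unfolding A by (rule equiv_class_eq[OF equiv_weighted rel])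
      ultimately show "A \<in> (\<lambda>u. weighted_equiv `` {u}) ` (U \<union> W)" by blast
    qed
  qed
  also have "P // weighted_equiv = model_points f" by (simp add: model_points_def P_def F_def)
  finally have "card (model_points f) = card (U \<union> W)" by simp
  also have "\<dots> = card U + card W"
    by (rule card_Un_disjoint) (auto simp: U_def W_def)
  also have "card U = (\<Sum>x\<in>UNIV. card {y. y ^ 2 = poly f x})"
    unfolding U_def by (subst card_image) (auto simp: inj_on_def)
  also have "card W = card {y. y ^ 2 = poly.coeff f 4}"
    unfolding W_def by (rule card_image) (simp add: inj_on_def)
  finally show ?thesis .
qed

text \<open>The last term comes from the points at infinity. It is 0 for the two cubics and 1 for
  \<open>E4\<close>, which produces the \<open>a4 + 1\<close> in
  \<open>pattern_polynomial\<close>.\<close>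

lemma frobenius_trace_eq:
  fixes f :: "'p::prime_card mod_ring poly"
  assumes "(2 :: 'p mod_ring) \<noteq> 0" "Polynomial.degree f \<le> 4"
  shows "frobenius_trace f = - (\<Sum>x\<in>UNIV. quad_char (poly f x)) - quad_char (poly.coeff f 4)"
  unfolding frobenius_trace_def card_model_points[OF assms(2)]
  by (simp add: card_square_roots[OF assms(1)] sum.distrib)

section \<open>Counting patterns\<close>

definition letter_sign :: "letter \<Rightarrow> int" where
  "letter_sign s = (if s = R then 1 else - 1)"

lemma mod_ring_small_nonzero:
  assumes "CARD('p::prime_card) > n" "n > 0"
  shows "(of_nat n :: 'p mod_ring) \<noteq> 0"
  using of_nat_0_mod_ring_dvd[of n, where 'a = 'p] assms by (auto dest!: dvd_imp_le)

lemma card_nonzero_roots: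
  fixes a u :: "'p::prime_card mod_ring"
  assumes p: "CARD('p) > 2" and a: "a \<noteq> 0"
  shows "int (card {x. x \<noteq> 0 \<and> a * x ^ 2 = u}) = (if u = 0 then 0 else 1 + quad_char a * quad_char u)"
proof (cases "u = 0")
  case True
  then have "{x. x \<noteq> 0 \<and> a * x ^ 2 = u} = {}" using a by auto
  then show ?thesis using True by simp
next
  case False
  have two: "(2 :: 'p mod_ring) \<noteq> 0" using mod_ring_small_nonzero[OF p] by simp
  have "{x. x \<noteq> 0 \<and> a * x ^ 2 = u} = {x. x ^ 2 = u / a}" using a False by (auto simp: field_simps)
  moreover have "quad_char u = quad_char a * quad_char (u / a)" using a by (simp flip: quad_char_mult[OF p])
  moreover have "quad_char a * quad_char a = 1" using quad_char_values[OF a] by auto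
  ultimately show ?thesis using False card_square_roots[OF two, of "u / a"] by (simp flip: mult.assoc)
qed

lemma affine_space_4_iff: "x \<in> affine_space 4 \<longleftrightarrow> (\<forall>i. i \<notin> {1, 2, 3, 4} \<longrightarrow> x i = 0)"
proof -
  have "{1..4::nat} = {1, 2, 3, 4}" by auto
  then show ?thesis by (simp add: affine_space_def)
qed

text \<open>The consecutive equations telescope, tying every coordinate to the first one
  alone.\<close>

lemma word_curve_4_iff:
  assumes "length S = 4"
  shows "x \<in> word_curve (ep :: 'a::field) em S \<longleftrightarrow> x \<in> affine_space 4 \<and>
    (\<forall>i\<in>{2,3,4}. word_coeff ep em S i * x i ^ 2 = word_coeff ep em S 1 * x 1 ^ 2 + of_nat (i - 1))"
proof -
  define q where "q = (\<lambda>i. word_coeff ep em S i * x i ^ 2)"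
  have 123: "{1..<4::nat} = {1, 2, 3}" by auto
  have "(q 2 - q 1 = 1 \<and> q 3 - q 2 = 1 \<and> q 4 - q 3 = 1) \<longleftrightarrow> (q 2 = q 1 + 1 \<and> q 3 = q 1 + 2 \<and> q 4 = q 1 + 3)"
    by (auto simp: algebra_simps)
  moreover have "(of_nat (2 - 1) :: 'a) = 1" "(of_nat (3 - 1) :: 'a) = 2" "(of_nat (4 - 1) :: 'a) = 3" by simp_all
  moreover have "1 + 1 = (2::nat)" "2 + 1 = (3::nat)" "3 + 1 = (4::nat)" by simp_all
  ultimately show ?thesis
    unfolding word_curve_def assms 123 mem_Collect_eq q_def ball_simps by (simp only:) blast
qed

text \<open>Once t is fixed, the four coordinates are independent of each other, so the fibre is a
  product of four solution sets. The character of each coefficient is the sign of its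
  letter.\<close>

lemma card_word_curve_nonzero:
  fixes ep em :: "'p::prime_card mod_ring"
  assumes p: "CARD('p) > 2" and ep: "ep \<noteq> 0" "\<exists>y. ep = y ^ 2" and em: "\<not> (\<exists>y. em = y ^ 2)"
    and S: "S = [s1, s2, s3, s4]"
  shows "int (card (word_curve_nonzero ep em S)) = (\<Sum>t\<in>(UNIV :: 'p mod_ring set).
    if t = 0 \<or> t + 1 = 0 \<or> t + 2 = 0 \<or> t + 3 = 0 then 0 else
      (1 + letter_sign s1 * quad_char t) * (1 + letter_sign s2 * quad_char (t + 1))
      * (1 + letter_sign s3 * quad_char (t + 2)) * (1 + letter_sign s4 * quad_char (t + 3)))"
proof -
  define c where "c = (\<lambda>s. if s = R then ep else em)"
  have "em \<noteq> 0" using em by (auto intro: exI[of _ 0])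
  then have c: "c s \<noteq> 0" "quad_char (c s) = letter_sign s" for s
    using ep em by (auto simp: c_def letter_sign_def quad_char_def)
  define Z where "Z = (\<lambda>s u. {x. x \<noteq> 0 \<and> c s * x ^ 2 = u})"
  have Z: "int (card (Z s u)) = (if u = 0 then 0 else 1 + letter_sign s * quad_char u)" for s u
    using card_nonzero_roots[OF p c(1)[of s], of u] by (simp add: Z_def c(2))
  let ?A = "SIGMA t:UNIV. Z s1 t \<times> Z s2 (t + 1) \<times> Z s3 (t + 2) \<times> Z s4 (t + 3)"
  have coeff: "word_coeff ep em S 1 = c s1" "word_coeff ep em S 2 = c s2"
    "word_coeff ep em S 3 = c s3" "word_coeff ep em S 4 = c s4"
    by (simp_all add: word_coeff_def S c_def)
  have mem: "x \<in> word_curve_nonzero ep em S \<longleftrightarrow> x \<in> affine_space 4 \<and>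
      x 1 \<in> Z s1 (c s1 * x 1 ^ 2) \<and> x 2 \<in> Z s2 (c s1 * x 1 ^ 2 + 1) \<and>
      x 3 \<in> Z s3 (c s1 * x 1 ^ 2 + 2) \<and> x 4 \<in> Z s4 (c s1 * x 1 ^ 2 + 3)" for x
  proof -
    have len: "length S = 4" and "{1..4::nat} = {1, 2, 3, 4}" by (auto simp: S)
    then show ?thesis unfolding word_curve_nonzero_def mem_Collect_eq word_curve_4_iff[OF len]
      by (auto simp: coeff Z_def simp del: One_nat_def)
  qed
  define F where "F = (\<lambda>x :: nat \<Rightarrow> 'p mod_ring. (c s1 * x 1 ^ 2, x 1, x 2, x 3, x 4))"
  have "bij_betw F (word_curve_nonzero ep em S) ?A"
  proof (rule bij_betwI')
    fix x y assume "x \<in> word_curve_nonzero ep em S" "y \<in> word_curve_nonzero ep em S"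
    then have 0: "x i = 0" "y i = 0" if "i \<notin> {1, 2, 3, 4}" for i
      using that mem unfolding affine_space_4_iff by blast+
    show "F x = F y \<longleftrightarrow> x = y"
    proof
      assume "F x = F y"
      then have "x i = y i" for i by (cases "i \<in> {1, 2, 3, 4}") (auto simp: F_def 0)
      then show "x = y" by auto
    qed simp
  next
    fix x assume "x \<in> word_curve_nonzero ep em S"
    then show "F x \<in> ?A" unfolding mem F_def by auto
  next
    fix q assume "q \<in> ?A"
    then obtain t a1 a2 a3 a4 where q: "q = (t, a1, a2, a3, a4)"
      "a1 \<in> Z s1 t" "a2 \<in> Z s2 (t + 1)" "a3 \<in> Z s3 (t + 2)" "a4 \<in> Z s4 (t + 3)" by auto
    define x where "x = (\<lambda>i::nat. if i = 1 then a1 else if i = 2 then a2 else if i = 3 then a3 else if i = 4 then a4 else 0)"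
    have x: "x 1 = a1" "x 2 = a2" "x 3 = a3" "x 4 = a4" by (simp_all add: x_def)
    have t: "c s1 * a1 ^ 2 = t" using q(2) by (simp add: Z_def)
    have "x \<in> affine_space 4" by (simp add: affine_space_4_iff x_def)
    then have "x \<in> word_curve_nonzero ep em S" unfolding mem x t using q by simp
    moreover have "q = F x" unfolding F_def x t q(1) ..
    ultimately show "\<exists>x\<in>word_curve_nonzero ep em S. q = F x" by blast
  qed
  then have "card (word_curve_nonzero ep em S) = card ?A" by (rule bij_betw_same_card)
  also have "\<dots> = (\<Sum>t\<in>UNIV. card (Z s1 t) * (card (Z s2 (t + 1)) * (card (Z s3 (t + 2)) * card (Z s4 (t + 3)))))"
    by (simp add: card_SigmaI card_cartesian_product)
  finally show ?thesis by (simp add: Z) (intro sum.cong, auto)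
qed

lemma letter_factor:
  "u \<noteq> 0 \<Longrightarrow> 1 + letter_sign s * quad_char u = (if (if quad_char u = 1 then R else N) = s then 2 else 0)"
  using quad_char_values[of u] by (cases s) (auto simp: letter_sign_def)

text \<open>In the field, 1 \<le> n \<le> p - 4 says that t avoids 0, -1, -2, -3. At the other t
  every factor is 2 or 0, so the product is 16 or 0.\<close>

lemma pattern_count_eq:
  assumes p: "p = CARD('p::prime_card)" "p > 4" and S: "S = [s1, s2, s3, s4]"
  shows "16 * int (pattern_count p S) = (\<Sum>t\<in>(UNIV :: 'p mod_ring set).
    if t = 0 \<or> t + 1 = 0 \<or> t + 2 = 0 \<or> t + 3 = 0 then 0 else
      (1 + letter_sign s1 * quad_char t) * (1 + letter_sign s2 * quad_char (t + 1))
      * (1 + letter_sign s3 * quad_char (t + 2)) * (1 + letter_sign s4 * quad_char (t + 3)))"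
proof -
  define w where "w = (\<lambda>u :: 'p mod_ring. if quad_char u = 1 then R else N)"
  define D where D_def': "D = {x. 1 \<le> x \<and> x + 4 \<le> p \<and> map (\<lambda>i. residue_letter p (x + i)) [0..<4] = S}"
  \<comment> \<open>Like \<open>residue_letter\<close>, \<open>w\<close> returns \<open>N\<close> at
    0 as well, so the four zeros are excluded explicitly.\<close>
  define T where "T = {t :: 'p mod_ring. \<not> (t = 0 \<or> t + 1 = 0 \<or> t + 2 = 0 \<or> t + 3 = 0) \<and>
    w t = s1 \<and> w (t + 1) = s2 \<and> w (t + 2) = s3 \<and> w (t + 3) = s4}"
  have res: "residue_letter p n = w (of_nat n)" for n
    using quad_char_of_int[of "int n", where 'p = 'p] by (simp add: residue_letter_def w_def p)
  have "[0..<4] = [0, 1, 2, 3]" by (simp add: upt_rec)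
  then have D: "D = {x. 1 \<le> x \<and> x + 4 \<le> p \<and> w (of_nat x) = s1 \<and> w (of_nat x + 1) = s2
      \<and> w (of_nat x + 2) = s3 \<and> w (of_nat x + 3) = s4}"
    by (auto simp: D_def' S res add.commute)
  have nz: "(of_nat n :: 'p mod_ring) \<noteq> 0" if "0 < n" "n < p" for n
    using mod_ring_small_nonzero[of n, where 'p = 'p] that p by simp
  have "bij_betw (of_nat :: nat \<Rightarrow> 'p mod_ring) D T"
  proof (rule bij_betwI')
    fix x y assume "x \<in> D" "y \<in> D"
    then have "x < CARD('p)" "y < CARD('p)" by (auto simp: D p)
    then show "(of_nat x :: 'p mod_ring) = of_nat y \<longleftrightarrow> x = y"
      by (auto simp: of_nat_eq_iff_cong_CHAR cong_def)
  next
    fix x assume x: "x \<in> D"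
    then have "(of_nat x :: 'p mod_ring) + of_nat i \<noteq> 0" if "i < 4" for i
      using that nz[of "x + i"] by (auto simp: D)
    from this[of 0] this[of 1] this[of 2] this[of 3] show "of_nat x \<in> T"
      using x by (auto simp: T_def D)
  next
    fix t assume t: "t \<in> T"
    obtain n where n: "n < p" "t = of_nat n" using surj_of_nat_mod_ring[of t] p by auto
    have "n \<noteq> 0"
    proof
      assume "n = 0"
      with t n(2) show False by (simp add: T_def)
    qed
    moreover have "n + i \<noteq> p" if "i < 4" for i
    proof
      assume "n + i = p"
      then have "t + of_nat i = 0" using of_nat_card_eq_0[where 'a = 'p] unfolding n p by (metis of_nat_add)
      moreover have "i = 0 \<or> i = 1 \<or> i = 2 \<or> i = 3" using that by auto
      ultimately show False using t by (auto simp: T_def)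
    qed
    from this[of 1] this[of 2] this[of 3] have "n + 4 \<le> p" using n(1) by simp
    ultimately have "n \<in> D" using t unfolding D T_def n(2) by auto
    then show "\<exists>x\<in>D. t = of_nat x" using n(2) by blast
  qed
  then have "card D = card T" by (rule bij_betw_same_card)
  moreover have "pattern_count p S = card D"
  proof -
    have "length S = 4" by (simp add: S)
    then show ?thesis unfolding pattern_count_def D_def' by simp
  qed
  ultimately have "16 * int (pattern_count p S) = (\<Sum>t\<in>UNIV. if t \<in> T then 16 else 0)"
    by (simp add: sum.If_cases)
  also have "\<dots> = (\<Sum>t\<in>(UNIV :: 'p mod_ring set). if t = 0 \<or> t + 1 = 0 \<or> t + 2 = 0 \<or> t + 3 = 0 then 0 else
      (1 + letter_sign s1 * quad_char t) * (1 + letter_sign s2 * quad_char (t + 1))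
      * (1 + letter_sign s3 * quad_char (t + 2)) * (1 + letter_sign s4 * quad_char (t + 3)))"
    by (intro sum.cong) (auto simp: T_def letter_factor w_def)
  finally show ?thesis .
qed

text \<open>The product of the factors \<open>1 + \<sigma>\<^sub>i \<chi>(t + i - 1)\<close> summed over all \<open>t\<close>, from which
  the last two lines remove the contributions of \<open>t = 0, -1, -2, -3\<close>. Here \<open>u\<close>, \<open>v\<close>, \<open>w\<close> stand
  for \<open>\<chi>(-1)\<close>, \<open>\<chi>(2)\<close>, \<open>\<chi>(3)\<close>.\<close>

definition pattern_polynomial :: "int \<Rightarrow> int \<Rightarrow> int \<Rightarrow> int \<Rightarrow> int \<Rightarrow> int \<Rightarrow> int \<Rightarrow> int \<Rightarrow> int \<Rightarrow> int \<Rightarrow> int \<Rightarrow> int" where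
  "pattern_polynomial p a0 a1 a4 u v w \<sigma>1 \<sigma>2 \<sigma>3 \<sigma>4 =
    p - (\<sigma>1 * \<sigma>2 + \<sigma>1 * \<sigma>3 + \<sigma>1 * \<sigma>4 + \<sigma>2 * \<sigma>3 + \<sigma>2 * \<sigma>4 + \<sigma>3 * \<sigma>4)
      - a0 * (\<sigma>1 * \<sigma>2 * \<sigma>3 + \<sigma>2 * \<sigma>3 * \<sigma>4) - a1 * (\<sigma>1 * \<sigma>2 * \<sigma>4 + u * \<sigma>1 * \<sigma>3 * \<sigma>4) - (a4 + 1) * (\<sigma>1 * \<sigma>2 * \<sigma>3 * \<sigma>4)
      - (1 + \<sigma>2) * (1 + \<sigma>3 * v) * (1 + \<sigma>4 * w) - (1 + \<sigma>1 * u) * (1 + \<sigma>3) * (1 + \<sigma>4 * v)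
      - (1 + \<sigma>1 * (u * v)) * (1 + \<sigma>2 * u) * (1 + \<sigma>4) - (1 + \<sigma>1 * (u * w)) * (1 + \<sigma>2 * (u * v)) * (1 + \<sigma>3 * u)"

text \<open>Sums of one character vanish and the six pair sums are -1; only triple and quadruple
  products involve the curves. The relation \<open>u * a0 = a0\<close> forces \<open>a0 = 0\<close>
  when \<open>u = - 1\<close>, which is why \<open>a0\<close> is absent from the table column for p
  \<equiv> 3 modulo 4.\<close>

lemma character_sum:
  fixes \<sigma>1 \<sigma>2 \<sigma>3 \<sigma>4 :: int and a0 a1 a4 :: int
  assumes p: "p = CARD('p::prime_card)" "p > 4"
    and a0: "a0 = frobenius_trace (E0 :: 'p mod_ring poly)"
    and a1: "a1 = frobenius_trace (E1 :: 'p mod_ring poly)"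
    and a4: "a4 = frobenius_trace (E4 :: 'p mod_ring poly)"
    and u: "u = quad_char (- 1 :: 'p mod_ring)" and v: "v = quad_char (2 :: 'p mod_ring)"
    and w: "w = quad_char (3 :: 'p mod_ring)"
  shows "(\<Sum>t\<in>(UNIV :: 'p mod_ring set). if t = 0 \<or> t + 1 = 0 \<or> t + 2 = 0 \<or> t + 3 = 0 then 0 else
      (1 + \<sigma>1 * quad_char t) * (1 + \<sigma>2 * quad_char (t + 1)) * (1 + \<sigma>3 * quad_char (t + 2)) * (1 + \<sigma>4 * quad_char (t + 3)))
    = pattern_polynomial (int p) a0 a1 a4 u v w \<sigma>1 \<sigma>2 \<sigma>3 \<sigma>4"
    and "u * a0 = a0"
proof -
  let ?K = "UNIV :: 'p mod_ring set"
  have p2: "CARD('p) > 2" using p by simp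
  note mult = quad_char_mult[OF p2]
  have nz: "(of_nat n :: 'p mod_ring) \<noteq> 0" if "0 < n" "n < 5" for n
    using mod_ring_small_nonzero[of n, where 'p = 'p] that p by simp
  have nz1: "(1 :: 'p mod_ring) \<noteq> 0" "(2 :: 'p mod_ring) \<noteq> 0" "(3 :: 'p mod_ring) \<noteq> 0"
    using nz[of 2] nz[of 3] by simp_all
  have dist: "1 \<noteq> (2 :: 'p mod_ring)" "1 \<noteq> (3 :: 'p mod_ring)" "2 \<noteq> (3 :: 'p mod_ring)"
  proof -
    have "(2 :: 'p mod_ring) = 1 + 1" "(3 :: 'p mod_ring) = 1 + 2" "(3 :: 'p mod_ring) = 2 + 1" by simp_all
    then show "1 \<noteq> (2 :: 'p mod_ring)" "1 \<noteq> (3 :: 'p mod_ring)" "2 \<noteq> (3 :: 'p mod_ring)"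
      using nz1 by (metis add_cancel_right_right)+
  qed
  define c0 c1 c2 c3 :: "'p mod_ring \<Rightarrow> int" where "c0 = (\<lambda>t. quad_char t)" and "c1 = (\<lambda>t. quad_char (t + 1))"
    and "c2 = (\<lambda>t. quad_char (t + 2))" and "c3 = (\<lambda>t. quad_char (t + 3))"
  note c = c0_def c1_def c2_def c3_def
  define F where "F = (\<lambda>t. (1 + \<sigma>1 * c0 t) * (1 + \<sigma>2 * c1 t) * (1 + \<sigma>3 * c2 t) * (1 + \<sigma>4 * c3 t))"
  have S1: "(\<Sum>t\<in>?K. c0 t) = 0" "(\<Sum>t\<in>?K. c1 t) = 0" "(\<Sum>t\<in>?K. c2 t) = 0" "(\<Sum>t\<in>?K. c3 t) = 0"
    unfolding c sum_shift[of quad_char] by (rule sum_quad_char[OF nz1(2)])+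
  have S2: "(\<Sum>t\<in>?K. c0 t * c1 t) = - 1" "(\<Sum>t\<in>?K. c0 t * c2 t) = - 1" "(\<Sum>t\<in>?K. c0 t * c3 t) = - 1"
    "(\<Sum>t\<in>?K. c1 t * c2 t) = - 1" "(\<Sum>t\<in>?K. c1 t * c3 t) = - 1" "(\<Sum>t\<in>?K. c2 t * c3 t) = - 1"
    unfolding c using sum_quad_char_pair[OF p2, of 0 1] sum_quad_char_pair[OF p2, of 0 2] sum_quad_char_pair[OF p2, of 0 3]
      sum_quad_char_pair[OF p2, of 1 2] sum_quad_char_pair[OF p2, of 1 3] sum_quad_char_pair[OF p2, of 2 3] nz1 dist
    by simp_all
  have deg: "Polynomial.degree (E0 :: 'p mod_ring poly) \<le> 4" "Polynomial.degree (E1 :: 'p mod_ring poly) \<le> 4"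
    "Polynomial.degree (E4 :: 'p mod_ring poly) \<le> 4"
    unfolding E0_def E1_def E4_def by (simp_all add: degree_mult_eq)
  have coeff: "poly.coeff (E0 :: 'p mod_ring poly) 4 = 0" "poly.coeff (E1 :: 'p mod_ring poly) 4 = 0"
    "poly.coeff (E4 :: 'p mod_ring poly) 4 = 1"
    unfolding E0_def E1_def E4_def by (simp_all add: eval_nat_numeral)
  have P0: "quad_char (poly E0 t) = c0 t * c1 t * c2 t" and P1: "quad_char (poly E1 t) = c0 t * c1 t * c3 t"
    and P4: "quad_char (poly E4 t) = c0 t * c1 t * c2 t * c3 t" for t
    unfolding c mult[symmetric] E0_def E1_def E4_def poly_mult by (simp_all add: add.commute)
  have A0: "(\<Sum>t\<in>?K. c0 t * c1 t * c2 t) = - a0"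
    unfolding a0 frobenius_trace_eq[OF nz1(2) deg(1)] coeff
    by (simp add: P0)
  have A1: "(\<Sum>t\<in>?K. c0 t * c1 t * c3 t) = - a1"
    unfolding a1 frobenius_trace_eq[OF nz1(2) deg(2)] coeff
    by (simp add: P1)
  have A4: "(\<Sum>t\<in>?K. c0 t * c1 t * c2 t * c3 t) = - a4 - 1"
    unfolding a4 frobenius_trace_eq[OF nz1(2) deg(3)] coeff
    by (simp add: P4)
  have B0: "(\<Sum>t\<in>?K. c1 t * c2 t * c3 t) = - a0"
    using sum_shift[of "\<lambda>t. c0 t * c1 t * c2 t" 1] A0 by (simp add: c add.assoc)
  have neg: "quad_char (- x) = u * quad_char x" for x :: "'p mod_ring"
    using mult[of "- 1" x] by (simp add: u)
  have u2: "u * u = 1" using quad_char_values[of "- 1 :: 'p mod_ring"] by (auto simp: u)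
  have u3: "u * u * u = u" using u2 by simp
  \<comment> \<open>Under t \<mapsto> -3 - t the shifts 0, 1, 3 become 3, 2, 0 up to sign; each
    factor contributes \<open>u\<close>, and u^3 = u.\<close>
  have B1: "(\<Sum>t\<in>?K. c0 t * c2 t * c3 t) = - (u * a1)"
  proof -
    have "c0 (- 3 - t) * c1 (- 3 - t) * c3 (- 3 - t) = u * (c0 t * c2 t * c3 t)" for t
    proof -
      have "c0 (- 3 - t) = u * c3 t" "c1 (- 3 - t) = u * c2 t" "c3 (- 3 - t) = u * c0 t"
        unfolding c neg[symmetric] by (intro arg_cong[of _ _ quad_char]; simp)+
      then have "c0 (- 3 - t) * c1 (- 3 - t) * c3 (- 3 - t) = u * u * u * (c0 t * c2 t * c3 t)" by (simp only: mult_ac)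
      then show ?thesis by (simp only: u3)
    qed
    then have "- a1 = u * (\<Sum>t\<in>?K. c0 t * c2 t * c3 t)"
      using sum_reflect[of "\<lambda>t. c0 t * c1 t * c3 t" "- 3"] A1 by (simp add: sum_distrib_left)
    then have "u * - a1 = u * u * (\<Sum>t\<in>?K. c0 t * c2 t * c3 t)" by (simp only: mult.assoc)
    then show ?thesis by (simp add: u2)
  qed
  have "c0 (- 2 - t) * c1 (- 2 - t) * c2 (- 2 - t) = u * (c0 t * c1 t * c2 t)" for t
  proof -
    have "c0 (- 2 - t) = u * c2 t" "c1 (- 2 - t) = u * c1 t" "c2 (- 2 - t) = u * c0 t"
      unfolding c neg[symmetric] by (intro arg_cong[of _ _ quad_char]; simp)+
    then have "c0 (- 2 - t) * c1 (- 2 - t) * c2 (- 2 - t) = u * u * u * (c0 t * c1 t * c2 t)" by (simp only: mult_ac)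
    then show ?thesis by (simp only: u3)
  qed
  then have "- a0 = u * - a0"
    using sum_reflect[of "\<lambda>t. c0 t * c1 t * c2 t" "- 2"] A0 by (simp flip: sum_distrib_left)
  then show "u * a0 = a0" by simp
  have F: "F t = 1 + (\<sigma>1 * c0 t + \<sigma>2 * c1 t + \<sigma>3 * c2 t + \<sigma>4 * c3 t)
    + (\<sigma>1 * \<sigma>2 * (c0 t * c1 t) + \<sigma>1 * \<sigma>3 * (c0 t * c2 t) + \<sigma>1 * \<sigma>4 * (c0 t * c3 t)
       + \<sigma>2 * \<sigma>3 * (c1 t * c2 t) + \<sigma>2 * \<sigma>4 * (c1 t * c3 t) + \<sigma>3 * \<sigma>4 * (c2 t * c3 t))
    + (\<sigma>1 * \<sigma>2 * \<sigma>3 * (c0 t * c1 t * c2 t) + \<sigma>1 * \<sigma>2 * \<sigma>4 * (c0 t * c1 t * c3 t)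
       + \<sigma>1 * \<sigma>3 * \<sigma>4 * (c0 t * c2 t * c3 t) + \<sigma>2 * \<sigma>3 * \<sigma>4 * (c1 t * c2 t * c3 t))
    + \<sigma>1 * \<sigma>2 * \<sigma>3 * \<sigma>4 * (c0 t * c1 t * c2 t * c3 t)" for t
    unfolding F_def by (simp add: algebra_simps)
  have "(\<Sum>t\<in>?K. F t) = int p - (\<sigma>1 * \<sigma>2 + \<sigma>1 * \<sigma>3 + \<sigma>1 * \<sigma>4 + \<sigma>2 * \<sigma>3 + \<sigma>2 * \<sigma>4 + \<sigma>3 * \<sigma>4)
      - a0 * (\<sigma>1 * \<sigma>2 * \<sigma>3 + \<sigma>2 * \<sigma>3 * \<sigma>4) - a1 * (\<sigma>1 * \<sigma>2 * \<sigma>4 + u * \<sigma>1 * \<sigma>3 * \<sigma>4) - (a4 + 1) * (\<sigma>1 * \<sigma>2 * \<sigma>3 * \<sigma>4)"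
    unfolding F sum.distrib sum_distrib_left[symmetric] S1 S2 A0 A1 A4 B0 B1 by (simp add: p algebra_simps)
  moreover have "(\<Sum>t\<in>?K. if t = 0 \<or> t + 1 = 0 \<or> t + 2 = 0 \<or> t + 3 = 0 then 0 else F t)
    = (\<Sum>t\<in>?K. F t) - F 0 - F (- 1) - F (- 2) - F (- 3)"
  proof -
    let ?B = "{0, - 1, - 2, - 3} :: 'p mod_ring set"
    have "(\<Sum>t\<in>?K. if t = 0 \<or> t + 1 = 0 \<or> t + 2 = 0 \<or> t + 3 = 0 then 0 else F t) = (\<Sum>t\<in>?K. if t \<in> ?B then 0 else F t)"
      by (intro sum.cong) (auto simp: add_eq_0_iff2)
    also have "\<dots> = (\<Sum>t\<in>?K - ?B. F t)"
      by (rule sum.mono_neutral_cong_right) auto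
    also have "\<dots> = (\<Sum>t\<in>?K. F t) - (\<Sum>t\<in>?B. F t)" by (rule sum_diff) auto
    also have "(\<Sum>t\<in>?B. F t) = F 0 + F (- 1) + F (- 2) + F (- 3)"
    proof -
      have "- 1 \<noteq> (- 2 :: 'p mod_ring)" "- 1 \<noteq> (- 3 :: 'p mod_ring)" "- 2 \<noteq> (- 3 :: 'p mod_ring)"
        unfolding neg_equal_iff_equal by (rule dist)+
      then show ?thesis using nz1 by simp
    qed
    finally show ?thesis by simp
  qed
  \<comment> \<open>At each removed point one of the four characters is 0; the arguments of the
    other three are 1, 2 or 3 up to sign.\<close>
  moreover have "F 0 = (1 + \<sigma>2) * (1 + \<sigma>3 * v) * (1 + \<sigma>4 * w)"
    by (simp add: F_def c v w)
  moreover have "F (- 1) = (1 + \<sigma>1 * u) * (1 + \<sigma>3) * (1 + \<sigma>4 * v)"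
    by (simp add: F_def c u v)
  moreover have "F (- 2) = (1 + \<sigma>1 * (u * v)) * (1 + \<sigma>2 * u) * (1 + \<sigma>4)"
    using neg[of 2] by (simp add: F_def c u v)
  moreover have "F (- 3) = (1 + \<sigma>1 * (u * w)) * (1 + \<sigma>2 * (u * v)) * (1 + \<sigma>3 * u)"
    using neg[of 2] neg[of 3] by (simp add: F_def c u v w)
  ultimately show "(\<Sum>t\<in>?K. if t = 0 \<or> t + 1 = 0 \<or> t + 2 = 0 \<or> t + 3 = 0 then 0 else
      (1 + \<sigma>1 * quad_char t) * (1 + \<sigma>2 * quad_char (t + 1)) * (1 + \<sigma>3 * quad_char (t + 2)) * (1 + \<sigma>4 * quad_char (t + 3)))
    = pattern_polynomial (int p) a0 a1 a4 u v w \<sigma>1 \<sigma>2 \<sigma>3 \<sigma>4"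
    unfolding F_def c pattern_polynomial_def by linarith
qed

section \<open>Dependence on the residue class of p\<close>

lemma prime_mod_24:
  assumes "Factorial_Ring.prime p" "p > 4"
  shows "p mod 24 \<in> {1, 5, 7, 11, 13, 17, 19, 23::nat}"
proof -
  have "\<not> 2 dvd p" "\<not> 3 dvd p"
    using assms primes_dvd_imp_eq[of 2 p] primes_dvd_imp_eq[of 3 p] by auto
  then have "\<not> 2 dvd p mod 24" "\<not> 3 dvd p mod 24" by (simp_all add: dvd_mod_iff)
  moreover have "x = 1 \<or> x = 5 \<or> x = 7 \<or> x = 11 \<or> x = 13 \<or> x = 17 \<or> x = 19 \<or> x = 23"
    if "x < 24" "\<not> 2 dvd x" "\<not> 3 dvd x" for x :: nat
    using that by presburger
  ultimately show ?thesis using pos_mod_bound by simp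
qed

text \<open>The character of -1 depends on p modulo 4, that of 2 on p modulo 8, that of 3 on p
  modulo 12; this is the origin of the modulus 24.\<close>

lemma quad_char_small_values:
  assumes p: "p = CARD('p::prime_card)" "p > 4"
  shows "quad_char (- 1 :: 'p mod_ring) = (if p mod 24 \<in> {1, 5, 13, 17} then 1 else - 1)"
    and "quad_char (2 :: 'p mod_ring) = (if p mod 24 \<in> {1, 7, 17, 23} then 1 else - 1)"
    and "quad_char (3 :: 'p mod_ring) = (if p mod 24 \<in> {1, 11, 13, 23} then 1 else - 1)"
proof -
  have prime: "Factorial_Ring.prime p" using prime_card[where 'a = 'p] p by simp
  define k r where "k = p div 24" and "r = p mod 24"
  have kr: "p = 24 * k + r" by (simp add: k_def r_def)
  have r: "r \<in> {1, 5, 7, 11, 13, 17, 19, 23}" using prime_mod_24[OF prime p(2)] by (simp add: r_def)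
  \<comment> \<open>With p = 24 k + r, the exponents of -1 change by the even numbers 12 k and 6 k,
    so the signs depend on r only.\<close>
  have h: "(p - 1) div 2 = 12 * k + (r - 1) div 2" using r by (auto simp: kr)
  define s where "s = (r - 1) div 2 - (r - 1) div 2 div 2"
  have "(p - 1) div 2 - (p - 1) div 2 div 2 = 6 * k + s"
    unfolding h s_def using r by auto
  then have "Legendre 2 (int p) = (- 1) ^ (6 * k + s)" using Legendre_two[OF prime] p(2) by simp
  then have L2: "Legendre 2 (int p) = (- 1) ^ s" by (simp add: power_add power_mult)
  have m1: "(- 1 :: int) ^ ((p - 1) div 2) = (- 1) ^ ((r - 1) div 2)"
    unfolding h by (simp add: power_add power_mult)
  have p3: "p mod 3 = r mod 3" unfolding kr by presburger
  show "quad_char (- 1 :: 'p mod_ring) = (if p mod 24 \<in> {1, 5, 13, 17} then 1 else - 1)"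
    using Legendre_minus_one[OF prime] p(2) quad_char_of_int[of "- 1", where 'p = 'p] m1 r
    by (auto simp: p(1)[symmetric] r_def[symmetric])
  show "quad_char (2 :: 'p mod_ring) = (if p mod 24 \<in> {1, 7, 17, 23} then 1 else - 1)"
    using quad_char_of_int[of 2, where 'p = 'p] L2 r
    by (auto simp: s_def p(1)[symmetric] r_def[symmetric])
  show "quad_char (3 :: 'p mod_ring) = (if p mod 24 \<in> {1, 11, 13, 23} then 1 else - 1)"
    using quad_char_of_int[of 3, where 'p = 'p] Legendre_three[OF prime] p(2) m1 p3 r
    by (auto simp: p(1)[symmetric] r_def[symmetric])
qed

text \<open>Selecting the table entries before any arithmetic keeps the simplifier from normalizing all
  the discarded ones.\<close>

lemmas table_lookup = A_term_def A_table_def C_term_def C_table_def C_columns_def zip_Cons_Cons zip_Nil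
  map_of.simps list.inject letter.distinct simp_thms if_True if_False option.sel prod.case fst_conv snd_conv
  numeral_eq_iff one_eq_numeral_iff numeral_eq_one_iff semiring_norm

text \<open>A check of sixteen words in eight classes; a tuple stands for p mod 24, p mod 4 and the
  characters of -1, 2, 3. The bound is attained by \<open>RRRR\<close> in class 1: six pair sums,
  the 1 of \<open>a4 + 1\<close> and four removed points worth 8 each give 6 + 1 + 32 = 39.\<close>

lemma pattern_table:
  assumes "(m, q, u, v, w) \<in> {(1, 1, 1, 1, 1), (5, 1, 1, - 1, - 1), (7, 3, - 1, 1, - 1), (11, 3, - 1, - 1, 1),
      (13, 1, 1, - 1, 1), (17, 1, 1, 1, - 1), (19, 3, - 1, - 1, - 1), (23, 3, - 1, 1, 1)}"
    and "u * a0 = a0"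
    and "k = pattern_polynomial (int p) a0 a1 a4 u v w (letter_sign s1) (letter_sign s2) (letter_sign s3) (letter_sign s4)"
  shows "real_of_int k = real p - real_of_int (A_term a0 a1 a4 [s1, s2, s3, s4] q) + 16 * C_term [s1, s2, s3, s4] m
    \<and> \<bar>C_term [s1, s2, s3, s4] m\<bar> \<le> 39 / 16"
  using assms(1,2) unfolding assms(3) insert_iff empty_iff prod.inject
  by (elim disjE conjE FalseE; hypsubst; cases s1; cases s2; cases s3; cases s4; hypsubst;
      simp only: table_lookup; simp add: letter_sign_def pattern_polynomial_def)

lemma pattern_count_formula:
  fixes a0 a1 a4 :: int
  assumes p: "p = CARD('p::prime_card)" "p > 4" and S: "length S = 4"
    and a: "a0 = frobenius_trace (E0 :: 'p mod_ring poly)" "a1 = frobenius_trace (E1 :: 'p mod_ring poly)"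
      "a4 = frobenius_trace (E4 :: 'p mod_ring poly)"
  shows "real (pattern_count p S) = real p / 16 - real_of_int (A_term a0 a1 a4 S (p mod 4)) / 16 + C_term S (p mod 24)"
    and "\<bar>C_term S (p mod 24)\<bar> \<le> 39 / 16"
proof -
  obtain s1 s2 s3 s4 where S: "S = [s1, s2, s3, s4]" using S by (auto simp: eval_nat_numeral length_Suc_conv)
  define u v w where "u = quad_char (- 1 :: 'p mod_ring)" and "v = quad_char (2 :: 'p mod_ring)"
    and "w = quad_char (3 :: 'p mod_ring)"
  note sum = character_sum(1)[OF p a u_def v_def w_def,
    where ?\<sigma>1.0 = "letter_sign s1" and ?\<sigma>2.0 = "letter_sign s2" and ?\<sigma>3.0 = "letter_sign s3" and ?\<sigma>4.0 = "letter_sign s4"]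
  have count: "16 * int (pattern_count p S) = pattern_polynomial (int p) a0 a1 a4 u v w
      (letter_sign s1) (letter_sign s2) (letter_sign s3) (letter_sign s4)"
    unfolding pattern_count_eq[OF p S] by (rule sum)
  have "Factorial_Ring.prime p" using prime_card[where 'a = 'p] p by simp
  define m where "m = p mod 24"
  have r: "m \<in> {1, 5, 7, 11, 13, 17, 19, 23}" using prime_mod_24 \<open>Factorial_Ring.prime p\<close> p by (simp only: m_def)
  have m4: "p mod 4 = m mod 4" by (simp add: m_def mod_mod_cancel)
  have "(m, p mod 4, u, v, w) \<in> {(1, 1, 1, 1, 1), (5, 1, 1, - 1, - 1), (7, 3, - 1, 1, - 1), (11, 3, - 1, - 1, 1),
    (13, 1, 1, - 1, 1), (17, 1, 1, 1, - 1), (19, 3, - 1, - 1, - 1), (23, 3, - 1, 1, 1)}"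
    unfolding m4 using r quad_char_small_values[OF p, folded u_def v_def w_def m_def] by auto
  from pattern_table[OF this character_sum(2)[OF p a u_def] count, folded S]
  have "16 * real (pattern_count p S) = real p - real_of_int (A_term a0 a1 a4 S (p mod 4)) + 16 * C_term S (p mod 24)"
    and C: "\<bar>C_term S (p mod 24)\<bar> \<le> 39 / 16" unfolding m_def by simp_all
  then show "real (pattern_count p S) = real p / 16 - real_of_int (A_term a0 a1 a4 S (p mod 4)) / 16 + C_term S (p mod 24)"
    by linarith
  show "\<bar>C_term S (p mod 24)\<bar> \<le> 39 / 16" by (rule C)
qed

section \<open>Transfer to the curve of a word\<close>

lemma diagonal_curve_word_coeff:
  fixes ep em :: "'p::prime_card mod_ring"
  assumes p: "CARD('p) > 4" and e: "ep \<noteq> 0" "em \<noteq> 0"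
  shows "diagonal_curve (word_coeff (to_ac ep) (to_ac em) S)"
proof
  have "(2 :: 'p mod_ring) \<noteq> 0" "(3 :: 'p mod_ring) \<noteq> 0"
    using mod_ring_small_nonzero[of 2, where 'p = 'p] mod_ring_small_nonzero[of 3, where 'p = 'p] p by simp_all
  then show "(2 :: 'p mod_ring alg_closure) \<noteq> 0" "(3 :: 'p mod_ring alg_closure) \<noteq> 0"
    by (metis to_ac_eq_0_iff to_ac_numeral)+
qed (use e in \<open>simp add: word_coeff_def\<close>)

text \<open>Affine points carry 0 at index 0, vectors in the chart carry 1 there; changing this
  entry matches the two sets.\<close>

lemma (in diagonal_curve) affine_part_iff:
  assumes "\<And>i. e i = word_coeff ep em S i" "length S = 4"
  shows "affine_part = (\<lambda>x. x(0 := 1)) ` word_curve ep em S"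
    and "word_curve ep em S = {x \<in> affine_space 4. x(0 := 1) \<in> proj_curve}"
proof -
  have mem: "x(0 := 1) \<in> proj_curve \<longleftrightarrow> x \<in> word_curve ep em S" if x: "x \<in> affine_space 4" for x
  proof -
    have "x(0 := 1) \<in> proj_space 4"
      using x unfolding affine_space_def proj_space_def by (auto simp: fun_eq_iff intro: exI[of _ 0])
    then show ?thesis
      unfolding proj_curve_iff word_curve_4_iff[OF assms(2)] assms(1)[symmetric] using x by simp
  qed
  show eq: "word_curve ep em S = {x \<in> affine_space 4. x(0 := 1) \<in> proj_curve}"
    using mem word_curve_4_iff[OF assms(2)] by blast
  show "affine_part = (\<lambda>x. x(0 := 1)) ` word_curve ep em S"
  proof
    show "affine_part \<subseteq> (\<lambda>x. x(0 := 1)) ` word_curve ep em S"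
    proof
      fix v assume v: "v \<in> affine_part"
      then have "v = (v(0 := 0))(0 := 1)" by (auto simp: affine_part_def)
      moreover have "v(0 := 0) \<in> affine_space 4"
        using v by (auto simp: affine_part_def proj_curve_def proj_space_def affine_space_def)
      moreover have "(v(0 := 0))(0 := 1) \<in> proj_curve" using v calculation(1) by (simp add: affine_part_def)
      ultimately show "v \<in> (\<lambda>x. x(0 := 1)) ` word_curve ep em S" unfolding eq by blast
    qed
    show "(\<lambda>x. x(0 := 1)) ` word_curve ep em S \<subseteq> affine_part"
      unfolding eq affine_part_def by auto
  qed
qed

theorem theorem1:
  fixes eps_plus eps_minus :: "'p::prime_card mod_ring"
    and S :: "letter list" and p :: nat and a0 a1 a4 :: int
  assumes "p = CARD('p)" and "p \<ge> 5"
    and "eps_plus \<noteq> 0" and "\<exists>y. eps_plus = y ^ 2"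
    and "\<not> (\<exists>y. eps_minus = y ^ 2)"
    and "length S = 4"
    and "a0 = frobenius_trace (E0 :: 'p mod_ring poly)"
    and "a1 = frobenius_trace (E1 :: 'p mod_ring poly)"
    and "a4 = frobenius_trace (E4 :: 'p mod_ring poly)"
  shows "smooth_projective_model 4 (projective_word_curve eps_plus eps_minus S)
           (geometric_word_curve eps_plus eps_minus S)
       \<and> genus 4 (projective_word_curve eps_plus eps_minus S) = 5
       \<and> real (pattern_count p S) = real (card (word_curve_nonzero eps_plus eps_minus S)) / 2 ^ 4
       \<and> real (pattern_count p S) =
           real p / 16 - real_of_int (A_term a0 a1 a4 S (p mod 4)) / 16 + C_term S (p mod 24)
       \<and> \<bar>C_term S (p mod 24)\<bar> \<le> 39 / 16"
proof -
  have p: "p > 4" "CARD('p) > 4" "CARD('p) > 2" using assms(1,2) by simp_all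
  have em: "eps_minus \<noteq> 0" using assms(5) by (metis zero_power2)
  interpret diagonal_curve "word_coeff (to_ac eps_plus) (to_ac eps_minus) S"
    by (rule diagonal_curve_word_coeff[OF p(2) assms(3) em])
  note affine = affine_part_iff[OF refl assms(6)]
  have closure: "projective_word_curve eps_plus eps_minus S = proj_curve"
    unfolding projective_word_curve_def projective_closure_def geometric_word_curve_def assms(6)
      affine(1)[symmetric] closure_affine_part ..
  have "geometric_word_curve eps_plus eps_minus S \<noteq> {}"
    using curve_point_in affine(1) by (auto simp: geometric_word_curve_def)
  then have "smooth_projective_model 4 (projective_word_curve eps_plus eps_minus S) (geometric_word_curve eps_plus eps_minus S)"
    unfolding smooth_projective_model_def closure
    using nonsingular_proj_curve affine(2) by (simp add: geometric_word_curve_def)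
  moreover have "genus 4 (projective_word_curve eps_plus eps_minus S) = 5"
    unfolding closure by (rule genus_proj_curve)
  moreover have "real (pattern_count p S) = real (card (word_curve_nonzero eps_plus eps_minus S)) / 2 ^ 4"
  proof -
    obtain s1 s2 s3 s4 where S: "S = [s1, s2, s3, s4]"
      using assms(6) by (auto simp: eval_nat_numeral length_Suc_conv)
    \<comment> \<open>Points and patterns are counted by the same sum over t.\<close>
    have "16 * int (pattern_count p S) = int (card (word_curve_nonzero eps_plus eps_minus S))"
      unfolding card_word_curve_nonzero[OF p(3) assms(3-5) S] by (rule pattern_count_eq[OF assms(1) p(1) S])
    then show ?thesis by simp
  qed
  ultimately show ?thesis
    using pattern_count_formula[OF assms(1) p(1) assms(6-9)] by blast
qed

end
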